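(* Let $\mathcal C$ be one of the sets $\mathcal K^{2,r}_{\mathbf m,\mathbf p}$ (with $N=2$), $\mathcal K^{N}_{\mathbf m,\mathbf p}$, ${}^c\mathcal K^{N,r}_{\mathbf m,\mathbf p}$ (for some $c>0$), or $\overline{\mathcal K}^{N,r}_{\mathbf m,\mathbf p}$, and suppose the generating dictionary satisfies $\mathbf D^0\in\mathcal C$ and the coefficient, noise and parameter assumptions below hold. Then for any $\rho$ with $\bar\lambda C_{\min}<\rho<\bar\lambda C_{\max}$ and $\frac{M_\epsilon}{M_x}<\frac72(\bar\lambda C_{\max}-\rho)$, the function $\mathbf D\in\mathcal C\mapsto f_{\mathcal P}(\mathbf D)$ has a local minimum $\mathbf D^*$ (local relative to $\mathcal C$) with $\|\mathbf D^*-\mathbf D^0\|_F<\rho$.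
   Context: Let $N\ge2$, $m_n,p_n\ge1$, $m=\prod_n m_n$, $p=\prod_n p_n$. The oblique manifold $\mathcal D_{m\times p}$ is the set of $m\times p$ matrices with unit $\ell_2$-norm columns. The separation rank $\mathfrak R^N_{\mathbf m,\mathbf p}(\mathbf A)$ is the minimum $r$ with $\mathbf A=\sum_{k=1}^r\mathbf A^k_1\otimes\cdots\otimes\mathbf A^k_N$, $\mathbf A^k_n\in\mathbb R^{m_n\times p_n}$. Define $\mathcal K^{N,r}_{\mathbf m,\mathbf p}=\{\mathbf D\in\mathcal D_{m\times p}:\mathfrak R^N_{\mathbf m,\mathbf p}(\mathbf D)\le r\}$, $\mathcal K^N_{\mathbf m,\mathbf p}=\mathcal K^{N,1}_{\mathbf m,\mathbf p}$, $\mathcal K^{2,r}_{\mathbf m,\mathbf p}$ the case $N=2$, ${}^c\mathcal K^{N,r}_{\mathbf m,\mathbf p}$ the set of $\mathbf D\in\mathcal D_{m\times p}$ expressible as $\sum_{k=1}^r\bigotimes_n\mathbf D^k_n$ with $\|\bigotimes_n\mathbf D^k_n\|_F\le c$ for all $k$, and $\overline{\mathcal K}^{N,r}_{\mathbf m,\mathbf p}$ the closure of $\mathcal K^{N,r}_{\mathbf m,\mathbf p}$ in Frobenius norm. Generative model: a sample is $\mathbf y=\mathbf D^0\mathbf x^0+\boldsymbol\varepsilon\in\mathbb R^m$, where a support $\mathcal J\subset[p]$ with $|\mathcal J|=s$ is chosen uniformly at random and $\mathbf x^0\in\mathbb R^p$ is a random vector supported on $\mathcal J$; $\mathbf s^0=\mathrm{sgn}(\mathbf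 x^0)$. Coefficient assumption: for a real random variable $x$ and constants $M_x,\underline x>0$: $\mathbb E\{\mathbf x^0_{\mathcal J}[\mathbf x^0_{\mathcal J}]^T|\mathcal J\}=\mathbb E\{x^2\}\mathbf I_s$, $\mathbb E\{\mathbf s^0_{\mathcal J}[\mathbf s^0_{\mathcal J}]^T|\mathcal J\}=\mathbf I_s$, $\mathbb E\{\mathbf s^0_{\mathcal J}[\mathbf x^0_{\mathcal J}]^T|\mathcal J\}=\mathbb E\{|x|\}\mathbf I_s$, $\|\mathbf x^0\|_2\le M_x$ and $\min_{j\in\mathcal J}|x^0_j|\ge\underline x$ a.s. Noise assumption: for a real random variable $\epsilon$ and constant $M_\epsilon>0$: $\mathbb E\{\boldsymbol\varepsilon\boldsymbol\varepsilon^T|\mathcal J\}=\mathbb E\{\epsilon^2\}\mathbf I_m$, $\mathbb E\{\mathbf x^0\boldsymbol\varepsilon^T|\mathcal J\}=\mathbb E\{\mathbf s^0\boldsymbol\varepsilon^T|\mathcal J\}=0$, $\|\boldsymbol\varepsilon\|_2\le M_\epsilon$ a.s. Parameters: $\lambda>0$, $\bar\lambda=\lambda/\mathbb E\{|x|\}$, $C_{\min}=24\frac{\mathbb E\{|x|\}^2}{\mathbb E\{x^2\}}(\|\mathbf D^0\|_2+1)^2\frac sp\|[\mathbf D^0]^T\mathbf D^0-\mathbf I\|_F$, $C_{\max}=\frac{2\mathbb E\{|x|\}}{7M_x}(1-2\mu_s(\mathbf D^0))$, where the cumulative coherence is $\mu_s(\mathbf D)=\max_{|\mathcal J|\le s}\max_{j\notin\mathcal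 J}\|\mathbf D_{\mathcal J}^T\mathbf d_j\|_1$. Parameter assumption: $C_{\min}\le C_{\max}$, $\lambda\le\underline x/4$, $s\le\frac{p}{16(\|\mathbf D^0\|_2+1)^2}$, $\mu_s(\mathbf D^0)\le1/4$, $\frac{M_\epsilon}{M_x}<\frac72(C_{\max}-C_{\min})\bar\lambda$. Objective: $f_{\mathbf y}(\mathbf D)=\inf_{\mathbf x\in\mathbb R^p}\frac12\|\mathbf y-\mathbf D\mathbf x\|_2^2+\lambda\|\mathbf x\|_1$ and $f_{\mathcal P}(\mathbf D)=\mathbb E_{\mathbf y}f_{\mathbf y}(\mathbf D)$ with $\mathbf y$ drawn from the model. *)

theory Defs
  imports "HOL-Probability.Probability"
begin

type_synonym rmat = "nat \<Rightarrow> nat \<Rightarrow> real"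

definition mats :: "nat \<Rightarrow> nat \<Rightarrow> rmat set" where
  "mats m p = {A. \<forall>i j. (m \<le> i \<or> p \<le> j) \<longrightarrow> A i j = 0}"

definition frob :: "nat \<Rightarrow> nat \<Rightarrow> rmat \<Rightarrow> real" where
  "frob m p A = sqrt (\<Sum>i<m. \<Sum>j<p. (A i j)\<^sup>2)"

definition frob_dist :: "nat \<Rightarrow> nat \<Rightarrow> rmat \<Rightarrow> rmat \<Rightarrow> real" where
  "frob_dist m p A B = frob m p (\<lambda>i j. A i j - B i j)"

definition oblique :: "nat \<Rightarrow> nat \<Rightarrow> rmat set" where
  "oblique m p = {D \<in> mats m p. \<forall>j<p. (\<Sum>i<m. (D i j)\<^sup>2) = 1}"

definition kron2 :: "nat \<Rightarrow> nat \<Rightarrow> rmat \<Rightarrow> rmat \<Rightarrow> rmat" where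
  "kron2 m2 p2 A B = (\<lambda>i j. A (i div m2) (j div p2) * B (i mod m2) (j mod p2))"

fun kronN :: "nat \<Rightarrow> (nat \<Rightarrow> nat) \<Rightarrow> (nat \<Rightarrow> nat) \<Rightarrow> (nat \<Rightarrow> rmat) \<Rightarrow> rmat" where
  "kronN 0 ms ps A = (\<lambda>i j. if i = 0 \<and> j = 0 then 1 else 0)"
| "kronN (Suc n) ms ps A = kron2 (ms n) (ps n) (kronN n ms ps A) (A n)"

definition is_kron_decomp ::
  "nat \<Rightarrow> (nat \<Rightarrow> nat) \<Rightarrow> (nat \<Rightarrow> nat) \<Rightarrow> nat \<Rightarrow> (nat \<Rightarrow> nat \<Rightarrow> rmat) \<Rightarrow> rmat \<Rightarrow> bool" where
  "is_kron_decomp N ms ps r Ak A \<longleftrightarrow>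
     (\<forall>k<r. \<forall>n<N. Ak k n \<in> mats (ms n) (ps n)) \<and>
     A = (\<lambda>i j. \<Sum>k<r. kronN N ms ps (Ak k) i j)"

definition sep_rank :: "nat \<Rightarrow> (nat \<Rightarrow> nat) \<Rightarrow> (nat \<Rightarrow> nat) \<Rightarrow> rmat \<Rightarrow> nat" where
  "sep_rank N ms ps A = (LEAST r. \<exists>Ak. is_kron_decomp N ms ps r Ak A)"

definition Kset :: "nat \<Rightarrow> (nat \<Rightarrow> nat) \<Rightarrow> (nat \<Rightarrow> nat) \<Rightarrow> nat \<Rightarrow> rmat set" where
  "Kset N ms ps r = {D \<in> oblique (\<Prod>n<N. ms n) (\<Prod>n<N. ps n). sep_rank N ms ps D \<le> r}"

definition cKset :: "real \<Rightarrow> nat \<Rightarrow> (nat \<Rightarrow> nat) \<Rightarrow> (nat \<Rightarrow> nat) \<Rightarrow> nat \<Rightarrow> rmat set" where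
  "cKset c N ms ps r = {D \<in> oblique (\<Prod>n<N. ms n) (\<Prod>n<N. ps n).
      \<exists>Ak. is_kron_decomp N ms ps r Ak D \<and>
        (\<forall>k<r. frob (\<Prod>n<N. ms n) (\<Prod>n<N. ps n) (kronN N ms ps (Ak k)) \<le> c)}"

definition Kbar :: "nat \<Rightarrow> (nat \<Rightarrow> nat) \<Rightarrow> (nat \<Rightarrow> nat) \<Rightarrow> nat \<Rightarrow> rmat set" where
  "Kbar N ms ps r = {D \<in> mats (\<Prod>n<N. ms n) (\<Prod>n<N. ps n).
      \<forall>e>0. \<exists>D'\<in>Kset N ms ps r. frob_dist (\<Prod>n<N. ms n) (\<Prod>n<N. ps n) D D' < e}"

definition opnorm2 :: "nat \<Rightarrow> nat \<Rightarrow> rmat \<Rightarrow> real" where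
  "opnorm2 m p D = (SUP x\<in>{x :: nat \<Rightarrow> real. (\<forall>j\<ge>p. x j = 0) \<and> (\<Sum>j<p. (x j)\<^sup>2) \<le> 1}.
       sqrt (\<Sum>i<m. (\<Sum>j<p. D i j * x j)\<^sup>2))"

definition gram_minus_id :: "nat \<Rightarrow> nat \<Rightarrow> rmat \<Rightarrow> rmat" where
  "gram_minus_id m p D = (\<lambda>k j. if k < p \<and> j < p then
       (\<Sum>i<m. D i k * D i j) - (if k = j then 1 else 0) else 0)"

definition cum_coherence :: "nat \<Rightarrow> nat \<Rightarrow> nat \<Rightarrow> rmat \<Rightarrow> real" where
  "cum_coherence s m p D = Max {(\<Sum>k\<in>J. \<bar>\<Sum>i<m. D i k * D i j\<bar>) | J j.
       J \<subseteq> {..<p} \<and> card J \<le> s \<and> j < p \<and> j \<notin> J}"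

definition f_y :: "real \<Rightarrow> nat \<Rightarrow> nat \<Rightarrow> (nat \<Rightarrow> real) \<Rightarrow> rmat \<Rightarrow> real" where
  "f_y lam m p y D = (INF x\<in>{x :: nat \<Rightarrow> real. \<forall>j\<ge>p. x j = 0}.
      1/2 * (\<Sum>i<m. (y i - (\<Sum>j<p. D i j * x j))\<^sup>2) + lam * (\<Sum>j<p. \<bar>x j\<bar>))"

definition cexpJ :: "'a measure \<Rightarrow> ('a \<Rightarrow> nat set) \<Rightarrow> nat set \<Rightarrow> ('a \<Rightarrow> real) \<Rightarrow> real" where
  "cexpJ M J S X = (\<integral>\<omega>. indicator {\<omega> \<in> space M. J \<omega> = S} \<omega> * X \<omega> \<partial>M)
                    / measure M {\<omega> \<in> space M. J \<omega> = S}"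

definition local_min_on :: "rmat set \<Rightarrow> (rmat \<Rightarrow> real) \<Rightarrow> (rmat \<Rightarrow> rmat \<Rightarrow> real) \<Rightarrow> rmat \<Rightarrow> bool" where
  "local_min_on C f d D \<longleftrightarrow> D \<in> C \<and> (\<exists>e>0. \<forall>D'\<in>C. d D' D < e \<longrightarrow> f D \<le> f D')"

end

theory Submission
  imports Defs
begin

text \<open>Each of the four constraint sets is compact and \<open>fP\<close> is continuous, so \<open>fP\<close> attains a minimum
  on the part of the set within distance \<open>\<rho>\<close> of \<open>D0\<close>; it suffices to show \<open>fP D0 < fP D\<close> whenever
  \<open>D\<close> has distance exactly \<open>\<rho>\<close>. Given the support \<open>S\<close> and the signs of the coefficients, the
  quadratic program with these signs has an explicit value. It bounds \<open>f_y\<close> at \<open>D\<close> from below, since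
  its residual is feasible for the dual of the lasso, and at \<open>D0\<close> from above, since its solution has
  the prescribed signs. The conditional expectation of the explicit value is a combination of traces
  in \<open>G\<close> (the Gram matrix of the columns in \<open>S\<close>), its inverse and \<open>K = D\<^sup>T (D - D0)\<close>. Columns
  have unit norm, so the diagonal of \<open>K\<close> is of second order in \<open>\<rho>\<close>, and a pair of columns lies in
  \<open>S\<close> with probability at most \<open>(s/p)\<^sup>2\<close>; averaging over \<open>S\<close> therefore leaves a gap of at
  least a positive multiple of \<open>(s/p) \<rho> (\<rho> - lbar Cmin / 2)\<close>.\<close>

section \<open>Diagonally dominant matrices\<close>

text \<open>The gap on the sphere is only of order (s/p) \<rho>^2, while the trace of H K looks like
  a quantity of first order in \<rho>; this is the obstacle. It is removed by splitting matrices
  into diagonal and off-diagonal parts: the diagonal of K is already quadratic, and off the diagonal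
  H equals minus H times the off-diagonal part of G. Every product of off-diagonal parts is a sum
  over pairs of indices, hence carries (s/p)^2, and one factor s/p is absorbed through s (||D0|| +
  1)^2 \<le> p/16. What remains of the off-diagonal part of the Gram matrix of \<open>D0\<close> is
  the Frobenius norm in \<open>Cmin\<close>. \<open>Cmax\<close> has a different source: relative to
  \<open>D\<close> the sample is perturbed by the noise and by (D0 - D) x0, and dual feasibility of
  the residual tolerates a perturbation up to lam (1 - 2a), with a the coherence of
  \<open>D\<close>. Compactness needs bounded summands: with three or more factors, sums of r
  products may converge, by cancellation of unbounded summands, to a limit that is no such
  sum.\<close>

lemma posdef_solvable:
  fixes A :: "nat \<Rightarrow> nat \<Rightarrow> real"
  assumes "finite S"
    and "\<And>x. (\<exists>i\<in>S. x i \<noteq> 0) \<Longrightarrow> (\<Sum>i\<in>S. \<Sum>j\<in>S. x i * A i j * x j) > 0"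
  shows "\<exists>x. \<forall>i\<in>S. (\<Sum>j\<in>S. A i j * x j) = b i"
  using assms
proof (induction S arbitrary: b rule: finite_induct)
  case empty
  show ?case by simp
next
  case (insert a S)
  have pos: "(\<Sum>i\<in>S. \<Sum>j\<in>S. x i * A i j * x j) > 0" if ex: "\<exists>i\<in>S. x i \<noteq> 0" for x
  proof -
    let ?x = "x(a := 0)"
    have upd: "?x i = x i" if "i \<in> S" for i
      using that insert.hyps(2) by auto
    have "(\<Sum>i\<in>insert a S. \<Sum>j\<in>insert a S. ?x i * A i j * ?x j) > 0"
      using ex upd by (intro insert.prems) force
    then show ?thesis
      using insert.hyps upd by simp
  qed
  obtain z where z: "\<forall>i\<in>S. (\<Sum>j\<in>S. A i j * z j) = A i a"
    using insert.IH[of "\<lambda>i. A i a"] pos by blast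
  obtain w where w: "\<forall>i\<in>S. (\<Sum>j\<in>S. A i j * w j) = b i"
    using insert.IH[of b] pos by blast
  \<comment> \<open>\<open>c\<close> is the Schur complement of the block on \<open>S\<close>. It is
    the quadratic form at the vector with entry 1 at \<open>a\<close> and \<open>- z\<close> on
    \<open>S\<close>, since the rows in \<open>S\<close> annihilate that vector; hence it is
    positive and the last equation can be solved for \<open>t\<close>.\<close>
  define c where "c = A a a - (\<Sum>j\<in>S. A a j * z j)"
  have cpos: "c > 0"
  proof -
    let ?v = "\<lambda>i. if i = a then 1 else - z i"
    have v: "?v i = - z i" if "i \<in> S" for i
      using that insert.hyps by auto
    have rowS: "(\<Sum>j\<in>insert a S. A i j * ?v j) = A i a - (\<Sum>j\<in>S. A i j * z j)" for i
      using insert.hyps v by (simp add: sum_negf)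
    have "0 < (\<Sum>i\<in>insert a S. \<Sum>j\<in>insert a S. ?v i * A i j * ?v j)"
      by (intro insert.prems) auto
    also have "\<dots> = (\<Sum>i\<in>insert a S. ?v i * (\<Sum>j\<in>insert a S. A i j * ?v j))"
      by (simp add: sum_distrib_left mult.assoc del: sum.insert)
    also have "\<dots> = (\<Sum>i\<in>insert a S. ?v i * (A i a - (\<Sum>j\<in>S. A i j * z j)))"
      by (simp only: rowS)
    also have "\<dots> = c"
      using insert.hyps z by (simp add: c_def)
    finally show ?thesis .
  qed
  define t where "t = (b a - (\<Sum>j\<in>S. A a j * w j)) / c"
  define x where "x = (\<lambda>i. if i = a then t else w i - t * z i)"
  have xS: "x i = w i - t * z i" if "i \<in> S" for i
    using that insert.hyps by (auto simp: x_def)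
  have row: "(\<Sum>j\<in>insert a S. A i j * x j) =
      A i a * t + (\<Sum>j\<in>S. A i j * w j) - t * (\<Sum>j\<in>S. A i j * z j)" for i
    using insert.hyps xS
    by (simp add: x_def right_diff_distrib sum_subtractf sum_distrib_left mult.left_commute)
  have "(\<Sum>j\<in>insert a S. A i j * x j) = b i" if "i \<in> insert a S" for i
  proof (cases "i = a")
    case True
    have "c * t = b a - (\<Sum>j\<in>S. A a j * w j)"
      using cpos by (simp add: t_def)
    then show ?thesis
      unfolding row True c_def by (simp add: algebra_simps)
  next
    case False
    then show ?thesis
      unfolding row using that z w by simp
  qed
  then show ?case by blast
qed

text \<open>In all uses \<open>G\<close> is a Gram matrix of unit vectors, and the last clause is
  what a bound on the cumulative coherence provides. For a < 1 it yields invertibility and bounds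
  for the inverse in the maximum norm and in the Euclidean norm.\<close>

definition row_dominant :: "nat set \<Rightarrow> real \<Rightarrow> (nat \<Rightarrow> nat \<Rightarrow> real) \<Rightarrow> bool" where
  "row_dominant S a G \<longleftrightarrow> finite S \<and> (\<forall>i\<in>S. G i i = 1) \<and> (\<forall>i\<in>S. \<forall>j\<in>S. G i j = G j i) \<and>
     (\<forall>i\<in>S. (\<Sum>j\<in>S - {i}. \<bar>G i j\<bar>) \<le> a)"

lemma row_dominant_split:
  assumes "row_dominant S a G" "i \<in> S"
  shows "(\<Sum>j\<in>S. G i j * x j) = x i + (\<Sum>j\<in>S - {i}. G i j * x j)"
  using assms by (subst sum.remove[of S i]) (auto simp: row_dominant_def)

text \<open>A Gershgorin estimate: 2 |x i x j| is at most (x i)^2 + (x j)^2, and by symmetry of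
  \<open>G\<close> both halves have the same sum, so each square is weighted by one off-diagonal row
  sum.\<close>

lemma row_dominant_quadratic:
  assumes G: "row_dominant S a G"
  shows "\<bar>(\<Sum>i\<in>S. x i * (\<Sum>j\<in>S. G i j * x j)) - (\<Sum>i\<in>S. (x i)\<^sup>2)\<bar> \<le> a * (\<Sum>i\<in>S. (x i)\<^sup>2)"
proof -
  have fin: "finite S" and sym: "\<And>i j. i \<in> S \<Longrightarrow> j \<in> S \<Longrightarrow> G i j = G j i"
    and rb: "\<And>i. i \<in> S \<Longrightarrow> (\<Sum>j\<in>S - {i}. \<bar>G i j\<bar>) \<le> a"
    using G by (auto simp: row_dominant_def)
  have "(\<Sum>i\<in>S. x i * (\<Sum>j\<in>S. G i j * x j)) - (\<Sum>i\<in>S. (x i)\<^sup>2)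
      = (\<Sum>i\<in>S. \<Sum>j\<in>S - {i}. x i * G i j * x j)"
    unfolding sum_subtractf[symmetric]
    by (rule sum.cong)
      (simp_all add: row_dominant_split[OF G] distrib_left power2_eq_square sum_distrib_left mult.assoc)
  also have "\<bar>\<dots>\<bar> \<le> (\<Sum>i\<in>S. \<Sum>j\<in>S - {i}. \<bar>x i * G i j * x j\<bar>)"
    by (intro order.trans[OF sum_abs] sum_mono order_refl)
  also have "\<dots> \<le> (\<Sum>i\<in>S. \<Sum>j\<in>S - {i}. \<bar>G i j\<bar> * (x i)\<^sup>2 / 2 + \<bar>G i j\<bar> * (x j)\<^sup>2 / 2)"
  proof (intro sum_mono)
    fix i j
    have "\<bar>x i\<bar> * \<bar>x j\<bar> \<le> ((x i)\<^sup>2 + (x j)\<^sup>2) / 2"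
      using sum_squares_bound[of "\<bar>x i\<bar>" "\<bar>x j\<bar>"] by simp
    then have "\<bar>G i j\<bar> * (\<bar>x i\<bar> * \<bar>x j\<bar>) \<le> \<bar>G i j\<bar> * (((x i)\<^sup>2 + (x j)\<^sup>2) / 2)"
      by (intro mult_left_mono) auto
    then show "\<bar>x i * G i j * x j\<bar> \<le> \<bar>G i j\<bar> * (x i)\<^sup>2 / 2 + \<bar>G i j\<bar> * (x j)\<^sup>2 / 2"
      by (simp add: abs_mult algebra_simps add_divide_distrib)
  qed
  also have "\<dots> = (\<Sum>i\<in>S. \<Sum>j\<in>S - {i}. \<bar>G i j\<bar> * (x i)\<^sup>2 / 2) +
      (\<Sum>i\<in>S. \<Sum>j\<in>S - {i}. \<bar>G i j\<bar> * (x j)\<^sup>2 / 2)"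
    by (simp add: sum.distrib)
  also have "(\<Sum>i\<in>S. \<Sum>j\<in>S - {i}. \<bar>G i j\<bar> * (x j)\<^sup>2 / 2) = (\<Sum>i\<in>S. \<Sum>j\<in>S - {i}. \<bar>G i j\<bar> * (x i)\<^sup>2 / 2)"
  proof -
    have eq: "(\<Sum>j\<in>S - {i}. f j) = (\<Sum>j\<in>S. if j = i then 0 else f j)"
      for i and f :: "nat \<Rightarrow> real"
      using fin by (intro sum.mono_neutral_cong_left) auto
    show ?thesis
      unfolding eq by (subst sum.swap) (intro sum.cong refl, auto simp: sym)
  qed
  also have "(\<Sum>i\<in>S. \<Sum>j\<in>S - {i}. \<bar>G i j\<bar> * (x i)\<^sup>2 / 2) + (\<Sum>i\<in>S. \<Sum>j\<in>S - {i}. \<bar>G i j\<bar> * (x i)\<^sup>2 / 2)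
      = (\<Sum>i\<in>S. (\<Sum>j\<in>S - {i}. \<bar>G i j\<bar>) * (x i)\<^sup>2)"
    unfolding sum.distrib[symmetric] by (simp add: sum_distrib_right)
  also have "\<dots> \<le> (\<Sum>i\<in>S. a * (x i)\<^sup>2)"
    by (intro sum_mono mult_right_mono rb) auto
  finally show ?thesis by (simp add: sum_distrib_left)
qed

text \<open>At an index where |w| is maximal the off-diagonal terms amount to at most
  \<open>a\<close> times that maximum, so they can be moved to the left-hand side.\<close>

lemma row_dominant_solution_bound_inf:
  assumes G: "row_dominant S a G" and a: "a < 1"
    and sol: "\<And>i. i \<in> S \<Longrightarrow> (\<Sum>j\<in>S. G i j * w j) = v i"
    and v: "\<And>i. i \<in> S \<Longrightarrow> \<bar>v i\<bar> \<le> b" and i: "i \<in> S"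
  shows "\<bar>w i\<bar> \<le> b / (1 - a)"
proof -
  have fin: "finite S" using G by (simp add: row_dominant_def)
  define W where "W = Max ((\<lambda>i. \<bar>w i\<bar>) ` S)"
  have WI: "\<bar>w j\<bar> \<le> W" if "j \<in> S" for j
    using that fin by (auto simp: W_def)
  have "W \<in> (\<lambda>i. \<bar>w i\<bar>) ` S"
    unfolding W_def using fin i by (intro Max_in) auto
  then obtain k where k: "k \<in> S" "W = \<bar>w k\<bar>" by auto
  have W0: "W \<ge> 0" using k by simp
  have "w k = v k - (\<Sum>j\<in>S - {k}. G k j * w j)"
    using sol[OF k(1)] row_dominant_split[OF G k(1), of w] by simp
  then have "W \<le> \<bar>v k\<bar> + \<bar>\<Sum>j\<in>S - {k}. G k j * w j\<bar>"
    using k by simp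
  also have "\<bar>\<Sum>j\<in>S - {k}. G k j * w j\<bar> \<le> (\<Sum>j\<in>S - {k}. \<bar>G k j\<bar> * W)"
    by (intro order.trans[OF sum_abs] sum_mono) (auto simp: abs_mult intro!: mult_left_mono WI)
  also have "\<dots> = (\<Sum>j\<in>S - {k}. \<bar>G k j\<bar>) * W"
    by (simp add: sum_distrib_right)
  also have "\<dots> \<le> a * W"
    using G k W0 by (intro mult_right_mono) (auto simp: row_dominant_def)
  finally have "W * (1 - a) \<le> b"
    using v[OF k(1)] by (simp add: algebra_simps)
  then have "W \<le> b / (1 - a)"
    using a by (simp add: field_simps)
  then show ?thesis using WI[OF i] by linarith
qed

text \<open>By the quadratic form estimate, (1 - a) |w|^2 is at most the inner product of w and v;
  Cauchy-Schwarz then cancels one factor |w|.\<close>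

lemma row_dominant_solution_bound_two:
  assumes G: "row_dominant S a G" and a: "a < 1"
    and sol: "\<And>i. i \<in> S \<Longrightarrow> (\<Sum>j\<in>S. G i j * w j) = v i"
  shows "L2_set w S \<le> 1 / (1 - a) * L2_set v S"
proof -
  have sq: "(\<Sum>i\<in>S. (w i)\<^sup>2) = (L2_set w S)\<^sup>2"
    by (simp add: L2_set_def sum_nonneg)
  have "(1 - a) * (L2_set w S)\<^sup>2 \<le> (\<Sum>i\<in>S. w i * (\<Sum>j\<in>S. G i j * w j))"
    using row_dominant_quadratic[OF G, of w] unfolding sq by (simp add: algebra_simps)
  also have "\<dots> = (\<Sum>i\<in>S. w i * v i)"
    by (intro sum.cong) (auto simp: sol)
  also have "\<dots> \<le> (\<Sum>i\<in>S. \<bar>w i\<bar> * \<bar>v i\<bar>)"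
    by (intro sum_mono) (metis abs_ge_self abs_mult)
  also have "\<dots> \<le> L2_set w S * L2_set v S"
    by (rule L2_set_mult_ineq)
  finally have le: "(1 - a) * (L2_set w S)\<^sup>2 \<le> L2_set w S * L2_set v S" .
  show ?thesis
  proof (cases "L2_set w S = 0")
    case True
    then show ?thesis using a by simp
  next
    case False
    then have "L2_set w S > 0"
      using L2_set_nonneg[of w S] by linarith
    then have "(1 - a) * L2_set w S \<le> L2_set v S"
      using le by (simp add: power2_eq_square mult_ac)
    then show ?thesis using a by (simp add: field_simps)
  qed
qed

text \<open>Solving for each unit vector gives a right inverse. It is symmetric because the bilinear
  form of \<open>G\<close> at two of its columns can be evaluated in either slot, and symmetry turns
  it into a left inverse.\<close>

lemma row_dominant_inverse:
  assumes G: "row_dominant S a G" and a: "a < 1"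
  obtains H where "\<And>i k. i \<in> S \<Longrightarrow> k \<in> S \<Longrightarrow> (\<Sum>j\<in>S. G i j * H j k) = (if i = k then 1 else 0)"
    and "\<And>i k. i \<in> S \<Longrightarrow> k \<in> S \<Longrightarrow> H i k = H k i"
    and "\<And>i k. i \<in> S \<Longrightarrow> k \<in> S \<Longrightarrow> (\<Sum>j\<in>S. H i j * G j k) = (if i = k then 1 else 0)"
proof -
  have fin: "finite S" and sym: "\<And>i j. i \<in> S \<Longrightarrow> j \<in> S \<Longrightarrow> G i j = G j i"
    using G by (auto simp: row_dominant_def)
  have pos: "(\<Sum>i\<in>S. \<Sum>j\<in>S. x i * G i j * x j) > 0" if ex: "\<exists>i\<in>S. x i \<noteq> 0" for x
  proof -
    obtain i where i: "i \<in> S" "x i \<noteq> 0" using ex by blast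
    have "(\<Sum>i\<in>S. (x i)\<^sup>2) > 0"
      using fin i by (intro sum_pos2[of S i]) auto
    then have "0 < (1 - a) * (\<Sum>i\<in>S. (x i)\<^sup>2)"
      using a by simp
    also have "\<dots> \<le> (\<Sum>i\<in>S. x i * (\<Sum>j\<in>S. G i j * x j))"
      using row_dominant_quadratic[OF G, of x] by (simp add: algebra_simps)
    finally show ?thesis by (simp add: sum_distrib_left mult.assoc)
  qed
  have "\<forall>k. \<exists>x. \<forall>i\<in>S. (\<Sum>j\<in>S. G i j * x j) = (if i = k then 1 else 0)"
    by (intro allI posdef_solvable fin pos)
  then obtain h where h: "\<And>k i. i \<in> S \<Longrightarrow> (\<Sum>j\<in>S. G i j * h k j) = (if i = k then 1 else 0)"
    by metis
  have hsym: "h i k = h k i" if "i \<in> S" "k \<in> S" for i k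
  proof -
    have "(\<Sum>l\<in>S. h i l * (\<Sum>j\<in>S. G l j * h k j)) = (\<Sum>l\<in>S. \<Sum>j\<in>S. h i l * G l j * h k j)"
      by (simp add: sum_distrib_left mult.assoc)
    also have "\<dots> = (\<Sum>j\<in>S. \<Sum>l\<in>S. h i l * G l j * h k j)"
      by (rule sum.swap)
    also have "\<dots> = (\<Sum>j\<in>S. h k j * (\<Sum>l\<in>S. G j l * h i l))"
      by (intro sum.cong refl) (auto simp: sum_distrib_left sym intro!: sum.cong)
    finally show ?thesis
      using that fin by (simp add: h if_distrib cong: if_cong)
  qed
  show thesis
  proof (rule that[of "\<lambda>j k. h k j"])
    fix i k assume ik: "i \<in> S" "k \<in> S"
    show "(\<Sum>j\<in>S. G i j * h k j) = (if i = k then 1 else 0)"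
      using h ik by blast
    show "h k i = h i k" using hsym ik by simp
    have "(\<Sum>j\<in>S. h j i * G j k) = (\<Sum>j\<in>S. G k j * h i j)"
      using ik hsym sym by (intro sum.cong) auto
    then show "(\<Sum>j\<in>S. h j i * G j k) = (if i = k then 1 else 0)"
      using h[OF ik(2)] by auto
  qed
qed

section \<open>Kronecker products and compactness of the constraint sets\<close>

lemma frob_L2_set: "frob m p A = L2_set (\<lambda>(i, j). A i j) ({..<m} \<times> {..<p})"
  by (simp add: frob_def L2_set_def sum.cartesian_product case_prod_unfold)

lemma frob_nonneg [simp]: "frob m p A \<ge> 0"
  by (simp add: frob_L2_set)

lemma frob_dist_nonneg [simp]: "frob_dist m p A B \<ge> 0"
  by (simp add: frob_dist_def)

lemma frob_dist_self [simp]: "frob_dist m p A A = 0"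
  by (simp add: frob_dist_def frob_def)

lemma frob_dist_commute: "frob_dist m p A B = frob_dist m p B A"
  by (simp add: frob_dist_def frob_def power2_commute)

lemma frob_triangle: "frob m p (\<lambda>i j. A i j + B i j) \<le> frob m p A + frob m p B"
  using L2_set_triangle_ineq[of "\<lambda>(i, j). A i j" "\<lambda>(i, j). B i j" "{..<m} \<times> {..<p}"]
  by (simp add: frob_L2_set case_prod_unfold)

lemma frob_dist_triangle: "frob_dist m p A C \<le> frob_dist m p A B + frob_dist m p B C"
  using frob_triangle[of m p "\<lambda>i j. A i j - B i j" "\<lambda>i j. B i j - C i j"]
  by (simp add: frob_dist_def)

lemma frob_scale: "frob m p (\<lambda>i j. c * A i j) = \<bar>c\<bar> * frob m p A"
  by (simp add: frob_def power_mult_distrib real_sqrt_mult flip: sum_distrib_left)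

lemma entry_le_frob:
  assumes "i < m" "j < p"
  shows "\<bar>A i j\<bar> \<le> frob m p A"
proof -
  have "\<bar>A i j\<bar> = (\<lambda>(i, j). \<bar>A i j\<bar>) (i, j)" by simp
  also have "\<dots> \<le> L2_set (\<lambda>(i, j). \<bar>A i j\<bar>) ({..<m} \<times> {..<p})"
    using assms by (intro member_le_L2_set) auto
  also have "\<dots> = frob m p A"
    by (simp add: frob_L2_set L2_set_def case_prod_unfold)
  finally show ?thesis .
qed

lemma frob_sq: "(frob m p A)\<^sup>2 = (\<Sum>i<m. \<Sum>j<p. (A i j)\<^sup>2)"
  by (simp add: frob_def sum_nonneg)

lemma frob_oblique:
  assumes "D \<in> oblique m p"
  shows "frob m p D = sqrt p"
proof -
  have "(\<Sum>i<m. \<Sum>j<p. (D i j)\<^sup>2) = (\<Sum>j<p. \<Sum>i<m. (D i j)\<^sup>2)"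
    by (rule sum.swap)
  also have "\<dots> = p"
    using assms by (simp add: oblique_def)
  finally show ?thesis by (simp add: frob_def)
qed

section \<open>Kronecker products and separation rank\<close>

lemma sum_div_mod:
  fixes f :: "nat \<Rightarrow> nat \<Rightarrow> 'b :: comm_monoid_add"
  shows "(\<Sum>i<a * b. f (i div b) (i mod b)) = (\<Sum>u<a. \<Sum>v<b. f u v)"
proof -
  have "(\<Sum>i<a * b. f (i div b) (i mod b)) = (\<Sum>(u, v)\<in>{..<a} \<times> {..<b}. f u v)"
  proof (rule sum.reindex_bij_witness[of _ "\<lambda>(u, v). u * b + v" "\<lambda>i. (i div b, i mod b)"])
    fix i assume i: "i \<in> {..<a * b}"
    then have "b > 0" by (auto intro: gr0I)
    then show "(i div b, i mod b) \<in> {..<a} \<times> {..<b}"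
      using i by (auto simp: less_mult_imp_div_less)
  next
    fix w assume "w \<in> {..<a} \<times> {..<b}"
    then obtain u v where w: "w = (u, v)" "u < a" "v < b" by auto
    have "u * b + v < (u + 1) * b" using w by simp
    also have "\<dots> \<le> a * b" using w by (intro mult_le_mono1) simp
    finally show "(case w of (u, v) \<Rightarrow> u * b + v) \<in> {..<a * b}"
      using w by simp
  qed auto
  then show ?thesis by (simp add: sum.cartesian_product)
qed

lemma frob_kron2: "frob (a * m) (b * p) (kron2 m p A B) = frob a b A * frob m p B"
proof -
  have "(\<Sum>i<a * m. \<Sum>j<b * p. (kron2 m p A B i j)\<^sup>2) =
      (\<Sum>i<a * m. (\<lambda>u v. \<Sum>j<b * p. (\<lambda>s t. (A u s)\<^sup>2 * (B v t)\<^sup>2) (j div p) (j mod p)) (i div m) (i mod m))"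
    by (simp add: kron2_def power_mult_distrib)
  also have "\<dots> = (\<Sum>u<a. \<Sum>v<m. \<Sum>s<b. \<Sum>t<p. (A u s)\<^sup>2 * (B v t)\<^sup>2)"
    by (subst sum_div_mod, subst sum_div_mod) simp
  also have "\<dots> = (\<Sum>u<a. \<Sum>s<b. (A u s)\<^sup>2) * (\<Sum>v<m. \<Sum>t<p. (B v t)\<^sup>2)"
  proof -
    have "(\<Sum>v<m. \<Sum>s<b. \<Sum>t<p. (A u s)\<^sup>2 * (B v t)\<^sup>2) =
        (\<Sum>s<b. (A u s)\<^sup>2) * (\<Sum>v<m. \<Sum>t<p. (B v t)\<^sup>2)" for u
      by (subst sum.swap) (simp add: sum_distrib_left sum_distrib_right mult.commute)
    then show ?thesis by (simp add: sum_distrib_right)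
  qed
  finally show ?thesis by (simp add: frob_def real_sqrt_mult)
qed

lemma frob_kronN:
  "frob (\<Prod>n<N. ms n) (\<Prod>n<N. ps n) (kronN N ms ps A) = (\<Prod>n<N. frob (ms n) (ps n) (A n))"
  by (induction N) (simp_all add: frob_kron2, simp add: frob_def)

lemma kronN_scale:
  "kronN N ms ps (\<lambda>n i j. c n * A n i j) i j = (\<Prod>n<N. c n) * kronN N ms ps A i j"
  by (induction N arbitrary: i j) (simp_all add: kron2_def)

lemma kronN_cong:
  assumes "\<And>n. n < N \<Longrightarrow> A n = B n"
  shows "kronN N ms ps A = kronN N ms ps B"
  using assms by (induction N) simp_all

lemma kronN_zero:
  assumes "n < N" "A n = (\<lambda>i j. 0)"
  shows "kronN N ms ps A = (\<lambda>i j. 0)"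
  using assms by (induction N) (auto simp: kron2_def less_Suc_eq)

text \<open>Mixed-radix digits: the remainder of an index by \<open>ms N\<close> or
  \<open>ps N\<close> selects the entry of the last factor and the quotient is treated by induction,
  so each matrix unit is itself a Kronecker product of matrix units.\<close>

lemma kronN_unit:
  assumes "i < (\<Prod>n<N. ms n)" "j < (\<Prod>n<N. ps n)"
  shows "\<exists>F. (\<forall>n<N. F n \<in> mats (ms n) (ps n)) \<and>
    kronN N ms ps F = (\<lambda>a b. if a = i \<and> b = j then 1 else 0)"
  using assms
proof (induction N arbitrary: i j)
  case 0
  then show ?case by (auto intro!: exI[of _ "\<lambda>n i j. 0"])
next
  case (Suc N)
  have pos: "ms N > 0" "ps N > 0"
    using Suc.prems by (auto intro: gr0I)
  have "i div ms N < (\<Prod>n<N. ms n)" "j div ps N < (\<Prod>n<N. ps n)"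
    using Suc.prems by (auto intro: less_mult_imp_div_less)
  then obtain F where F: "\<forall>n<N. F n \<in> mats (ms n) (ps n)"
    "kronN N ms ps F = (\<lambda>a b. if a = i div ms N \<and> b = j div ps N then 1 else 0)"
    using Suc.IH by blast
  let ?e = "\<lambda>a b. if a = i mod ms N \<and> b = j mod ps N then 1 else (0 :: real)"
  let ?F = "F(N := ?e)"
  have e: "?e \<in> mats (ms N) (ps N)"
    using pos by (auto simp: mats_def dest: mod_less_divisor[of _ i] mod_less_divisor[of _ j] intro: leD)
  have eq: "kronN N ms ps ?F = kronN N ms ps F"
    by (rule kronN_cong) simp
  have dm: "(a div k = i div k \<and> a mod k = i mod k) \<longleftrightarrow> a = i" for a i k :: nat
    by (metis div_mult_mod_eq)
  have "kronN (Suc N) ms ps ?F = (\<lambda>a b. if a = i \<and> b = j then 1 else 0)"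
  proof (intro ext)
    fix a b
    have "kronN (Suc N) ms ps ?F a b = (if (a div ms N = i div ms N \<and> a mod ms N = i mod ms N) \<and>
        (b div ps N = j div ps N \<and> b mod ps N = j mod ps N) then 1 else 0)"
      by (simp add: eq F kron2_def)
    then show "kronN (Suc N) ms ps ?F a b = (if a = i \<and> b = j then 1 else 0)"
      unfolding dm .
  qed
  moreover have "\<forall>n<Suc N. ?F n \<in> mats (ms n) (ps n)"
    using F(1) e by (simp add: less_Suc_eq)
  ultimately show ?case by blast
qed

text \<open>\<open>sep_rank\<close> is a \<open>LEAST\<close>, which carries information only if
  some decomposition exists. Here one summand per entry is used.\<close>

lemma is_kron_decomp_exists:
  assumes N: "N \<ge> 1" and A: "A \<in> mats (\<Prod>n<N. ms n) (\<Prod>n<N. ps n)"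
  shows "\<exists>r Ak. is_kron_decomp N ms ps r Ak A"
proof -
  define m where "m = (\<Prod>n<N. ms n)"
  define p where "p = (\<Prod>n<N. ps n)"
  define F where "F i j = (SOME F. (\<forall>n<N. F n \<in> mats (ms n) (ps n)) \<and>
      kronN N ms ps F = (\<lambda>a b. if a = i \<and> b = j then 1 else 0))" for i j
  have FF: "(\<forall>n<N. F i j n \<in> mats (ms n) (ps n)) \<and>
      kronN N ms ps (F i j) = (\<lambda>a b. if a = i \<and> b = j then 1 else 0)"
    if "i < m" "j < p" for i j
    using someI_ex[OF kronN_unit[where i = i and j = j and ms = ms and ps = ps and N = N]] that
    by (simp add: F_def m_def p_def)
  have F: "F i j n \<in> mats (ms n) (ps n)" if "i < m" "j < p" "n < N" for i j n
    using FF[OF that(1,2)] that(3) by blast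
  have FE: "kronN N ms ps (F i j) = (\<lambda>a b. if a = i \<and> b = j then 1 else 0)" if "i < m" "j < p" for i j
    using FF[OF that] by blast
  \<comment> \<open>The coefficient is put into factor 0 alone, which exists because
    \<open>N \<ge> 1\<close>; multilinearity then scales the whole product by it.\<close>
  define G where "G i j = (\<lambda>n a b. (if n = 0 then A i j else 1) * F i j n a b)" for i j
  have G: "G i j n \<in> mats (ms n) (ps n)" if "i < m" "j < p" "n < N" for i j n
    using F[OF that] by (auto simp: G_def mats_def)
  have "(\<Prod>n<N. if n = 0 then c else 1) = c" for c :: real
    using N by (subst prod.delta) auto
  then have GE: "kronN N ms ps (G i j) a b = A i j * (if a = i \<and> b = j then 1 else 0)"
    if "i < m" "j < p" for i j a b
    using FE[OF that] by (simp add: G_def kronN_scale)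
  define Ak where "Ak k = G (k div p) (k mod p)" for k
  have kb: "k div p < m \<and> k mod p < p" if "k < m * p" for k
  proof
    show "k div p < m" using that by (rule less_mult_imp_div_less)
    have "p \<noteq> 0"
      using that by (intro notI) simp
    then show "k mod p < p" by simp
  qed
  have "A a b = (\<Sum>k<m * p. kronN N ms ps (Ak k) a b)" for a b
  proof -
    have "(\<Sum>k<m * p. kronN N ms ps (Ak k) a b) = (\<Sum>i<m. \<Sum>j<p. kronN N ms ps (G i j) a b)"
      unfolding Ak_def by (rule sum_div_mod)
    also have "\<dots> = (\<Sum>i<m. \<Sum>j<p. if j = b then (if i = a then A i j else 0) else 0)"
      by (intro sum.cong refl) (auto simp: GE)
    also have "\<dots> = (if a < m \<and> b < p then A a b else 0)"
      by (cases "b < p") simp_all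
    finally show ?thesis
      using A by (auto simp: mats_def m_def p_def not_less)
  qed
  then have "is_kron_decomp N ms ps (m * p) Ak A"
    unfolding is_kron_decomp_def using kb G by (auto simp: Ak_def)
  then show ?thesis by blast
qed

text \<open>Turns the minimum into the existence of exactly \<open>r\<close> summands: a shorter
  decomposition is padded with zero products, which exist as soon as there is a factor.\<close>

lemma sep_rank_le_iff:
  assumes N: "N \<ge> 1" and A: "A \<in> mats (\<Prod>n<N. ms n) (\<Prod>n<N. ps n)"
  shows "sep_rank N ms ps A \<le> r \<longleftrightarrow> (\<exists>Ak. is_kron_decomp N ms ps r Ak A)"
proof
  assume le: "sep_rank N ms ps A \<le> r"
  have "\<exists>Ak. is_kron_decomp N ms ps (sep_rank N ms ps A) Ak A"
    unfolding sep_rank_def by (rule LeastI_ex) (rule is_kron_decomp_exists[OF assms])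
  then obtain Ak where Ak: "is_kron_decomp N ms ps (sep_rank N ms ps A) Ak A"
    by blast
  define Bk where "Bk k = (if k < sep_rank N ms ps A then Ak k else (\<lambda>n i j. 0))" for k
  have zero: "kronN N ms ps (\<lambda>n i j. 0) = (\<lambda>i j. 0)"
    using N by (intro kronN_zero[of 0]) auto
  have "(\<Sum>k<r. kronN N ms ps (Bk k) i j) = (\<Sum>k<sep_rank N ms ps A. kronN N ms ps (Ak k) i j)" for i j
    using le by (intro sum.mono_neutral_cong_right) (auto simp: Bk_def zero)
  then have "is_kron_decomp N ms ps r Bk A"
    using Ak by (auto simp: is_kron_decomp_def Bk_def mats_def)
  then show "\<exists>Ak. is_kron_decomp N ms ps r Ak A" by blast
next
  assume "\<exists>Ak. is_kron_decomp N ms ps r Ak A"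
  then show "sep_rank N ms ps A \<le> r"
    unfolding sep_rank_def by (rule Least_le)
qed

section \<open>Compactness of the constraint sets in the product topology\<close>

lemma compact_Pi_UNIV:
  fixes X :: "'i \<Rightarrow> 'b :: topological_space set"
  assumes "\<And>i. compact (X i)"
  shows "compact {f. \<forall>i. f i \<in> X i}"
proof -
  have "compactin (product_topology (\<lambda>_. euclidean) UNIV) (PiE UNIV X)"
    unfolding compactin_PiE using assms by simp
  then have "compact (PiE UNIV X)"
    unfolding euclidean_product_topology compactin_euclidean_iff .
  moreover have "PiE UNIV X = {f. \<forall>i. f i \<in> X i}"
    by (auto simp: PiE_UNIV_domain)
  ultimately show ?thesis by simp
qed

lemma continuous_on_entry: "continuous_on S (\<lambda>A :: rmat. A i j)"
  using continuous_on_product_then_coordinatewise[OF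
      continuous_on_product_then_coordinatewise[OF continuous_on_id]] .

text \<open>\<open>rmat\<close> carries the product topology, while \<open>frob_dist\<close> sees
  only a finite block and is a pseudometric. Its continuity is what lets topological compactness
  serve statements about the Frobenius distance.\<close>

lemma continuous_on_frob_dist: "continuous_on S (\<lambda>A. frob_dist m p A B)"
  unfolding frob_dist_def frob_def by (intro continuous_intros continuous_on_entry)

lemma closed_mats: "closed (mats m p)"
  unfolding mats_def
  by (intro closed_Collect_all closed_Collect_imp closed_Collect_eq continuous_on_entry
      continuous_on_const) simp

lemma compact_oblique: "compact (oblique m p)"
proof -
  let ?box = "{D :: rmat. \<forall>i. D i \<in> {v. \<forall>j. v j \<in> {-1..1}}}"
  have box: "compact ?box"
    by (intro compact_Pi_UNIV compact_Icc)
  have "oblique m p = mats m p \<inter> {D. \<forall>j. j < p \<longrightarrow> (\<Sum>i<m. (D i j)\<^sup>2) = 1}"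
    by (auto simp: oblique_def)
  moreover have "closed {D :: rmat. \<forall>j. j < p \<longrightarrow> (\<Sum>i<m. (D i j)\<^sup>2) = 1}"
    by (intro closed_Collect_all closed_Collect_imp closed_Collect_eq continuous_intros
        continuous_on_entry) simp
  ultimately have cl: "closed (oblique m p)"
    using closed_mats by auto
  have "oblique m p \<subseteq> ?box"
  proof
    fix D assume D: "D \<in> oblique m p"
    have "\<bar>D i j\<bar> \<le> 1" for i j
    proof (cases "i < m \<and> j < p")
      case True
      have "(D i j)\<^sup>2 \<le> (\<Sum>i<m. (D i j)\<^sup>2)"
        using True by (intro member_le_sum) auto
      also have "\<dots> = 1" using D True by (simp add: oblique_def)
      finally show ?thesis by (simp add: abs_square_le_1)
    next
      case False
      then have "D i j = 0" using D by (auto simp: oblique_def mats_def not_less)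
      then show ?thesis by simp
    qed
    then show "D \<in> ?box" by (simp add: abs_le_iff minus_le_iff)
  qed
  then have "oblique m p = ?box \<inter> oblique m p" by blast
  then show ?thesis
    using compact_Int_closed[OF box cl] by simp
qed

lemma continuous_on_kronN:
  assumes "\<And>n i j. continuous_on S (\<lambda>x. F x n i j)"
  shows "continuous_on S (\<lambda>x. kronN N ms ps (F x) i j)"
proof (induction N arbitrary: i j)
  case 0
  show ?case by (simp add: continuous_on_const)
next
  case (Suc N)
  show ?case by (simp add: kron2_def) (intro continuous_on_mult Suc assms)
qed

text \<open>Distributing the norm evenly among the factors of each summand confines them to a compact box,
  whose continuous image is the set in question.\<close>

lemma kron_term_balanced:
  assumes N: "N \<ge> 1" and A: "\<forall>n<N. A n \<in> mats (ms n) (ps n)"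
    and c: "frob (\<Prod>n<N. ms n) (\<Prod>n<N. ps n) (kronN N ms ps A) \<le> c"
  shows "\<exists>B. (\<forall>n<N. B n \<in> mats (ms n) (ps n)) \<and> kronN N ms ps B = kronN N ms ps A \<and>
    (\<forall>n<N. frob (ms n) (ps n) (B n) \<le> max 1 c)"
proof (cases "\<exists>n<N. frob (ms n) (ps n) (A n) = 0")
  case True
  then obtain n where n: "n < N" "frob (ms n) (ps n) (A n) = 0" by blast
  have "A n i j = 0" for i j
  proof (cases "i < ms n \<and> j < ps n")
    case True
    then show ?thesis using entry_le_frob[of i "ms n" j "ps n" "A n"] n by simp
  next
    case False
    then show ?thesis using A n by (auto simp: mats_def not_less)
  qed
  then have "kronN N ms ps A = (\<lambda>i j. 0)"
    using n by (intro kronN_zero[of n]) auto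
  moreover have "kronN N ms ps (\<lambda>n i j. 0) = (\<lambda>i j. 0)"
    using n by (intro kronN_zero[of n]) auto
  ultimately show ?thesis
    by (intro exI[of _ "\<lambda>n i j. 0"]) (auto simp: mats_def frob_def le_max_iff_disj)
next
  case False
  define f where "f n = frob (ms n) (ps n) (A n)" for n
  have f: "f n > 0" if "n < N" for n
    using False that frob_nonneg[of "ms n" "ps n" "A n"] unfolding f_def by (metis less_eq_real_def)
  define t where "t = root N (\<Prod>n<N. f n)"
  have P: "(\<Prod>n<N. f n) > 0"
    using f by (intro prod_pos) auto
  have t: "t > 0" "t ^ N = (\<Prod>n<N. f n)"
    using P N by (auto simp: t_def)
  have Pc: "(\<Prod>n<N. f n) \<le> c"
    using c by (simp add: frob_kronN f_def)
  \<comment> \<open>Either \<open>t\<close> is at most 1, or it is at most its power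
    \<open>t ^ N\<close>, the norm of the whole summand; this is where \<open>max 1 c\<close> comes
    from.\<close>
  have tc: "t \<le> max 1 c"
  proof (cases "t \<le> 1")
    case False
    then have "t ^ 1 \<le> t ^ N" using N by (intro power_increasing) auto
    then show ?thesis using t Pc by simp
  qed simp
  let ?B = "\<lambda>n i j. (t / f n) * A n i j"
  have "(\<Prod>n<N. t / f n) = 1"
    using t f by (subst prod_dividef) (auto simp: less_imp_neq[THEN not_sym])
  then have "kronN N ms ps ?B = kronN N ms ps A"
    by (intro ext) (simp only: kronN_scale mult_1)
  moreover have "frob (ms n) (ps n) (?B n) \<le> max 1 c" if "n < N" for n
    unfolding frob_scale f_def[symmetric] using f[OF that] t tc by simp
  ultimately show ?thesis
    using A by (intro exI[of _ ?B]) (auto simp: mats_def)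
qed

lemma compact_cKset:
  assumes N: "N \<ge> 1"
  shows "compact (cKset c N ms ps r)"
proof -
  define m where "m = (\<Prod>n<N. ms n)"
  define p where "p = (\<Prod>n<N. ps n)"
  \<comment> \<open>Entries outside the relevant ranges are pinned to 0, because a product over
    infinitely many indices is compact only if every coordinate set is.\<close>
  define I where "I k n i j = (if k < r \<and> n < N \<and> i < ms n \<and> j < ps n then {- max 1 c..max 1 c} else {0 :: real})"
    for k n i j
  define B where "B = {F :: nat \<Rightarrow> nat \<Rightarrow> rmat. \<forall>k. F k \<in> {F. \<forall>n. F n \<in> {F. \<forall>i. F i \<in> {F. \<forall>j. F j \<in> I k n i j}}}}"
  define K where "K = {F :: nat \<Rightarrow> nat \<Rightarrow> rmat. \<forall>k. k < r \<longrightarrow> frob m p (kronN N ms ps (F k)) \<le> c}"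
  define \<Phi> where "\<Phi> = (\<lambda>(F :: nat \<Rightarrow> nat \<Rightarrow> rmat) i j. \<Sum>k<r. kronN N ms ps (F k) i j)"
  have "compact B"
    unfolding B_def by (intro compact_Pi_UNIV) (auto simp: I_def)
  have cont: "continuous_on UNIV (\<lambda>F :: nat \<Rightarrow> nat \<Rightarrow> rmat. kronN N ms ps (F k) i j)" for k i j
    using continuous_on_product_then_coordinatewise[OF continuous_on_product_then_coordinatewise[OF
          continuous_on_product_then_coordinatewise[OF
            continuous_on_product_then_coordinatewise[OF continuous_on_id]]]]
    by (rule continuous_on_kronN)
  have "closed K"
    unfolding K_def frob_def
    by (intro closed_Collect_all closed_Collect_imp closed_Collect_le continuous_intros cont) simp
  with \<open>compact B\<close> have BK: "compact (B \<inter> K)"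
    by (rule compact_Int_closed)
  have "continuous_on (B \<inter> K) \<Phi>"
    unfolding \<Phi>_def
    by (intro continuous_on_coordinatewise_then_product continuous_on_sum
        continuous_on_subset[OF cont]) auto
  then have im: "compact (\<Phi> ` (B \<inter> K))"
    using BK by (rule compact_continuous_image)
  have "cKset c N ms ps r = oblique m p \<inter> \<Phi> ` (B \<inter> K)"
  proof (intro equalityI subsetI)
    fix D assume D: "D \<in> cKset c N ms ps r"
    then obtain Ak where Ak: "is_kron_decomp N ms ps r Ak D"
      and bd: "\<forall>k<r. frob m p (kronN N ms ps (Ak k)) \<le> c"
      by (auto simp: cKset_def m_def p_def)
    have "\<forall>k. \<exists>B. k < r \<longrightarrow> (\<forall>n<N. B n \<in> mats (ms n) (ps n)) \<and> kronN N ms ps B = kronN N ms ps (Ak k) \<and>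
        (\<forall>n<N. frob (ms n) (ps n) (B n) \<le> max 1 c)"
      using kron_term_balanced[OF N] Ak bd by (auto simp: is_kron_decomp_def m_def p_def)
    then obtain Bk where Bk: "\<And>k n. k < r \<Longrightarrow> n < N \<Longrightarrow> Bk k n \<in> mats (ms n) (ps n)"
      "\<And>k. k < r \<Longrightarrow> kronN N ms ps (Bk k) = kronN N ms ps (Ak k)"
      "\<And>k n. k < r \<Longrightarrow> n < N \<Longrightarrow> frob (ms n) (ps n) (Bk k n) \<le> max 1 c"
      by metis
    define F where "F k n = (if k < r \<and> n < N then Bk k n else (\<lambda>i j. 0))" for k n
    have kF: "kronN N ms ps (F k) = kronN N ms ps (Ak k)" if "k < r" for k
      unfolding Bk(2)[OF that, symmetric] using that by (intro kronN_cong) (simp add: F_def)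
    have "F k n i j \<in> I k n i j" for k n i j
    proof (cases "k < r \<and> n < N")
      case True
      then have "\<bar>Bk k n i j\<bar> \<le> max 1 c" if "i < ms n" "j < ps n"
        using Bk(3)[of k n] entry_le_frob[OF that, of "Bk k n"] by linarith
      then show ?thesis
        using True Bk(1)[of k n] by (auto simp: F_def I_def mats_def not_less abs_le_iff)
    qed (auto simp: F_def I_def)
    then have "F \<in> B \<inter> K"
      using bd kF by (simp add: B_def K_def)
    moreover have "D = \<Phi> F"
      using Ak kF by (simp add: is_kron_decomp_def \<Phi>_def)
    ultimately show "D \<in> oblique m p \<inter> \<Phi> ` (B \<inter> K)"
      using D by (auto simp: cKset_def m_def p_def)
  next
    fix D assume "D \<in> oblique m p \<inter> \<Phi> ` (B \<inter> K)"
    then obtain F where D: "D \<in> oblique m p" "D = \<Phi> F" and F: "F \<in> B" "F \<in> K" by blast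
    have "F k n \<in> mats (ms n) (ps n)" if "k < r" "n < N" for k n
      using F(1) unfolding mats_def B_def I_def
      by (auto simp: not_less split: if_splits)
    then show "D \<in> cKset c N ms ps r"
      using D F by (auto simp: cKset_def K_def is_kron_decomp_def \<Phi>_def m_def p_def)
  qed
  then show ?thesis
    using compact_Int_closed[OF compact_oblique compact_imp_closed[OF im]] by simp
qed

lemma cKset_subset_Kset: "cKset c N ms ps r \<subseteq> Kset N ms ps r"
  by (auto simp: cKset_def Kset_def sep_rank_def intro: Least_le)

text \<open>A single summand is the matrix itself, whose Frobenius norm is sqrt p because its p
  columns have norm 1. So the set is an instance of the one with bounded summands.\<close>

lemma compact_Kset_1:
  assumes N: "N \<ge> 1"
  shows "compact (Kset N ms ps 1)"
proof -
  define m where "m = (\<Prod>n<N. ms n)"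
  define p where "p = (\<Prod>n<N. ps n)"
  have "Kset N ms ps 1 \<subseteq> cKset (sqrt p) N ms ps 1"
  proof
    fix D assume "D \<in> Kset N ms ps 1"
    then have D: "D \<in> oblique m p" "sep_rank N ms ps D \<le> 1"
      by (auto simp: Kset_def m_def p_def)
    then obtain Ak where Ak: "is_kron_decomp N ms ps 1 Ak D"
      using sep_rank_le_iff[OF N, of D] by (auto simp: oblique_def m_def p_def)
    then have "kronN N ms ps (Ak 0) = D"
      by (simp add: is_kron_decomp_def)
    then show "D \<in> cKset (sqrt p) N ms ps 1"
      using D Ak frob_oblique[OF D(1)] by (auto simp: cKset_def m_def p_def)
  qed
  then have "Kset N ms ps 1 = cKset (sqrt p) N ms ps 1"
    using cKset_subset_Kset by blast
  then show ?thesis using compact_cKset[OF N] by simp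
qed

text \<open>The closure is formed inside all matrices, so the unit column norms have to be
  recovered: each column norm is 1-Lipschitz for the Frobenius distance.\<close>

lemma Kbar_subset_oblique: "Kbar N ms ps r \<subseteq> oblique (\<Prod>n<N. ms n) (\<Prod>n<N. ps n)"
proof -
  define m where "m = (\<Prod>n<N. ms n)"
  define p where "p = (\<Prod>n<N. ps n)"
  have Kbar: "Kbar N ms ps r = mats m p \<inter> {D. \<forall>e>0. \<exists>D'\<in>Kset N ms ps r. frob_dist m p D D' < e}"
    by (auto simp: Kbar_def m_def p_def)
  have "Kbar N ms ps r \<subseteq> oblique m p"
  proof
    fix D assume D: "D \<in> Kbar N ms ps r"
    have ob: "Kset N ms ps r \<subseteq> oblique m p" by (auto simp: Kset_def m_def p_def)
    have "(\<Sum>i<m. (D i j)\<^sup>2) = 1" if j: "j < p" for j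
    proof -
      have col: "\<bar>L2_set (\<lambda>i. D i j) {..<m} - 1\<bar> \<le> frob_dist m p D D'" if D': "D' \<in> oblique m p" for D'
      proof -
        have tri: "L2_set f {..<m} \<le> L2_set g {..<m} + L2_set (\<lambda>i. f i - g i) {..<m}" for f g :: "nat \<Rightarrow> real"
          using L2_set_triangle_ineq[of g "\<lambda>i. f i - g i" "{..<m}"] by simp
        have "L2_set (\<lambda>i. D' i j) {..<m} = 1"
          using D' j by (simp add: oblique_def L2_set_def)
        moreover have "L2_set (\<lambda>i. D i j - D' i j) {..<m} \<le> frob_dist m p D D'"
          unfolding L2_set_def frob_dist_def frob_def
          by (intro real_sqrt_le_mono sum_mono member_le_sum) (use j in auto)
        moreover have "L2_set (\<lambda>i. D' i j - D i j) {..<m} = L2_set (\<lambda>i. D i j - D' i j) {..<m}"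
          by (simp add: L2_set_def power2_commute)
        ultimately show ?thesis
          using tri[of "\<lambda>i. D i j" "\<lambda>i. D' i j"] tri[of "\<lambda>i. D' i j" "\<lambda>i. D i j"] by linarith
      qed
      have "\<bar>L2_set (\<lambda>i. D i j) {..<m} - 1\<bar> \<le> e" if "e > 0" for e
      proof -
        obtain D' where "D' \<in> Kset N ms ps r" "frob_dist m p D D' < e"
          using D \<open>e > 0\<close> unfolding Kbar by blast
        then show ?thesis using col ob by fastforce
      qed
      then have "\<bar>L2_set (\<lambda>i. D i j) {..<m} - 1\<bar> \<le> 0"
        by (rule field_le_epsilon) simp
      then show ?thesis by (simp add: L2_set_def)
    qed
    then show "D \<in> oblique m p"
      using D by (auto simp: oblique_def Kbar)
  qed
  then show ?thesis by (simp add: m_def p_def)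
qed

lemma compact_Kbar: "compact (Kbar N ms ps r)"
proof -
  define m where "m = (\<Prod>n<N. ms n)"
  define p where "p = (\<Prod>n<N. ps n)"
  let ?near = "{D. \<forall>e>0. \<exists>D'\<in>Kset N ms ps r. frob_dist m p D D' < e}"
  have Kbar: "Kbar N ms ps r = mats m p \<inter> ?near"
    by (auto simp: Kbar_def m_def p_def)
  have op: "open {D. frob_dist m p D A < e}" for A e
    by (intro open_Collect_less continuous_on_frob_dist continuous_on_const)
  have "open (- ?near)"
    unfolding open_subopen[of "- ?near"]
  proof
    fix A assume "A \<in> - ?near"
    then obtain e where e: "e > 0" "\<And>D'. D' \<in> Kset N ms ps r \<Longrightarrow> frob_dist m p A D' \<ge> e"
      by (auto simp: not_less)
    have "{D. frob_dist m p D A < e / 2} \<subseteq> - ?near"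
    proof
      fix D assume "D \<in> {D. frob_dist m p D A < e / 2}"
      then have "frob_dist m p D D' \<ge> e / 2" if "D' \<in> Kset N ms ps r" for D'
        using e(2)[OF that] frob_dist_triangle[of m p A D' D] by (simp add: frob_dist_commute)
      then show "D \<in> - ?near" using e(1) by (auto simp: not_less intro!: exI[of _ "e / 2"])
    qed
    then show "\<exists>T. open T \<and> A \<in> T \<and> T \<subseteq> - ?near"
      using op[of A "e / 2"] e(1) by (intro exI[of _ "{D. frob_dist m p D A < e / 2}"] conjI) simp_all
  qed
  then have cl: "closed (Kbar N ms ps r)"
    unfolding Kbar using closed_mats by (intro closed_Int) (simp_all add: closed_def)
  have "Kbar N ms ps r \<subseteq> oblique m p"
    using Kbar_subset_oblique by (simp add: m_def p_def)
  then show ?thesis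
    using compact_Int_closed[OF compact_oblique cl, of m p] by (simp add: Int_absorb1)
qed


section \<open>Orthogonal decompositions for two factors\<close>

definition mat_ip :: "nat \<Rightarrow> nat \<Rightarrow> rmat \<Rightarrow> rmat \<Rightarrow> real" where
  "mat_ip m p A B = (\<Sum>i<m. \<Sum>j<p. A i j * B i j)"

lemma mat_ip_commute: "mat_ip m p A B = mat_ip m p B A"
  by (simp add: mat_ip_def mult.commute)

lemma mat_ip_self: "mat_ip m p A A = (frob m p A)\<^sup>2"
  unfolding mat_ip_def frob_sq by (simp only: power2_eq_square)

lemma mat_ip_diff_left: "mat_ip m p (\<lambda>i j. A i j - B i j) C = mat_ip m p A C - mat_ip m p B C"
  by (simp add: mat_ip_def left_diff_distrib sum_subtractf)

lemma mat_ip_sum_left: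
  "mat_ip m p (\<lambda>i j. \<Sum>k\<in>K. c k * A k i j) B = (\<Sum>k\<in>K. c k * mat_ip m p (A k) B)"
proof -
  have "mat_ip m p (\<lambda>i j. \<Sum>k\<in>K. c k * A k i j) B = (\<Sum>i<m. \<Sum>j<p. \<Sum>k\<in>K. c k * (A k i j * B i j))"
    by (simp add: mat_ip_def sum_distrib_right mult.assoc)
  also have "\<dots> = (\<Sum>i<m. \<Sum>k\<in>K. \<Sum>j<p. c k * (A k i j * B i j))"
    by (intro sum.cong refl sum.swap)
  also have "\<dots> = (\<Sum>k\<in>K. \<Sum>i<m. \<Sum>j<p. c k * (A k i j * B i j))"
    by (rule sum.swap)
  finally show ?thesis by (simp add: mat_ip_def sum_distrib_left)
qed

lemma mat_ip_zero_right:
  assumes "mat_ip m p B B = 0"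
  shows "mat_ip m p A B = 0"
proof -
  have "B i j = 0" if "i < m" "j < p" for i j
    using entry_le_frob[OF that, of B] assms by (simp add: mat_ip_self)
  then show ?thesis by (simp add: mat_ip_def)
qed

text \<open>Gram-Schmidt on the first factors, without normalization. Replacing \<open>a r\<close>
  by its residual \<open>w\<close> is compensated by adding multiples of \<open>b r\<close> to the
  earlier second factors, so the number of summands does not grow.\<close>

lemma tensor_sum_orthogonalize:
  fixes a b :: "nat \<Rightarrow> rmat"
  assumes "\<forall>k<r. a k \<in> mats m p" "\<forall>k<r. b k \<in> mats m' p'"
  shows "\<exists>a' b'. (\<forall>k<r. a' k \<in> mats m p) \<and> (\<forall>k<r. b' k \<in> mats m' p') \<and>
    (\<forall>k<r. \<forall>l<r. k \<noteq> l \<longrightarrow> mat_ip m p (a' k) (a' l) = 0) \<and>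
    (\<forall>i j u v. (\<Sum>k<r. a k i j * b k u v) = (\<Sum>k<r. a' k i j * b' k u v))"
  using assms
proof (induction r)
  case 0
  then show ?case by simp
next
  case (Suc r)
  have prems: "\<forall>k<r. a k \<in> mats m p" "\<forall>k<r. b k \<in> mats m' p'"
    using Suc.prems by simp_all
  obtain a' b' where a': "\<forall>k<r. a' k \<in> mats m p" and b': "\<forall>k<r. b' k \<in> mats m' p'"
    and orth0: "\<forall>k<r. \<forall>l<r. k \<noteq> l \<longrightarrow> mat_ip m p (a' k) (a' l) = 0"
    and eq0: "\<forall>i j u v. (\<Sum>k<r. a k i j * b k u v) = (\<Sum>k<r. a' k i j * b' k u v)"
    using Suc.IH[OF prems]
    by (elim exE conjE) (rule that)
  have orth: "mat_ip m p (a' k) (a' l) = 0" if "k < r" "l < r" "k \<noteq> l" for k l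
    using orth0 that by blast
  have eq: "(\<Sum>k<r. a k i j * b k u v) = (\<Sum>k<r. a' k i j * b' k u v)" for i j u v
    using eq0 by blast
  \<comment> \<open>If \<open>a' k\<close> vanishes on the block, the quotient is 0 by the
    convention for division by zero; this is a correct coefficient because the numerator vanishes as
    well.\<close>
  define q where "q k = mat_ip m p (a r) (a' k) / mat_ip m p (a' k) (a' k)" for k
  define w where "w = (\<lambda>i j. a r i j - (\<Sum>k<r. q k * a' k i j))"
  define a2 where "a2 = a'(r := w)"
  define b2 where "b2 k = (if k < r then (\<lambda>u v. b' k u v + q k * b r u v) else b r)" for k
  have w_orth: "mat_ip m p w (a' l) = 0" if l: "l < r" for l
  proof -
    have "mat_ip m p w (a' l) = mat_ip m p (a r) (a' l) - (\<Sum>k<r. q k * mat_ip m p (a' k) (a' l))"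
      unfolding w_def mat_ip_diff_left mat_ip_sum_left ..
    also have "(\<Sum>k<r. q k * mat_ip m p (a' k) (a' l)) = (\<Sum>k\<in>{l}. q k * mat_ip m p (a' k) (a' l))"
      using l orth by (intro sum.mono_neutral_right) auto
    also have "\<dots> = mat_ip m p (a r) (a' l)"
      using mat_ip_zero_right[of m p "a' l" "a r"] by (auto simp: q_def)
    finally show ?thesis by simp
  qed
  have m1: "a2 k \<in> mats m p" if "k < Suc r" for k
    using that a' Suc.prems(1) by (auto simp: a2_def w_def mats_def less_Suc_eq)
  have m2: "b2 k \<in> mats m' p'" if "k < Suc r" for k
    using that b' Suc.prems(2) by (auto simp: b2_def mats_def less_Suc_eq)
  have m3: "mat_ip m p (a2 k) (a2 l) = 0" if "k < Suc r" "l < Suc r" "k \<noteq> l" for k l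
    using that orth[of k l] w_orth[of k] w_orth[of l] mat_ip_commute[of m p w]
    by (auto simp: a2_def less_Suc_eq)
  have m4: "(\<Sum>k<Suc r. a k i j * b k u v) = (\<Sum>k<Suc r. a2 k i j * b2 k u v)" for i j u v
  proof -
    have "(\<Sum>k<r. a2 k i j * b2 k u v) = (\<Sum>k<r. a' k i j * b' k u v) + (\<Sum>k<r. q k * a' k i j) * b r u v"
      unfolding sum_distrib_right sum.distrib[symmetric]
      by (intro sum.cong refl) (simp add: a2_def b2_def algebra_simps)
    then show ?thesis
      by (simp add: eq a2_def b2_def w_def algebra_simps)
  qed
  show ?case
    by (intro exI[of _ a2] exI[of _ b2] conjI allI impI) (assumption | rule m1 m2 m3 m4)+
qed

text \<open>Pythagoras, one entry (u, v) of the second factors at a time: for fixed (u, v) the sum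
  is a combination of the orthogonal \<open>a k\<close> with coefficients
  \<open>b k u v\<close>.\<close>

lemma frob_kron_sum_orthogonal:
  fixes r :: nat
  assumes orth: "\<And>k l. k < r \<Longrightarrow> l < r \<Longrightarrow> k \<noteq> l \<Longrightarrow> mat_ip m p (a k) (a l) = 0"
  shows "(frob (m * m') (p * p') (\<lambda>i j. \<Sum>k<r. kron2 m' p' (a k) (b k) i j))\<^sup>2 =
    (\<Sum>k<r. (frob m p (a k))\<^sup>2 * (frob m' p' (b k))\<^sup>2)"
proof -
  have pyth: "(\<Sum>i<m. \<Sum>j<p. (\<Sum>k<r. c k * a k i j)\<^sup>2) = (\<Sum>k<r. (c k)\<^sup>2 * (frob m p (a k))\<^sup>2)" for c
  proof -
    let ?t = "\<lambda>i j. \<Sum>k<r. c k * a k i j"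
    have "(\<Sum>i<m. \<Sum>j<p. (?t i j)\<^sup>2) = mat_ip m p ?t ?t"
      by (simp add: mat_ip_def power2_eq_square)
    also have "\<dots> = (\<Sum>k<r. c k * (\<Sum>l<r. c l * mat_ip m p (a l) (a k)))"
      by (subst mat_ip_sum_left, subst mat_ip_commute, subst mat_ip_sum_left) simp
    also have "\<dots> = (\<Sum>k<r. (c k)\<^sup>2 * (frob m p (a k))\<^sup>2)"
    proof (intro sum.cong refl)
      fix k assume "k \<in> {..<r}"
      then have "(\<Sum>l<r. c l * mat_ip m p (a l) (a k)) = (\<Sum>l\<in>{k}. c l * mat_ip m p (a l) (a k))"
        using orth by (intro sum.mono_neutral_right) auto
      then show "c k * (\<Sum>l<r. c l * mat_ip m p (a l) (a k)) = (c k)\<^sup>2 * (frob m p (a k))\<^sup>2"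
        by (simp add: mat_ip_self power2_eq_square)
    qed
    finally show ?thesis .
  qed
  have "(frob (m * m') (p * p') (\<lambda>i j. \<Sum>k<r. kron2 m' p' (a k) (b k) i j))\<^sup>2 =
      (\<Sum>i<m * m'. (\<lambda>i u. \<Sum>j<p * p'. (\<lambda>j v. (\<Sum>k<r. b k u v * a k i j)\<^sup>2) (j div p') (j mod p'))
        (i div m') (i mod m'))"
    by (simp add: frob_sq kron2_def mult.commute)
  also have "\<dots> = (\<Sum>i<m. \<Sum>u<m'. \<Sum>j<p. \<Sum>v<p'. (\<Sum>k<r. b k u v * a k i j)\<^sup>2)"
    by (subst sum_div_mod, subst sum_div_mod) simp
  also have "\<dots> = (\<Sum>i<m. \<Sum>u<m'. \<Sum>v<p'. \<Sum>j<p. (\<Sum>k<r. b k u v * a k i j)\<^sup>2)"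
    by (intro sum.cong refl sum.swap)
  also have "\<dots> = (\<Sum>u<m'. \<Sum>i<m. \<Sum>v<p'. \<Sum>j<p. (\<Sum>k<r. b k u v * a k i j)\<^sup>2)"
    by (rule sum.swap)
  also have "\<dots> = (\<Sum>u<m'. \<Sum>v<p'. \<Sum>i<m. \<Sum>j<p. (\<Sum>k<r. b k u v * a k i j)\<^sup>2)"
    by (intro sum.cong refl sum.swap)
  also have "\<dots> = (\<Sum>u<m'. \<Sum>v<p'. \<Sum>k<r. (b k u v)\<^sup>2 * (frob m p (a k))\<^sup>2)"
    unfolding pyth ..
  also have "\<dots> = (\<Sum>u<m'. \<Sum>k<r. \<Sum>v<p'. (b k u v)\<^sup>2 * (frob m p (a k))\<^sup>2)"
    by (intro sum.cong refl sum.swap)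
  also have "\<dots> = (\<Sum>k<r. \<Sum>u<m'. \<Sum>v<p'. (b k u v)\<^sup>2 * (frob m p (a k))\<^sup>2)"
    by (rule sum.swap)
  finally show ?thesis
    by (simp add: frob_sq[of m' p'] sum_distrib_left mult.commute)
qed

text \<open>The empty product is the 1 x 1 identity, stored as an array supported at (0, 0).
  Multiplying by it returns \<open>A 0\<close> since \<open>A 0\<close> vanishes outside its
  block.\<close>

lemma kronN_2:
  assumes "A 0 \<in> mats (ms 0) (ps 0)" "ms 0 \<ge> 1" "ps 0 \<ge> 1"
  shows "kronN 2 ms ps A = kron2 (ms 1) (ps 1) (A 0) (A 1)"
proof -
  have "kron2 (ms 0) (ps 0) (\<lambda>i j. if i = 0 \<and> j = 0 then 1 else 0) (A 0) = A 0"
    using assms by (intro ext) (auto simp: kron2_def mats_def div_eq_0_iff not_less)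
  then show ?thesis by (simp add: numeral_2_eq_2)
qed

text \<open>For two factors the summands of a decomposition can be made pairwise orthogonal, so none of
  them exceeds the whole matrix; hence the bound on the summands is no restriction.\<close>

lemma compact_Kset_2:
  assumes pos: "ms 0 \<ge> 1" "ps 0 \<ge> 1"
  shows "compact (Kset 2 ms ps r)"
proof -
  define m where "m = ms 0 * ms 1"
  define p where "p = ps 0 * ps 1"
  have dims: "(\<Prod>n<2. ms n) = m" "(\<Prod>n<2. ps n) = p"
    by (simp_all add: m_def p_def numeral_2_eq_2)
  have "Kset 2 ms ps r \<subseteq> cKset (sqrt p) 2 ms ps r"
  proof
    fix D assume "D \<in> Kset 2 ms ps r"
    then have D: "D \<in> oblique m p" "sep_rank 2 ms ps D \<le> r"
      by (auto simp: Kset_def dims)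
    then obtain Ak where Ak: "is_kron_decomp 2 ms ps r Ak D"
      using sep_rank_le_iff[of 2 D ms ps r] by (auto simp: oblique_def dims)
    then have mats: "\<forall>k<r. Ak k 0 \<in> mats (ms 0) (ps 0)" "\<forall>k<r. Ak k 1 \<in> mats (ms 1) (ps 1)"
      by (auto simp: is_kron_decomp_def)
    have Dk: "D i j = (\<Sum>k<r. Ak k 0 (i div ms 1) (j div ps 1) * Ak k 1 (i mod ms 1) (j mod ps 1))" for i j
      using Ak kronN_2[where ms = ms and ps = ps] pos mats by (auto simp: is_kron_decomp_def kron2_def intro!: sum.cong)
    obtain a b where a: "\<forall>k<r. a k \<in> mats (ms 0) (ps 0)" and b: "\<forall>k<r. b k \<in> mats (ms 1) (ps 1)"
      and orth: "\<forall>k<r. \<forall>l<r. k \<noteq> l \<longrightarrow> mat_ip (ms 0) (ps 0) (a k) (a l) = 0"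
      and eq: "\<forall>i j u v. (\<Sum>k<r. Ak k 0 i j * Ak k 1 u v) = (\<Sum>k<r. a k i j * b k u v)"
      using tensor_sum_orthogonalize[OF mats] by (elim exE conjE) (rule that)
    define B where "B k n = (if n = 0 then a k else b k)" for k and n :: nat
    have kB: "kronN 2 ms ps (B k) = kron2 (ms 1) (ps 1) (a k) (b k)" if "k < r" for k
      using kronN_2[where A = "B k" and ms = ms and ps = ps] pos a that by (simp add: B_def)
    have DB: "D = (\<lambda>i j. \<Sum>k<r. kron2 (ms 1) (ps 1) (a k) (b k) i j)"
      using Dk eq by (intro ext) (simp add: kron2_def)
    then have dec: "is_kron_decomp 2 ms ps r B D"
      using a b kB by (auto simp: is_kron_decomp_def B_def less_2_cases_iff)
    have "frob m p (kronN 2 ms ps (B k)) \<le> sqrt p" if k: "k < r" for k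
    proof -
      have "(frob m p (kronN 2 ms ps (B k)))\<^sup>2 = (frob (ms 0) (ps 0) (a k))\<^sup>2 * (frob (ms 1) (ps 1) (b k))\<^sup>2"
        by (simp add: kB[OF k] m_def p_def frob_kron2 power_mult_distrib)
      also have "\<dots> \<le> (\<Sum>k<r. (frob (ms 0) (ps 0) (a k))\<^sup>2 * (frob (ms 1) (ps 1) (b k))\<^sup>2)"
        using k by (intro member_le_sum) auto
      also have "\<dots> = (frob m p D)\<^sup>2"
        unfolding DB m_def p_def using orth by (intro frob_kron_sum_orthogonal[symmetric]) blast
      finally show ?thesis
        using frob_oblique[OF D(1)] by (simp add: power2_le_iff_abs_le real_le_rsqrt)
    qed
    then show "D \<in> cKset (sqrt p) 2 ms ps r"
      using D dec by (auto simp: cKset_def dims)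
  qed
  then have "Kset 2 ms ps r = cKset (sqrt p) 2 ms ps r"
    using cKset_subset_Kset by blast
  then show ?thesis using compact_cKset[of 2] by simp
qed

section \<open>Primal and dual bounds for the lasso\<close>

lemma L2_set_power2: "(L2_set f S)\<^sup>2 = (\<Sum>i\<in>S. (f i)\<^sup>2)"
  by (simp add: L2_set_def sum_nonneg)

lemma abs_sum_mult_le_L2: "\<bar>\<Sum>i\<in>S. f i * g i\<bar> \<le> L2_set f S * L2_set g S"
proof -
  have "\<bar>\<Sum>i\<in>S. f i * g i\<bar> \<le> (\<Sum>i\<in>S. \<bar>f i\<bar> * \<bar>g i\<bar>)"
    by (rule order.trans[OF sum_abs]) (simp add: abs_mult)
  also have "\<dots> \<le> L2_set f S * L2_set g S"
    by (rule L2_set_mult_ineq)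
  finally show ?thesis .
qed

lemma matvec_le_frob:
  "L2_set (\<lambda>i. \<Sum>j<p. A i j * x j) {..<m} \<le> frob m p A * L2_set x {..<p}"
proof -
  have "(\<Sum>j<p. A i j * x j)\<^sup>2 \<le> (\<Sum>j<p. (A i j)\<^sup>2) * (L2_set x {..<p})\<^sup>2" for i
  proof -
    have "(\<Sum>j<p. A i j * x j)\<^sup>2 \<le> (L2_set (A i) {..<p} * L2_set x {..<p})\<^sup>2"
      using abs_sum_mult_le_L2[of "A i" x "{..<p}"] by (rule abs_le_square_iff[THEN iffD1, OF order_trans]) simp
    then show ?thesis by (simp add: power_mult_distrib L2_set_power2)
  qed
  then have "(\<Sum>i<m. (\<Sum>j<p. A i j * x j)\<^sup>2) \<le> (frob m p A * L2_set x {..<p})\<^sup>2"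
    unfolding power_mult_distrib frob_sq sum_distrib_right by (intro sum_mono)
  then show ?thesis
    unfolding L2_set_def[of "\<lambda>i. \<Sum>j<p. A i j * x j"] by (intro real_le_lsqrt) auto
qed

definition lasso :: "real \<Rightarrow> nat \<Rightarrow> nat \<Rightarrow> (nat \<Rightarrow> real) \<Rightarrow> rmat \<Rightarrow> (nat \<Rightarrow> real) \<Rightarrow> real" where
  "lasso lam m p y D x =
     1/2 * (\<Sum>i<m. (y i - (\<Sum>j<p. D i j * x j))\<^sup>2) + lam * (\<Sum>j<p. \<bar>x j\<bar>)"

lemma lasso_nonneg: "lam \<ge> 0 \<Longrightarrow> lasso lam m p y D x \<ge> 0"
  by (simp add: lasso_def sum_nonneg)

lemma f_y_lasso: "f_y lam m p y D = (INF x\<in>{x. \<forall>j\<ge>p. x j = 0}. lasso lam m p y D x)"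
  by (simp add: f_y_def lasso_def)

lemma bdd_below_lasso:
  assumes "lam \<ge> 0"
  shows "bdd_below (lasso lam m p y D ` X)"
  using lasso_nonneg[OF assms] by (intro bdd_belowI[of _ 0]) auto

lemma f_y_le:
  assumes "lam \<ge> 0"
  shows "f_y lam m p y D \<le> lasso lam m p y D x"
proof -
  let ?x = "\<lambda>j. if j < p then x j else 0"
  have "f_y lam m p y D \<le> lasso lam m p y D ?x"
    unfolding f_y_lasso by (intro cINF_lower bdd_below_lasso assms) auto
  also have "\<dots> = lasso lam m p y D x"
    by (simp add: lasso_def)
  finally show ?thesis .
qed

lemma f_y_greatest:
  assumes "\<And>x. c \<le> lasso lam m p y D x"
  shows "c \<le> f_y lam m p y D"
  unfolding f_y_lasso using assms by (intro cINF_greatest) (auto intro: exI[of _ "\<lambda>_. 0"])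

lemma f_y_nonneg: "lam \<ge> 0 \<Longrightarrow> f_y lam m p y D \<ge> 0"
  by (intro f_y_greatest lasso_nonneg)

lemma f_y_le_half:
  assumes "lam \<ge> 0"
  shows "f_y lam m p y D \<le> 1/2 * (\<Sum>i<m. (y i)\<^sup>2)"
  using f_y_le[OF assms, of m p y D "\<lambda>_. 0"] by (simp add: lasso_def)

text \<open>Weak duality. For a feasible \<open>u\<close> the inner product of \<open>u\<close> with
  D x is at most lam times the l1 norm of x; the rest is Fenchel's inequality for half the squared
  norm.\<close>

lemma f_y_ge_dual:
  assumes "lam \<ge> 0" and u: "\<And>j. j < p \<Longrightarrow> \<bar>\<Sum>i<m. D i j * u i\<bar> \<le> lam"
  shows "1/2 * (\<Sum>i<m. (y i)\<^sup>2) - 1/2 * (\<Sum>i<m. (y i - u i)\<^sup>2) \<le> f_y lam m p y D"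
proof (rule f_y_greatest)
  fix x
  let ?z = "\<lambda>i. y i - (\<Sum>j<p. D i j * x j)"
  have "(\<Sum>i<m. u i * (\<Sum>j<p. D i j * x j)) = (\<Sum>i<m. \<Sum>j<p. D i j * u i * x j)"
    by (simp add: sum_distrib_left mult_ac)
  also have "\<dots> = (\<Sum>j<p. (\<Sum>i<m. D i j * u i) * x j)"
    by (subst sum.swap) (simp add: sum_distrib_right)
  also have "\<dots> \<le> (\<Sum>j<p. lam * \<bar>x j\<bar>)"
  proof (intro sum_mono)
    fix j assume "j \<in> {..<p}"
    then have "\<bar>(\<Sum>i<m. D i j * u i) * x j\<bar> \<le> lam * \<bar>x j\<bar>"
      unfolding abs_mult by (intro mult_right_mono u) auto
    then show "(\<Sum>i<m. D i j * u i) * x j \<le> lam * \<bar>x j\<bar>" by linarith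
  qed
  also have "\<dots> = lam * (\<Sum>j<p. \<bar>x j\<bar>)"
    by (simp add: sum_distrib_left)
  finally have 1: "(\<Sum>i<m. u i * (\<Sum>j<p. D i j * x j)) \<le> lam * (\<Sum>j<p. \<bar>x j\<bar>)" .
  have "1/2 * (\<Sum>i<m. (y i)\<^sup>2) - 1/2 * (\<Sum>i<m. (y i - u i)\<^sup>2) =
      (\<Sum>i<m. 1/2 * (y i)\<^sup>2 - 1/2 * (y i - u i)\<^sup>2)"
    by (simp add: sum_subtractf sum_distrib_left)
  also have "\<dots> \<le> (\<Sum>i<m. 1/2 * (?z i)\<^sup>2 + u i * (\<Sum>j<p. D i j * x j))"
  proof (intro sum_mono)
    fix i
    have "0 \<le> (?z i - u i)\<^sup>2" by simp
    then show "1/2 * (y i)\<^sup>2 - 1/2 * (y i - u i)\<^sup>2 \<le> 1/2 * (?z i)\<^sup>2 + u i * (\<Sum>j<p. D i j * x j)"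
      by (simp add: power2_eq_square algebra_simps)
  qed
  also have "\<dots> = 1/2 * (\<Sum>i<m. (?z i)\<^sup>2) + (\<Sum>i<m. u i * (\<Sum>j<p. D i j * x j))"
    by (simp add: sum.distrib sum_distrib_left)
  finally show "1/2 * (\<Sum>i<m. (y i)\<^sup>2) - 1/2 * (\<Sum>i<m. (y i - u i)\<^sup>2) \<le> lasso lam m p y D x"
    using 1 by (simp add: lasso_def)
qed

text \<open>Vectors whose objective is at least Y^2/2 never beat the zero vector. Any other one has
  residual norm at most \<open>Y\<close> and l1 norm at most \<open>R\<close>, so passing from
  \<open>D\<close> to \<open>D'\<close> moves its residual by at most \<open>R\<close> times the
  distance. The modulus depends on \<open>y\<close> only through the bound \<open>Y\<close>, so it
  survives integration.\<close>

lemma f_y_perturb: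
  assumes lam: "lam > 0" and y: "L2_set y {..<m} \<le> Y"
  defines "R \<equiv> Y\<^sup>2 / (2 * lam)"
  shows "f_y lam m p y D' \<le> f_y lam m p y D + (Y * R * frob_dist m p D D' + 1/2 * (R * frob_dist m p D D')\<^sup>2)"
proof -
  define d where "d = frob_dist m p D D'"
  have Y0: "Y \<ge> 0" using y L2_set_nonneg[of y "{..<m}"] by linarith
  have d0: "d \<ge> 0" by (simp add: d_def)
  have R0: "R \<ge> 0" using lam by (simp add: R_def)
  have y2: "(\<Sum>i<m. (y i)\<^sup>2) \<le> Y\<^sup>2"
    unfolding L2_set_power2[symmetric] using y by (intro power_mono) auto
  have "f_y lam m p y D' - (Y * R * d + 1/2 * (R * d)\<^sup>2) \<le> f_y lam m p y D"
  proof (rule f_y_greatest)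
    fix x
    show "f_y lam m p y D' - (Y * R * d + 1/2 * (R * d)\<^sup>2) \<le> lasso lam m p y D x"
    proof (cases "lasso lam m p y D x \<ge> 1/2 * Y\<^sup>2")
      case True
      have "f_y lam m p y D' \<le> 1/2 * Y\<^sup>2"
        using f_y_le_half[of lam m p y D'] lam y2 by simp
      moreover have "0 \<le> Y * R * d + 1/2 * (R * d)\<^sup>2"
        using Y0 R0 d0 by simp
      ultimately show ?thesis using True by linarith
    next
      case False
      let ?r = "\<lambda>D i. y i - (\<Sum>j<p. D i j * x j)"
      have l1: "0 \<le> lam * (\<Sum>j<p. \<bar>x j\<bar>)" using lam by (simp add: sum_nonneg)
      have res: "(L2_set (?r D) {..<m})\<^sup>2 \<le> Y\<^sup>2"
        using False l1 by (simp add: lasso_def L2_set_power2)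
      then have resY: "L2_set (?r D) {..<m} \<le> Y"
        using Y0 by (rule power2_le_imp_le)
      have "0 \<le> 1/2 * (\<Sum>i<m. (?r D i)\<^sup>2)" by (simp add: sum_nonneg)
      then have "lam * (\<Sum>j<p. \<bar>x j\<bar>) \<le> 1/2 * Y\<^sup>2"
        using False by (simp add: lasso_def)
      then have "(\<Sum>j<p. \<bar>x j\<bar>) \<le> R"
        using lam by (simp add: R_def field_simps)
      then have xR: "L2_set x {..<p} \<le> R"
        using L2_set_le_sum_abs[of x "{..<p}"] by linarith
      have "L2_set (\<lambda>i. \<Sum>j<p. (D i j - D' i j) * x j) {..<m} \<le> d * L2_set x {..<p}"
        unfolding d_def frob_dist_def by (rule matvec_le_frob)
      also have "\<dots> \<le> d * R" using xR d0 by (rule mult_left_mono)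
      finally have dx: "L2_set (\<lambda>i. \<Sum>j<p. (D i j - D' i j) * x j) {..<m} \<le> R * d"
        by (simp add: mult.commute)
      have "L2_set (?r D') {..<m} = L2_set (\<lambda>i. ?r D i + (\<Sum>j<p. (D i j - D' i j) * x j)) {..<m}"
        by (simp add: left_diff_distrib sum_subtractf)
      also have "\<dots> \<le> L2_set (?r D) {..<m} + R * d"
        using L2_set_triangle_ineq[of "?r D" "\<lambda>i. \<Sum>j<p. (D i j - D' i j) * x j" "{..<m}"] dx by linarith
      finally have "(L2_set (?r D') {..<m})\<^sup>2 \<le> (L2_set (?r D) {..<m} + R * d)\<^sup>2"
        by (intro power_mono) auto
      also have "\<dots> = (L2_set (?r D) {..<m})\<^sup>2 + 2 * (L2_set (?r D) {..<m} * (R * d)) + (R * d)\<^sup>2"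
        by (simp add: power2_sum)
      also have "L2_set (?r D) {..<m} * (R * d) \<le> Y * (R * d)"
        using resY R0 d0 by (intro mult_right_mono) auto
      finally have "lasso lam m p y D' x \<le> lasso lam m p y D x + (Y * R * d + 1/2 * (R * d)\<^sup>2)"
        by (simp add: lasso_def L2_set_power2)
      then show ?thesis
        using f_y_le[of lam m p y D' x] lam by linarith
    qed
  qed
  then show ?thesis by (simp add: d_def)
qed

text \<open>A strict sublevel set of the infimum is a union, over uncountably many x, of sets that
  are open in y; openness makes the union measurable.\<close>

lemma borel_measurable_f_y:
  assumes lam: "lam \<ge> 0" and y: "\<And>i. (\<lambda>\<omega>. y \<omega> i) \<in> borel_measurable M"
  shows "(\<lambda>\<omega>. f_y lam m p (y \<omega>) D) \<in> borel_measurable M"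
proof -
  have "(\<lambda>y. f_y lam m p y D) \<in> borel_measurable borel"
  proof (subst borel_measurable_iff_less, rule allI)
    fix a
    have eq: "{y \<in> space borel. f_y lam m p y D < a} =
        (\<Union>x\<in>{x. \<forall>j\<ge>p. x j = 0}. {y. lasso lam m p y D x < a})"
      unfolding f_y_lasso
      by (subst cINF_less_iff) (auto intro: bdd_below_lasso lam exI[of _ "\<lambda>_. 0"])
    have "open {y. lasso lam m p y D x < a}" for x
      unfolding lasso_def
      by (intro open_Collect_less continuous_intros continuous_on_product_coordinates)
    then show "{y \<in> space borel. f_y lam m p y D < a} \<in> sets borel"
      unfolding eq by (intro borel_open open_UN) auto
  qed
  moreover have "y \<in> borel_measurable M"
    by (rule measurable_coordinatewise_then_product) (rule y)
  ultimately show ?thesis by (rule measurable_compose_rev)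
qed

section \<open>The explicit value of the lasso for a given support and sign pattern\<close>

definition gram :: "nat \<Rightarrow> rmat \<Rightarrow> rmat \<Rightarrow> nat \<Rightarrow> nat \<Rightarrow> real" where
  "gram m A B j k = (\<Sum>i<m. A i j * B i k)"

lemma gram_commute: "gram m A B j k = gram m B A k j"
  by (simp add: gram_def mult.commute)

lemma sum_comb_mult:
  "(\<Sum>i<m. (\<Sum>a\<in>S. A i a * x a) * (\<Sum>b\<in>T. B i b * z b)) = (\<Sum>a\<in>S. x a * (\<Sum>b\<in>T. gram m A B a b * z b))"
proof -
  have "(\<Sum>i<m. (\<Sum>a\<in>S. A i a * x a) * (\<Sum>b\<in>T. B i b * z b)) =
      (\<Sum>i<m. \<Sum>a\<in>S. \<Sum>b\<in>T. x a * (A i a * B i b * z b))"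
    by (simp add: sum_product mult_ac)
  also have "\<dots> = (\<Sum>a\<in>S. \<Sum>i<m. \<Sum>b\<in>T. x a * (A i a * B i b * z b))"
    by (rule sum.swap)
  also have "\<dots> = (\<Sum>a\<in>S. \<Sum>b\<in>T. \<Sum>i<m. x a * (A i a * B i b * z b))"
    by (intro sum.cong refl sum.swap)
  finally show ?thesis
    by (simp add: gram_def sum_distrib_left sum_distrib_right)
qed

lemma sum_col_comb: "(\<Sum>i<m. A i j * (\<Sum>b\<in>T. B i b * z b)) = (\<Sum>b\<in>T. gram m A B j b * z b)"
  using sum_comb_mult[where S = "{j}" and x = "\<lambda>_. 1"] by simp

text \<open>The value of the lasso for \<open>y\<close> if its solution has support \<open>S\<close> and signs \<open>\<sigma>\<close>; \<open>H\<close> is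
  the inverse of the Gram matrix of the columns in \<open>S\<close>.\<close>

definition lasso_value ::
  "real \<Rightarrow> nat \<Rightarrow> (nat \<Rightarrow> real) \<Rightarrow> rmat \<Rightarrow> nat set \<Rightarrow> (nat \<Rightarrow> nat \<Rightarrow> real) \<Rightarrow> (nat \<Rightarrow> real) \<Rightarrow> real" where
  "lasso_value lam m y D S H \<sigma> = 1/2 * (\<Sum>i<m. (y i)\<^sup>2) - 1/2 * (\<Sum>a\<in>S. \<Sum>b\<in>S. H a b *
     (((\<Sum>i<m. D i a * y i) - lam * \<sigma> a) * ((\<Sum>i<m. D i b * y i) - lam * \<sigma> b)))"

lemma right_inverse_solves:
  fixes H :: "nat \<Rightarrow> nat \<Rightarrow> real"
  assumes "finite S" and GH: "\<And>i k. i \<in> S \<Longrightarrow> k \<in> S \<Longrightarrow> (\<Sum>j\<in>S. G i j * H j k) = (if i = k then 1 else 0)"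
    and i: "i \<in> S"
  shows "(\<Sum>j\<in>S. G i j * (\<Sum>k\<in>S. H j k * v k)) = v i"
proof -
  have "(\<Sum>j\<in>S. G i j * (\<Sum>k\<in>S. H j k * v k)) = (\<Sum>j\<in>S. \<Sum>k\<in>S. G i j * H j k * v k)"
    by (simp add: sum_distrib_left mult.assoc)
  also have "\<dots> = (\<Sum>k\<in>S. (\<Sum>j\<in>S. G i j * H j k) * v k)"
    by (subst sum.swap) (simp add: sum_distrib_right)
  also have "\<dots> = (\<Sum>k\<in>S. if k = i then v k else 0)"
    using i by (intro sum.cong) (auto simp: GH)
  finally show ?thesis using i assms(1) by simp
qed

text \<open>\<open>xh\<close> solves the stationarity equations with signs \<open>\<sigma>\<close>,
  and \<open>u\<close> is its residual. The lower bound is dual: \<open>u\<close> is feasible, with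
  D^T u equal to lam \<sigma> on \<open>S\<close>, so \<sigma> only has to be bounded by 1 there.
  The upper bound is primal: \<open>xh\<close> is a candidate, and its l1 norm is a linear form in
  \<sigma> once its signs are those of x. The vector \<open>w\<close> may contain both the noise and
  the error of replacing the generating dictionary by \<open>D\<close>.\<close>

lemma lasso_value_bounds:
  fixes D :: rmat and y x w \<sigma> :: "nat \<Rightarrow> real"
  assumes lam: "lam > 0" and S: "S \<subseteq> {..<p}"
    and dom: "row_dominant S a (gram m D D)" and a: "a < 1"
    and GH: "\<And>i k. i \<in> S \<Longrightarrow> k \<in> S \<Longrightarrow> (\<Sum>j\<in>S. gram m D D i j * H j k) = (if i = k then 1 else 0)"
    and unit: "\<And>j. j < p \<Longrightarrow> gram m D D j j = 1"
    and y: "\<And>i. i < m \<Longrightarrow> y i = (\<Sum>b\<in>S. D i b * x b) + w i"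
    and w: "L2_set w {..<m} \<le> \<nu>"
    and \<sigma>: "\<And>b. \<bar>\<sigma> b\<bar> \<le> 1"
  shows "(\<And>j. j < p \<Longrightarrow> j \<notin> S \<Longrightarrow> (\<Sum>b\<in>S. \<bar>gram m D D j b\<bar>) \<le> a) \<Longrightarrow> \<nu> \<le> lam * (1 - 2 * a) \<Longrightarrow>
      lasso_value lam m y D S H \<sigma> \<le> f_y lam m p y D"
    and "(\<And>b. b \<in> S \<Longrightarrow> \<sigma> b = sgn (x b)) \<Longrightarrow> (\<And>b. b \<in> S \<Longrightarrow> (\<nu> + lam) / (1 - a) \<le> \<bar>x b\<bar>) \<Longrightarrow>
      f_y lam m p y D \<le> lasso_value lam m y D S H \<sigma>"
proof -
  have fin: "finite S" using dom by (simp add: row_dominant_def)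
  define v where "v b = (\<Sum>i<m. D i b * y i) - lam * \<sigma> b" for b
  define xh where "xh j = (\<Sum>k\<in>S. H j k * v k)" for j
  define z where "z b = xh b - x b" for b
  define u where "u i = y i - (\<Sum>b\<in>S. D i b * xh b)" for i
  have Gxh: "(\<Sum>b\<in>S. gram m D D i b * xh b) = v i" if "i \<in> S" for i
    unfolding xh_def by (rule right_inverse_solves[OF fin GH that])
  have Dy: "(\<Sum>i<m. D i j * y i) = (\<Sum>b\<in>S. gram m D D j b * x b) + (\<Sum>i<m. D i j * w i)" for j
  proof -
    have "(\<Sum>i<m. D i j * y i) = (\<Sum>i<m. D i j * (\<Sum>b\<in>S. D i b * x b) + D i j * w i)"
      by (intro sum.cong) (auto simp: y distrib_left)
    then show ?thesis by (simp add: sum.distrib sum_col_comb)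
  qed
  have Gz: "(\<Sum>b\<in>S. gram m D D i b * z b) = (\<Sum>k<m. D k i * w k) - lam * \<sigma> i" if "i \<in> S" for i
    using Gxh[OF that] Dy[of i] by (simp add: z_def v_def right_diff_distrib sum_subtractf)
  have Dw: "\<bar>\<Sum>i<m. D i j * w i\<bar> \<le> \<nu>" if "j < p" for j
  proof -
    have "L2_set (\<lambda>i. D i j) {..<m} = 1"
      using unit[OF that] by (simp add: L2_set_def gram_def power2_eq_square)
    then show ?thesis
      using abs_sum_mult_le_L2[of "\<lambda>i. D i j" w "{..<m}"] w by simp
  qed
  \<comment> \<open>\<open>z\<close>, the deviation of \<open>xh\<close> from the true coefficients,
    solves the Gram system with right-hand side D^T w - lam \<sigma>, whose entries are at most
    \<nu> + lam.\<close>
  have zb: "\<bar>z b\<bar> \<le> (\<nu> + lam) / (1 - a)" if "b \<in> S" for b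
  proof (rule row_dominant_solution_bound_inf[OF dom a Gz _ that])
    fix i assume i: "i \<in> S"
    have "\<bar>lam * \<sigma> i\<bar> \<le> lam * 1"
      unfolding abs_mult using lam \<sigma>[of i] by (intro mult_mono) auto
    then show "\<bar>(\<Sum>k<m. D k i * w k) - lam * \<sigma> i\<bar> \<le> \<nu> + lam"
      using Dw[of i] i S by fastforce
  qed
  have quad: "(\<Sum>a\<in>S. \<Sum>b\<in>S. H a b * (v a * v b)) = (\<Sum>a\<in>S. xh a * v a)"
    unfolding xh_def sum_distrib_right by (intro sum.cong refl) (simp add: mult_ac)
  have val: "lasso_value lam m y D S H \<sigma> = 1/2 * (\<Sum>i<m. (y i)\<^sup>2) - 1/2 * (\<Sum>a\<in>S. xh a * v a)"
    unfolding lasso_value_def v_def[symmetric] quad ..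
  have sq: "(\<Sum>i<m. (\<Sum>b\<in>S. D i b * xh b)\<^sup>2) = (\<Sum>a\<in>S. xh a * v a)"
    using sum_comb_mult[where S = S and T = S and A = D and B = D and x = xh and z = xh and m = m] Gxh by (simp add: power2_eq_square)
  {
    assume off: "\<And>j. j < p \<Longrightarrow> j \<notin> S \<Longrightarrow> (\<Sum>b\<in>S. \<bar>gram m D D j b\<bar>) \<le> a"
      and \<nu>: "\<nu> \<le> lam * (1 - 2 * a)"
    have \<nu>0: "\<nu> \<ge> 0" using w L2_set_nonneg[of w "{..<m}"] by linarith
    have Du: "(\<Sum>i<m. D i j * u i) = (\<Sum>i<m. D i j * y i) - (\<Sum>b\<in>S. gram m D D j b * xh b)" for j
      by (simp add: u_def right_diff_distrib sum_subtractf sum_col_comb)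
    have feas: "\<bar>\<Sum>i<m. D i j * u i\<bar> \<le> lam" if j: "j < p" for j
    proof (cases "j \<in> S")
      case True
      have "(\<Sum>i<m. D i j * u i) = lam * \<sigma> j"
        unfolding Du Gxh[OF True] by (simp add: v_def)
      also have "\<bar>\<dots>\<bar> \<le> lam * 1"
        unfolding abs_mult using lam \<sigma>[of j] by (intro mult_mono) auto
      finally show ?thesis by simp
    next
      case False
      let ?Z = "(\<nu> + lam) / (1 - a)"
      have Z0: "?Z \<ge> 0" using \<nu>0 lam a by simp
      have "(\<Sum>i<m. D i j * u i) = (\<Sum>i<m. D i j * w i) - (\<Sum>b\<in>S. gram m D D j b * z b)"
        unfolding Du Dy by (simp add: z_def right_diff_distrib sum_subtractf)
      moreover have "\<bar>\<Sum>b\<in>S. gram m D D j b * z b\<bar> \<le> (\<Sum>b\<in>S. \<bar>gram m D D j b\<bar> * ?Z)"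
        by (rule order.trans[OF sum_abs]) (unfold abs_mult, intro sum_mono mult_left_mono zb abs_ge_zero)
      moreover have "\<dots> \<le> a * ?Z"
        unfolding sum_distrib_right[symmetric] using off[OF j False] Z0 by (rule mult_right_mono)
      \<comment> \<open>After multiplication by 1 - a this is exactly the hypothesis
        \<open>\<nu> \<le> lam * (1 - 2 * a)\<close>.\<close>
      moreover have "\<nu> + a * ?Z \<le> lam"
        using a \<nu> by (simp add: field_simps)
      ultimately show ?thesis using Dw[OF j] by linarith
    qed
    have "1/2 * (\<Sum>i<m. (y i)\<^sup>2) - 1/2 * (\<Sum>i<m. (y i - u i)\<^sup>2) \<le> f_y lam m p y D"
      using lam feas by (intro f_y_ge_dual) auto
    then show "lasso_value lam m y D S H \<sigma> \<le> f_y lam m p y D"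
      by (simp add: val u_def sq)
  next
    assume sg: "\<And>b. b \<in> S \<Longrightarrow> \<sigma> b = sgn (x b)"
      and large: "\<And>b. b \<in> S \<Longrightarrow> (\<nu> + lam) / (1 - a) \<le> \<bar>x b\<bar>"
    let ?x = "\<lambda>j. if j \<in> S then xh j else 0"
    have abs: "\<bar>xh b\<bar> = \<sigma> b * xh b" if b: "b \<in> S" for b
    proof -
      \<comment> \<open>\<open>xh b\<close> differs from \<open>x b\<close> by at most |x b|, hence
        cannot have the opposite sign.\<close>
      have "\<bar>z b\<bar> \<le> \<bar>x b\<bar>" using zb[OF b] large[OF b] by linarith
      then show ?thesis
        unfolding sg[OF b] z_def by (auto simp: sgn_if abs_if split: if_splits)
    qed
    have restr: "(\<Sum>j<p. if j \<in> S then g j else 0) = (\<Sum>j\<in>S. g j)" for g :: "nat \<Rightarrow> real"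
      using S by (subst sum.inter_restrict[symmetric]) (auto simp: Int_absorb1)
    have comb: "(\<Sum>j<p. D i j * ?x j) = (\<Sum>b\<in>S. D i b * xh b)" for i
      using restr[of "\<lambda>j. D i j * xh j"] by (simp add: if_distrib cong: if_cong)
    have l1: "(\<Sum>j<p. \<bar>?x j\<bar>) = (\<Sum>b\<in>S. \<sigma> b * xh b)"
      using restr[of "\<lambda>j. \<bar>xh j\<bar>"] abs by (simp add: if_distrib cong: if_cong)
    have cross: "(\<Sum>i<m. y i * (\<Sum>b\<in>S. D i b * xh b)) = (\<Sum>b\<in>S. xh b * (\<Sum>i<m. D i b * y i))"
    proof -
      have "(\<Sum>i<m. y i * (\<Sum>b\<in>S. D i b * xh b)) = (\<Sum>i<m. \<Sum>b\<in>S. xh b * (D i b * y i))"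
        by (simp add: sum_distrib_left mult_ac)
      also have "\<dots> = (\<Sum>b\<in>S. \<Sum>i<m. xh b * (D i b * y i))" by (rule sum.swap)
      finally show ?thesis by (simp add: sum_distrib_left)
    qed
    have "lasso lam m p y D ?x = 1/2 * (\<Sum>i<m. (y i - (\<Sum>b\<in>S. D i b * xh b))\<^sup>2) + lam * (\<Sum>b\<in>S. \<sigma> b * xh b)"
      unfolding lasso_def comb l1 ..
    also have "(\<Sum>i<m. (y i - (\<Sum>b\<in>S. D i b * xh b))\<^sup>2) =
        (\<Sum>i<m. (y i)\<^sup>2) - 2 * (\<Sum>i<m. y i * (\<Sum>b\<in>S. D i b * xh b)) + (\<Sum>i<m. (\<Sum>b\<in>S. D i b * xh b)\<^sup>2)"
      by (simp add: power2_diff sum.distrib sum_subtractf sum_distrib_left mult.assoc)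
    also have "\<dots> = (\<Sum>i<m. (y i)\<^sup>2) - 2 * (\<Sum>b\<in>S. xh b * (\<Sum>i<m. D i b * y i)) + (\<Sum>a\<in>S. xh a * v a)"
      unfolding cross sq ..
    also have "(\<Sum>b\<in>S. xh b * (\<Sum>i<m. D i b * y i)) = (\<Sum>b\<in>S. xh b * v b) + lam * (\<Sum>b\<in>S. \<sigma> b * xh b)"
      by (simp add: v_def right_diff_distrib sum_subtractf sum_distrib_left mult_ac)
    finally have "lasso lam m p y D ?x = lasso_value lam m y D S H \<sigma>"
      unfolding val by (simp add: algebra_simps)
    then show "f_y lam m p y D \<le> lasso_value lam m y D S H \<sigma>"
      using f_y_le[of lam m p y D ?x] lam by simp
  }
qed

section \<open>Trace inequalities for the conditional gap\<close>

definition mat_mul :: "nat set \<Rightarrow> (nat \<Rightarrow> nat \<Rightarrow> real) \<Rightarrow> (nat \<Rightarrow> nat \<Rightarrow> real) \<Rightarrow> nat \<Rightarrow> nat \<Rightarrow> real" where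
  "mat_mul S A B = (\<lambda>i k. \<Sum>j\<in>S. A i j * B j k)"

definition fro :: "nat set \<Rightarrow> (nat \<Rightarrow> nat \<Rightarrow> real) \<Rightarrow> real" where
  "fro S A = L2_set (\<lambda>(i, j). A i j) (S \<times> S)"

definition offdiag :: "(nat \<Rightarrow> nat \<Rightarrow> real) \<Rightarrow> nat \<Rightarrow> nat \<Rightarrow> real" where
  "offdiag A = (\<lambda>i j. if i = j then 0 else A i j)"

lemma fro_nonneg [simp]: "fro S A \<ge> 0"
  by (simp add: fro_def)

lemma fro_sq: "(fro S A)\<^sup>2 = (\<Sum>i\<in>S. \<Sum>j\<in>S. (A i j)\<^sup>2)"
  by (simp add: fro_def L2_set_power2 sum.cartesian_product case_prod_unfold)

lemma fro_transpose: "fro S (\<lambda>i j. A j i) = fro S A"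
  by (rule power2_eq_imp_eq) (simp_all add: fro_sq, rule sum.swap)

lemma fro_cong:
  assumes "\<And>i j. i \<in> S \<Longrightarrow> j \<in> S \<Longrightarrow> A i j = B i j"
  shows "fro S A = fro S B"
  unfolding fro_def by (rule L2_set_cong) (auto simp: assms)

lemma abs_sum_mult_le_fro: "\<bar>\<Sum>i\<in>S. \<Sum>j\<in>S. A i j * B i j\<bar> \<le> fro S A * fro S B"
  using abs_sum_mult_le_L2[of "\<lambda>(i, j). A i j" "\<lambda>(i, j). B i j" "S \<times> S"]
  by (simp add: fro_def sum.cartesian_product case_prod_unfold)

lemma abs_trace_mult_le_fro: "\<bar>\<Sum>i\<in>S. \<Sum>j\<in>S. A i j * B j i\<bar> \<le> fro S A * fro S B"
  using abs_sum_mult_le_fro[where B = "\<lambda>i j. B j i" and A = A and S = S]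
  unfolding fro_transpose[where A = B] .

lemma mat_mul_assoc: "mat_mul S (mat_mul S A B) C = mat_mul S A (mat_mul S B C)"
proof (intro ext)
  fix i l
  have "mat_mul S (mat_mul S A B) C i l = (\<Sum>k\<in>S. \<Sum>j\<in>S. A i j * (B j k * C k l))"
    by (simp add: mat_mul_def sum_distrib_right mult.assoc)
  also have "\<dots> = (\<Sum>j\<in>S. \<Sum>k\<in>S. A i j * (B j k * C k l))" by (rule sum.swap)
  finally show "mat_mul S (mat_mul S A B) C i l = mat_mul S A (mat_mul S B C) i l"
    by (simp add: mat_mul_def sum_distrib_left)
qed

lemma trace_mat_mul_commute: "(\<Sum>i\<in>S. mat_mul S A B i i) = (\<Sum>i\<in>S. mat_mul S B A i i)"
  unfolding mat_mul_def by (subst sum.swap) (simp add: mult.commute)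

text \<open>Each column of the product solves the Gram system for the corresponding column of
  \<open>A\<close>, so the Euclidean solution bound applies column by column.\<close>

lemma fro_inverse_mult:
  assumes dom: "row_dominant S a G" and a: "a < 1"
    and GH: "\<And>i k. i \<in> S \<Longrightarrow> k \<in> S \<Longrightarrow> (\<Sum>j\<in>S. G i j * H j k) = (if i = k then 1 else 0)"
  shows "fro S (mat_mul S H A) \<le> 1 / (1 - a) * fro S A"
proof (rule power2_le_imp_le)
  have fin: "finite S" using dom by (simp add: row_dominant_def)
  have col: "(\<Sum>i\<in>S. (mat_mul S H A i k)\<^sup>2) \<le> (1 / (1 - a))\<^sup>2 * (\<Sum>i\<in>S. (A i k)\<^sup>2)" for k
  proof -
    have "L2_set (\<lambda>i. mat_mul S H A i k) S \<le> 1 / (1 - a) * L2_set (\<lambda>i. A i k) S"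
      unfolding mat_mul_def
      by (rule row_dominant_solution_bound_two[OF dom a]) (rule right_inverse_solves[OF fin GH])
    then have "(L2_set (\<lambda>i. mat_mul S H A i k) S)\<^sup>2 \<le> (1 / (1 - a) * L2_set (\<lambda>i. A i k) S)\<^sup>2"
      by (intro power_mono) auto
    then show ?thesis by (simp only: power_mult_distrib L2_set_power2)
  qed
  have "(fro S (mat_mul S H A))\<^sup>2 = (\<Sum>k\<in>S. \<Sum>i\<in>S. (mat_mul S H A i k)\<^sup>2)"
    unfolding fro_sq by (rule sum.swap)
  also have "\<dots> \<le> (\<Sum>k\<in>S. (1 / (1 - a))\<^sup>2 * (\<Sum>i\<in>S. (A i k)\<^sup>2))"
    by (intro sum_mono col)
  also have "\<dots> = (1 / (1 - a))\<^sup>2 * (\<Sum>i\<in>S. \<Sum>k\<in>S. (A i k)\<^sup>2)"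
    unfolding sum_distrib_left[symmetric] by (subst sum.swap) simp
  finally show "(fro S (mat_mul S H A))\<^sup>2 \<le> (1 / (1 - a) * fro S A)\<^sup>2"
    by (simp only: power_mult_distrib fro_sq)
  show "0 \<le> 1 / (1 - a) * fro S A" using a by simp
qed

text \<open>A relation rather than a function, since the arrays are prescribed only on pairs from
  \<open>S\<close>. Both one-sided identities and the symmetry are recorded, as all three are
  used.\<close>

definition inverse_on :: "nat set \<Rightarrow> (nat \<Rightarrow> nat \<Rightarrow> real) \<Rightarrow> (nat \<Rightarrow> nat \<Rightarrow> real) \<Rightarrow> bool" where
  "inverse_on S G H \<longleftrightarrow> (\<forall>i\<in>S. \<forall>k\<in>S. mat_mul S G H i k = (if i = k then 1 else 0) \<and>
     mat_mul S H G i k = (if i = k then 1 else 0) \<and> H i k = H k i)"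

lemma inverse_on_exists:
  assumes "row_dominant S a G" "a < 1"
  shows "\<exists>H. inverse_on S G H"
proof -
  obtain H where
        GH: "\<And>i k. i \<in> S \<Longrightarrow> k \<in> S \<Longrightarrow> (\<Sum>j\<in>S. G i j * H j k) = (if i = k then 1 else 0)"
    and sym: "\<And>i k. i \<in> S \<Longrightarrow> k \<in> S \<Longrightarrow> H i k = H k i"
    and HG: "\<And>i k. i \<in> S \<Longrightarrow> k \<in> S \<Longrightarrow> (\<Sum>j\<in>S. H i j * G j k) = (if i = k then 1 else 0)"
    by (rule row_dominant_inverse[OF assms]) (rule that)
  have "inverse_on S G H"
    unfolding inverse_on_def mat_mul_def by (intro ballI conjI) (rule GH HG sym; assumption)+
  then show ?thesis by (rule exI[of _ H])
qed

lemma inverse_onD: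
  assumes "inverse_on S G H" "i \<in> S" "k \<in> S"
  shows "mat_mul S G H i k = (if i = k then 1 else 0)"
    and "mat_mul S H G i k = (if i = k then 1 else 0)"
    and "H i k = H k i"
  using assms unfolding inverse_on_def by blast+

lemma sum_indicator_eq:
  assumes "finite S" "i \<in> S"
  shows "(\<Sum>j\<in>S. (if i = j then 1 else 0) * f j) = (f i :: real)"
    and "(\<Sum>j\<in>S. f j * (if i = j then 1 else 0)) = (f i :: real)"
    and "(\<Sum>j\<in>S. f j * (if j = i then 1 else 0)) = (f i :: real)"
  using assms by (simp_all add: if_distrib if_distribR cong: if_cong)

text \<open>With E = G - I, the identities H G = I and G H = I read H = I - H E and H = I - E H. Off
  the diagonal, H is thus controlled by E.\<close>

lemma inverse_on_expand:
  assumes dom: "row_dominant S a G" and inv: "inverse_on S G H"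
    and ij: "i \<in> S" "j \<in> S"
  shows "H i j = (if i = j then 1 else 0) - mat_mul S H (offdiag G) i j"
    and "H i j = (if i = j then 1 else 0) - mat_mul S (offdiag G) H i j"
proof -
  have fin: "finite S" and d: "\<And>i. i \<in> S \<Longrightarrow> G i i = 1"
    using dom by (auto simp: row_dominant_def)
  have od: "offdiag G a b = G a b - (if a = b then 1 else 0)" if "a \<in> S" for a b
    using d[OF that] by (auto simp: offdiag_def)
  have "mat_mul S H (offdiag G) i j = mat_mul S H G i j - H i j"
    using ij fin by (simp add: mat_mul_def od right_diff_distrib sum_subtractf sum_indicator_eq)
  moreover have "mat_mul S (offdiag G) H i j = mat_mul S G H i j - H i j"
    using ij fin by (simp add: mat_mul_def od left_diff_distrib sum_subtractf sum_indicator_eq)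
  ultimately show "H i j = (if i = j then 1 else 0) - mat_mul S H (offdiag G) i j"
    "H i j = (if i = j then 1 else 0) - mat_mul S (offdiag G) H i j"
    using inv ij by (auto simp: inverse_on_def)
qed

lemma mat_mul_identity_left:
  assumes "finite S" "\<And>j. j \<in> S \<Longrightarrow> A i j = (if i = j then 1 else 0)" "i \<in> S"
  shows "mat_mul S A B i k = B i k"
proof -
  have "mat_mul S A B i k = (\<Sum>j\<in>S. (if i = j then 1 else 0) * B j k)"
    unfolding mat_mul_def using assms(2) by (intro sum.cong) auto
  then show ?thesis using assms(1,3) by (simp add: sum_indicator_eq)
qed

text \<open>G - K stands for D^T D0, and H times it is I - H K. The terms with G collapse through G
  H = I, leaving the trace of K and a term quadratic in K.\<close>

lemma trace_inverse_cross:
  assumes dom: "row_dominant S a G" and inv: "inverse_on S G H"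
  shows "(\<Sum>a\<in>S. \<Sum>b\<in>S. H a b * (\<Sum>c\<in>S. (G a c - K a c) * (G b c - K b c))) =
      real (card S) - 2 * (\<Sum>a\<in>S. K a a) + (\<Sum>a\<in>S. \<Sum>c\<in>S. K a c * mat_mul S H K a c)" (is ?cross)
    and "(\<Sum>a\<in>S. \<Sum>b\<in>S. H a b * (G a b - K a b)) = real (card S) - (\<Sum>a\<in>S. mat_mul S H K a a)" (is ?lin)
proof -
  let ?P = "mat_mul S H K"
  have fin: "finite S" and diag: "\<And>i. i \<in> S \<Longrightarrow> G i i = 1"
    and sym: "\<And>i j. i \<in> S \<Longrightarrow> j \<in> S \<Longrightarrow> G i j = G j i"
    using dom by (auto simp: row_dominant_def)
  have HB: "(\<Sum>b\<in>S. H a b * (G b c - K b c)) = (if a = c then 1 else 0) - ?P a c"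
    if "a \<in> S" "c \<in> S" for a c
    using inverse_onD(2)[OF inv that] by (simp add: mat_mul_def right_diff_distrib sum_subtractf)
  have inner: "(\<Sum>b\<in>S. H a b * (\<Sum>c\<in>S. (G a c - K a c) * (G b c - K b c))) =
      1 - K a a - (\<Sum>c\<in>S. G a c * ?P a c) + (\<Sum>c\<in>S. K a c * ?P a c)" if a: "a \<in> S" for a
  proof -
    have "(\<Sum>b\<in>S. H a b * (\<Sum>c\<in>S. (G a c - K a c) * (G b c - K b c))) =
        (\<Sum>b\<in>S. \<Sum>c\<in>S. (G a c - K a c) * (H a b * (G b c - K b c)))"
      by (simp add: sum_distrib_left mult_ac)
    also have "\<dots> = (\<Sum>c\<in>S. (G a c - K a c) * (\<Sum>b\<in>S. H a b * (G b c - K b c)))"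
      by (subst sum.swap) (simp add: sum_distrib_left)
    also have "\<dots> = (\<Sum>c\<in>S. (G a c - K a c) * ((if a = c then 1 else 0) - ?P a c))"
      using a by (intro sum.cong) (simp_all add: HB)
    also have "\<dots> = (\<Sum>c\<in>S. (G a c - K a c) * (if a = c then 1 else 0)) -
        (\<Sum>c\<in>S. G a c * ?P a c) + (\<Sum>c\<in>S. K a c * ?P a c)"
      by (simp only: right_diff_distrib left_diff_distrib sum_subtractf)
    finally show ?thesis
      unfolding sum_indicator_eq(2)[OF fin a] using diag[OF a] by simp
  qed
  have "(\<Sum>a\<in>S. \<Sum>c\<in>S. G a c * ?P a c) = (\<Sum>c\<in>S. mat_mul S G ?P c c)"
    unfolding mat_mul_def[of S G] by (subst sum.swap) (intro sum.cong refl, simp add: sym)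
  also have "\<dots> = (\<Sum>c\<in>S. K c c)"
    unfolding mat_mul_assoc[symmetric] using inv
    by (intro sum.cong refl mat_mul_identity_left fin) (auto simp: inverse_on_def)
  finally have GP: "(\<Sum>a\<in>S. \<Sum>c\<in>S. G a c * ?P a c) = (\<Sum>c\<in>S. K c c)" .
  show ?cross
    using GP by (simp add: inner sum.distrib sum_subtractf)
  have "(\<Sum>a\<in>S. \<Sum>b\<in>S. H a b * (G a b - K a b)) = (\<Sum>b\<in>S. \<Sum>a\<in>S. H b a * (G a b - K a b))"
    by (subst sum.swap) (intro sum.cong refl arg_cong2[where f = "(*)"] inverse_onD(3)[OF inv])
  also have "\<dots> = (\<Sum>b\<in>S. 1 - ?P b b)"
    by (intro sum.cong refl) (simp add: HB)
  finally show ?lin by (simp add: sum_subtractf)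
qed

lemma inverse_diag_bound:
  assumes dom: "row_dominant S a G" and a: "a < 1" and inv: "inverse_on S G H" and i: "i \<in> S"
  shows "\<bar>H i i\<bar> \<le> 1 / (1 - a)"
proof (rule row_dominant_solution_bound_inf[OF dom a, of "\<lambda>j. H j i" "\<lambda>j. if j = i then 1 else 0"])
  show "(\<Sum>j\<in>S. G k j * H j i) = (if k = i then 1 else 0)" if "k \<in> S" for k
    using inverse_onD(1)[OF inv that i] by (simp add: mat_mul_def)
qed (use i in auto)

lemma inverse_on_solves:
  assumes "inverse_on S G H" "i \<in> S" "k \<in> S"
  shows "(\<Sum>j\<in>S. G i j * H j k) = (if i = k then 1 else 0)"
  using inverse_onD(1)[OF assms] by (simp add: mat_mul_def)

text \<open>The diagonal of K meets the bounded diagonal of H; off the diagonal H is replaced by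
  minus H times the off-diagonal part of G. Estimating by the Frobenius norms of H and K instead
  would leave a term of first order in K with a factor sqrt s.\<close>

lemma abs_trace_inverse_mult_le:
  assumes dom: "row_dominant S a G" and a: "a < 1" and inv: "inverse_on S G H"
    and K0: "\<And>i. i \<in> S \<Longrightarrow> K i i \<ge> 0"
  shows "\<bar>\<Sum>i\<in>S. mat_mul S H K i i\<bar> \<le>
    1 / (1 - a) * (\<Sum>i\<in>S. K i i) + 1 / (1 - a) * fro S (offdiag G) * fro S (offdiag K)"
proof -
  have fin: "finite S" using dom by (simp add: row_dominant_def)
  have entry: "H i j * K j i = (if i = j then H i i * K i i else 0) - mat_mul S H (offdiag G) i j * offdiag K j i"
    if "i \<in> S" "j \<in> S" for i j
    using inverse_on_expand(1)[OF dom inv that] by (auto simp: offdiag_def)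
  have "(\<Sum>i\<in>S. mat_mul S H K i i) =
      (\<Sum>i\<in>S. \<Sum>j\<in>S. (if i = j then H i i * K i i else 0) - mat_mul S H (offdiag G) i j * offdiag K j i)"
    unfolding mat_mul_def[of S H K] by (intro sum.cong refl entry)
  also have "\<dots> = (\<Sum>i\<in>S. H i i * K i i) - (\<Sum>i\<in>S. \<Sum>j\<in>S. mat_mul S H (offdiag G) i j * offdiag K j i)"
    using fin by (simp add: sum_subtractf)
  finally have eq: "(\<Sum>i\<in>S. mat_mul S H K i i) =
      (\<Sum>i\<in>S. H i i * K i i) - (\<Sum>i\<in>S. \<Sum>j\<in>S. mat_mul S H (offdiag G) i j * offdiag K j i)" .
  have "\<bar>\<Sum>i\<in>S. H i i * K i i\<bar> \<le> (\<Sum>i\<in>S. 1 / (1 - a) * K i i)"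
  proof (rule order.trans[OF sum_abs], intro sum_mono)
    fix i assume i: "i \<in> S"
    show "\<bar>H i i * K i i\<bar> \<le> 1 / (1 - a) * K i i"
      unfolding abs_mult abs_of_nonneg[OF K0[OF i]]
      by (intro mult_right_mono inverse_diag_bound[OF dom a inv i] K0 i)
  qed
  moreover have "\<bar>\<Sum>i\<in>S. \<Sum>j\<in>S. mat_mul S H (offdiag G) i j * offdiag K j i\<bar> \<le>
      fro S (mat_mul S H (offdiag G)) * fro S (offdiag K)"
    by (rule abs_trace_mult_le_fro)
  moreover have "\<dots> \<le> 1 / (1 - a) * fro S (offdiag G) * fro S (offdiag K)"
    by (intro mult_right_mono fro_inverse_mult[OF dom a inverse_on_solves[OF inv]]) auto
  ultimately show ?thesis
    unfolding eq sum_distrib_left by linarith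
qed

text \<open>Resolvent identity: the difference of the traces is the trace of (G - G0) H H0. With E
  and E0 the off-diagonal parts, H H0 = I - H E - H E0 H0, and the identity matrix drops out because
  G - G0 has zero diagonal. What remains are products of two off-diagonal quantities.\<close>

lemma trace_inverse_diff_le:
  assumes dom: "row_dominant S a G" and a: "a < 1" and inv: "inverse_on S G H"
    and dom0: "row_dominant S a G0" and inv0: "inverse_on S G0 H0"
  shows "\<bar>(\<Sum>i\<in>S. H0 i i) - (\<Sum>i\<in>S. H i i)\<bar> \<le> fro S (\<lambda>i j. G i j - G0 i j) *
    (1 / (1 - a) * fro S (offdiag G) + (1 / (1 - a))\<^sup>2 * fro S (offdiag G0))"
proof -
  let ?F = "\<lambda>i j. G i j - G0 i j"
  let ?c = "1 / (1 - a)"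
  have fin: "finite S" using dom by (simp add: row_dominant_def)
  have F0: "?F i i = 0" if "i \<in> S" for i
    using dom dom0 that by (simp add: row_dominant_def)
  have tr1: "(\<Sum>i\<in>S. mat_mul S (mat_mul S G H) H0 i i) = (\<Sum>i\<in>S. H0 i i)"
    using inv by (intro sum.cong refl mat_mul_identity_left fin) (auto simp: inverse_on_def)
  have "(\<Sum>i\<in>S. mat_mul S (mat_mul S G0 H) H0 i i) = (\<Sum>i\<in>S. mat_mul S H0 (mat_mul S G0 H) i i)"
    by (rule trace_mat_mul_commute)
  also have "\<dots> = (\<Sum>i\<in>S. H i i)"
    unfolding mat_mul_assoc[symmetric] using inv0
    by (intro sum.cong refl mat_mul_identity_left fin) (auto simp: inverse_on_def)
  finally have tr2: "(\<Sum>i\<in>S. mat_mul S (mat_mul S G0 H) H0 i i) = (\<Sum>i\<in>S. H i i)" .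
  have "(\<Sum>i\<in>S. H0 i i) - (\<Sum>i\<in>S. H i i) = (\<Sum>i\<in>S. \<Sum>j\<in>S. ?F i j * mat_mul S H H0 j i)"
    unfolding tr1[symmetric] tr2[symmetric] mat_mul_assoc
    by (simp add: mat_mul_def left_diff_distrib sum_subtractf)
  also have "\<dots> = (\<Sum>i\<in>S. \<Sum>j\<in>S. ?F i j *
      - (mat_mul S H (offdiag G) j i + mat_mul S H (mat_mul S (offdiag G0) H0) j i))"
  proof (intro sum.cong refl)
    fix i j assume ij: "i \<in> S" "j \<in> S"
    have "mat_mul S H H0 j i = (\<Sum>k\<in>S. H j k * ((if k = i then 1 else 0) - mat_mul S (offdiag G0) H0 k i))"
      unfolding mat_mul_def[of S H H0]
      using ij inverse_on_expand(2)[OF dom0 inv0] by (intro sum.cong) auto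
    also have "\<dots> = H j i - mat_mul S H (mat_mul S (offdiag G0) H0) j i"
      using ij fin by (simp add: right_diff_distrib sum_subtractf sum_indicator_eq mat_mul_def[of S H])
    finally show "?F i j * mat_mul S H H0 j i = ?F i j *
      - (mat_mul S H (offdiag G) j i + mat_mul S H (mat_mul S (offdiag G0) H0) j i)"
      using inverse_on_expand(1)[OF dom inv ij(2,1)] F0[OF ij(1)] by (cases "i = j") auto
  qed
  also have "\<dots> = - ((\<Sum>i\<in>S. \<Sum>j\<in>S. ?F i j * mat_mul S H (offdiag G) j i) +
      (\<Sum>i\<in>S. \<Sum>j\<in>S. ?F i j * mat_mul S H (mat_mul S (offdiag G0) H0) j i))"
    by (simp add: sum_negf sum.distrib distrib_left del: minus_add_distrib)
  finally have eq: "(\<Sum>i\<in>S. H0 i i) - (\<Sum>i\<in>S. H i i) =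
      - ((\<Sum>i\<in>S. \<Sum>j\<in>S. ?F i j * mat_mul S H (offdiag G) j i) +
      (\<Sum>i\<in>S. \<Sum>j\<in>S. ?F i j * mat_mul S H (mat_mul S (offdiag G0) H0) j i))" .
  have "\<bar>\<Sum>i\<in>S. \<Sum>j\<in>S. ?F i j * mat_mul S H (offdiag G) j i\<bar> \<le> fro S ?F * fro S (mat_mul S H (offdiag G))"
    by (rule abs_trace_mult_le_fro)
  also have "\<dots> \<le> fro S ?F * (?c * fro S (offdiag G))"
    by (intro mult_left_mono fro_inverse_mult[OF dom a inverse_on_solves[OF inv]]) auto
  finally have b1: "\<bar>\<Sum>i\<in>S. \<Sum>j\<in>S. ?F i j * mat_mul S H (offdiag G) j i\<bar> \<le> fro S ?F * (?c * fro S (offdiag G))" .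
  have "fro S (mat_mul S (offdiag G0) H0) = fro S (mat_mul S H0 (offdiag G0))"
    using inv0 dom0 by (subst fro_transpose[symmetric], intro fro_cong)
      (auto simp: mat_mul_def inverse_on_def row_dominant_def offdiag_def mult.commute intro!: sum.cong)
  also have "\<dots> \<le> ?c * fro S (offdiag G0)"
    by (rule fro_inverse_mult[OF dom0 a inverse_on_solves[OF inv0]])
  finally have E0: "fro S (mat_mul S (offdiag G0) H0) \<le> ?c * fro S (offdiag G0)" .
  have "\<bar>\<Sum>i\<in>S. \<Sum>j\<in>S. ?F i j * mat_mul S H (mat_mul S (offdiag G0) H0) j i\<bar> \<le>
      fro S ?F * fro S (mat_mul S H (mat_mul S (offdiag G0) H0))"
    by (rule abs_trace_mult_le_fro)
  also have "\<dots> \<le> fro S ?F * (?c * fro S (mat_mul S (offdiag G0) H0))"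
    by (intro mult_left_mono fro_inverse_mult[OF dom a inverse_on_solves[OF inv]]) auto
  also have "\<dots> \<le> fro S ?F * (?c * (?c * fro S (offdiag G0)))"
    using a by (intro mult_left_mono E0) auto
  finally have b2: "\<bar>\<Sum>i\<in>S. \<Sum>j\<in>S. ?F i j * mat_mul S H (mat_mul S (offdiag G0) H0) j i\<bar> \<le>
      fro S ?F * (?c * (?c * fro S (offdiag G0)))" .
  show ?thesis
    unfolding eq using b1 b2 by (simp add: distrib_left power2_eq_square mult.assoc)
qed

text \<open>If \<open>B\<close> collects the inner products of the columns of the dictionary with those of the generating
  one, then minus half of this is the conditional expectation of \<open>lasso_value\<close> given the support \<open>S\<close>,
  up to the energy of the sample, which does not depend on the dictionary.\<close>

definition mean_quad ::
  "nat set \<Rightarrow> real \<Rightarrow> real \<Rightarrow> real \<Rightarrow> real \<Rightarrow> (nat \<Rightarrow> nat \<Rightarrow> real) \<Rightarrow> (nat \<Rightarrow> nat \<Rightarrow> real) \<Rightarrow> (nat \<Rightarrow> nat \<Rightarrow> real) \<Rightarrow> real"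
  where "mean_quad S ex2 ea ee lam G B H = (\<Sum>a\<in>S. \<Sum>b\<in>S. H a b *
    (ex2 * (\<Sum>c\<in>S. B a c * B b c) + ee * G a b - lam * ea * (B a b + B b a) +
     lam\<^sup>2 * (if a = b then 1 else 0)))"

text \<open>The noise enters only through the sum of H against G, which is the size of
  \<open>S\<close>; this is the same for every dictionary and cancels in differences.\<close>

lemma mean_quad_eq:
  assumes dom: "row_dominant S a G" and inv: "inverse_on S G H"
  shows "mean_quad S ex2 ea ee lam G (\<lambda>a b. G a b - K a b) H =
    ex2 * (real (card S) - 2 * (\<Sum>a\<in>S. K a a) + (\<Sum>a\<in>S. \<Sum>c\<in>S. K a c * mat_mul S H K a c)) + ee * real (card S)
    - 2 * lam * ea * (real (card S) - (\<Sum>a\<in>S. mat_mul S H K a a)) + lam\<^sup>2 * (\<Sum>a\<in>S. H a a)"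
proof -
  let ?B = "\<lambda>a b. G a b - K a b"
  have fin: "finite S" using dom by (simp add: row_dominant_def)
  have "(\<Sum>a\<in>S. \<Sum>b\<in>S. H a b * (ex2 * (\<Sum>c\<in>S. ?B a c * ?B b c) + ee * G a b - lam * ea * (?B a b + ?B b a) +
       lam\<^sup>2 * (if a = b then 1 else 0))) =
     (\<Sum>a\<in>S. \<Sum>b\<in>S. ex2 * (H a b * (\<Sum>c\<in>S. ?B a c * ?B b c)) + ee * (H a b * G a b)
       - lam * ea * (H a b * ?B a b) - lam * ea * (H a b * ?B b a) + lam\<^sup>2 * (H a b * (if a = b then 1 else 0)))"
    by (intro sum.cong refl) algebra
  also have "\<dots> = ex2 * (\<Sum>a\<in>S. \<Sum>b\<in>S. H a b * (\<Sum>c\<in>S. ?B a c * ?B b c)) + ee * (\<Sum>a\<in>S. \<Sum>b\<in>S. H a b * G a b)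
       - lam * ea * (\<Sum>a\<in>S. \<Sum>b\<in>S. H a b * ?B a b) - lam * ea * (\<Sum>a\<in>S. \<Sum>b\<in>S. H a b * ?B b a)
       + lam\<^sup>2 * (\<Sum>a\<in>S. \<Sum>b\<in>S. H a b * (if a = b then 1 else 0))"
    by (simp only: sum.distrib sum_subtractf sum_distrib_left)
  also have "(\<Sum>a\<in>S. \<Sum>b\<in>S. H a b * ?B b a) = (\<Sum>a\<in>S. \<Sum>b\<in>S. H a b * ?B a b)"
    by (subst sum.swap) (intro sum.cong refl arg_cong2[where f = "(*)"] inverse_onD(3)[OF inv])
  also have "(\<Sum>a\<in>S. \<Sum>b\<in>S. H a b * G a b) = real (card S)"
    using trace_inverse_cross(2)[OF dom inv, where K = "\<lambda>_ _. 0"] by (simp add: mat_mul_def)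
  also have "(\<Sum>a\<in>S. \<Sum>b\<in>S. H a b * (if a = b then 1 else 0)) = (\<Sum>a\<in>S. H a a)"
    by (intro sum.cong refl sum_indicator_eq(2) fin)
  finally show ?thesis
    unfolding mean_quad_def trace_inverse_cross[OF dom inv] by (simp add: algebra_simps)
qed

text \<open>At the generating dictionary K is 0. With dominance constant 1/3 the inverse bound 1/(1
  - a) is 3/2, and its square is 9/4.\<close>

lemma mean_quad_gap:
  assumes dom: "row_dominant S (1/3) G" and inv: "inverse_on S G H"
    and dom0: "row_dominant S (1/3) G0" and inv0: "inverse_on S G0 H0"
    and K0: "\<And>i. i \<in> S \<Longrightarrow> K i i \<ge> 0" and pos: "ex2 \<ge> 0" "ea \<ge> 0" "lam \<ge> 0"
  shows "ex2 / 2 * (2 * (\<Sum>a\<in>S. K a a) - 3/2 * (fro S K)\<^sup>2)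
     - lam * ea * (3/2 * (\<Sum>a\<in>S. K a a) + 3/2 * fro S (offdiag G) * fro S (offdiag K))
     - lam\<^sup>2 / 2 * fro S (\<lambda>i j. G i j - G0 i j) * (3/2 * fro S (offdiag G) + 9/4 * fro S (offdiag G0))
   \<le> 1/2 * (mean_quad S ex2 ea ee lam G0 G0 H0 - mean_quad S ex2 ea ee lam G (\<lambda>a b. G a b - K a b) H)"
proof -
  let ?k = "\<Sum>a\<in>S. K a a"
  let ?q = "\<Sum>a\<in>S. \<Sum>c\<in>S. K a c * mat_mul S H K a c"
  let ?t = "\<Sum>a\<in>S. mat_mul S H K a a"
  let ?h = "(\<Sum>i\<in>S. H0 i i) - (\<Sum>i\<in>S. H i i)"
  have eq0: "mean_quad S ex2 ea ee lam G0 G0 H0 =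
      ex2 * real (card S) + ee * real (card S) - 2 * lam * ea * real (card S) + lam\<^sup>2 * (\<Sum>a\<in>S. H0 a a)"
    using mean_quad_eq[OF dom0 inv0, where K = "\<lambda>_ _. 0"] by (simp add: mat_mul_def)
  have eq: "1/2 * (mean_quad S ex2 ea ee lam G0 G0 H0 - mean_quad S ex2 ea ee lam G (\<lambda>a b. G a b - K a b) H)
      = ex2 / 2 * (2 * ?k - ?q) - lam * ea * ?t + lam\<^sup>2 / 2 * ?h"
    unfolding eq0 mean_quad_eq[OF dom inv] by (simp add: field_simps)
  have "\<bar>?q\<bar> \<le> fro S K * fro S (mat_mul S H K)"
    by (rule abs_sum_mult_le_fro)
  also have "\<dots> \<le> fro S K * (1 / (1 - 1/3) * fro S K)"
    by (intro mult_left_mono fro_inverse_mult[OF dom _ inverse_on_solves[OF inv]]) auto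
  finally have "?q \<le> 3/2 * (fro S K)\<^sup>2"
    by (simp add: power2_eq_square)
  then have 1: "ex2 / 2 * (2 * ?k - 3/2 * (fro S K)\<^sup>2) \<le> ex2 / 2 * (2 * ?k - ?q)"
    using pos by (intro mult_left_mono) auto
  have "?t \<le> 3/2 * ?k + 3/2 * fro S (offdiag G) * fro S (offdiag K)"
    using abs_trace_inverse_mult_le[where K = K, OF dom _ inv] K0 by simp
  then have 2: "lam * ea * ?t \<le> lam * ea * (3/2 * ?k + 3/2 * fro S (offdiag G) * fro S (offdiag K))"
    using pos by (intro mult_left_mono) auto
  have "- ?h \<le> fro S (\<lambda>i j. G i j - G0 i j) * (3/2 * fro S (offdiag G) + 9/4 * fro S (offdiag G0))"
    using trace_inverse_diff_le[OF dom _ inv dom0 inv0] by (simp add: power2_eq_square)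
  then have "lam\<^sup>2 / 2 * (- ?h) \<le> lam\<^sup>2 / 2 * (fro S (\<lambda>i j. G i j - G0 i j) *
      (3/2 * fro S (offdiag G) + 9/4 * fro S (offdiag G0)))"
    by (intro mult_left_mono) auto
  then show ?thesis
    unfolding eq mult.assoc[of "lam\<^sup>2 / 2"] mult_minus_right using 1 2 by linarith
qed

section \<open>Averaging over supports\<close>

definition supports :: "nat \<Rightarrow> nat \<Rightarrow> nat set set" where
  "supports p s = {S. S \<subseteq> {..<p} \<and> card S = s}"

lemma finite_supports [simp]: "finite (supports p s)"
  unfolding supports_def by (rule finite_subset[of _ "Pow {..<p}"]) auto

lemma supports_finite: "S \<in> supports p s \<Longrightarrow> finite S"
  unfolding supports_def using finite_subset by blast

lemma card_supports_superset:
  assumes T: "T \<subseteq> {..<p}" "card T \<le> s"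
  shows "card {S \<in> supports p s. T \<subseteq> S} = (p - card T) choose (s - card T)"
proof -
  have finT: "finite T" using T finite_subset by blast
  have "bij_betw (\<lambda>S. S - T) {S \<in> supports p s. T \<subseteq> S} {U. U \<subseteq> {..<p} - T \<and> card U = s - card T}"
  proof (rule bij_betw_byWitness[where f' = "\<lambda>U. U \<union> T"])
    show "(\<lambda>S. S - T) ` {S \<in> supports p s. T \<subseteq> S} \<subseteq> {U. U \<subseteq> {..<p} - T \<and> card U = s - card T}"
      using finT by (auto simp: supports_def card_Diff_subset)
    show "(\<lambda>U. U \<union> T) ` {U. U \<subseteq> {..<p} - T \<and> card U = s - card T} \<subseteq> {S \<in> supports p s. T \<subseteq> S}"
    proof safe
      fix U assume U: "U \<subseteq> {..<p} - T" "card U = s - card T"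
      have "finite U" using U finite_subset by blast
      then have "card (U \<union> T) = card U + card T"
        using U finT by (intro card_Un_disjoint) auto
      then show "U \<union> T \<in> supports p s"
        using U T by (auto simp: supports_def)
    qed
  qed auto
  then have "card {S \<in> supports p s. T \<subseteq> S} = card {U. U \<subseteq> {..<p} - T \<and> card U = s - card T}"
    by (rule bij_betw_same_card)
  also have "\<dots> = card ({..<p} - T) choose (s - card T)"
    by (rule n_subsets) simp
  also have "card ({..<p} - T) = p - card T"
    using T finT by (simp add: card_Diff_subset)
  finally show ?thesis .
qed

lemma card_supports_member:
  assumes "i < p" "s \<ge> 1"
  shows "real p * card {S \<in> supports p s. i \<in> S} = real s * (p choose s)"
proof -
  have "card {S \<in> supports p s. i \<in> S} = (p - 1) choose (s - 1)"
    using card_supports_superset[of "{i}" p s] assms by simp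
  then have "p * card {S \<in> supports p s. i \<in> S} = s * (p choose s)"
    using times_binomial_minus1_eq[of s p] assms by simp
  then show ?thesis by (metis of_nat_mult)
qed

text \<open>The proportion of such supports is s (s - 1) / (p (p - 1)), and p (s - 1) \<le> (p - 1)
  s because s \<le> p. For s below 2 no support contains both indices.\<close>

lemma card_supports_pair:
  assumes "i < p" "j < p" "i \<noteq> j" "s \<le> p"
  shows "(real p)\<^sup>2 * card {S \<in> supports p s. i \<in> S \<and> j \<in> S} \<le> (real s)\<^sup>2 * (p choose s)"
proof (cases "s \<ge> 2")
  case True
  define n where "n = card {S \<in> supports p s. i \<in> S \<and> j \<in> S}"
  have p2: "p \<ge> 2" using True assms by linarith
  have c: "card {i, j} = 2" using assms by simp
  have n: "n = (p - 2) choose (s - 2)"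
    using card_supports_superset[of "{i, j}" p s] assms True unfolding c n_def by simp
  have "s * (p choose s) = p * ((p - 1) choose (s - 1))"
    using times_binomial_minus1_eq[of s p] True by simp
  moreover have "(s - 1) * ((p - 1) choose (s - 1)) = (p - 1) * n"
    using times_binomial_minus1_eq[of "s - 1" "p - 1"] True by (simp add: n numeral_2_eq_2)
  ultimately have "(s - 1) * (s * (p choose s)) = p * ((p - 1) * n)"
    by (metis mult.left_commute)
  then have "real (s - 1) * (real s * real (p choose s)) = real p * (real (p - 1) * real n)"
    by (metis of_nat_mult)
  then have eq: "(real s - 1) * (real s * real (p choose s)) = real p * ((real p - 1) * real n)"
    using True p2 by (simp add: of_nat_diff)
  have "(real p - 1) * ((real p)\<^sup>2 * real n) = real p * ((real s - 1) * (real s * real (p choose s)))"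
    unfolding eq by (simp add: power2_eq_square)
  also have "\<dots> = (real p * (real s - 1)) * (real s * real (p choose s))" by simp
  also have "\<dots> \<le> ((real p - 1) * real s) * (real s * real (p choose s))"
    using assms by (intro mult_right_mono) (auto simp: algebra_simps)
  finally have "(real p - 1) * ((real p)\<^sup>2 * real n) \<le> (real p - 1) * ((real s)\<^sup>2 * (p choose s))"
    by (simp add: power2_eq_square mult_ac)
  then show ?thesis
    using p2 unfolding n_def by (subst (asm) mult_le_cancel_left_pos) auto
next
  case False
  have empty: "{S \<in> supports p s. i \<in> S \<and> j \<in> S} = {}"
  proof (rule ccontr)
    assume "\<not> ?thesis"
    then obtain S where S: "S \<in> supports p s" "{i, j} \<subseteq> S" by auto
    then have "card {i, j} \<le> card S"
      by (intro card_mono supports_finite)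
    then show False using S False assms by (simp add: supports_def)
  qed
  show ?thesis unfolding empty by simp
qed

lemma sum_support_restrict:
  assumes "S \<in> supports p s"
  shows "(\<Sum>i\<in>S. g i) = (\<Sum>i<p. if i \<in> S then g i else (0 :: real))"
  using assms by (intro sum.mono_neutral_cong_left) (auto simp: supports_def)

lemma sum_supports_single:
  assumes "s \<ge> 1"
  shows "real p * (\<Sum>S\<in>supports p s. \<Sum>i\<in>S. f i) = real s * (p choose s) * (\<Sum>i<p. f i :: real)"
proof -
  have "(\<Sum>S\<in>supports p s. \<Sum>i\<in>S. f i) = (\<Sum>S\<in>supports p s. \<Sum>i<p. if i \<in> S then f i else 0)"
    by (intro sum.cong refl sum_support_restrict)
  also have "\<dots> = (\<Sum>i<p. \<Sum>S\<in>supports p s. if i \<in> S then f i else 0)"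
    by (rule sum.swap)
  also have "\<dots> = (\<Sum>i<p. card {S \<in> supports p s. i \<in> S} * f i)"
    by (intro sum.cong refl) (subst sum.inter_filter[symmetric], simp_all)
  finally have "real p * (\<Sum>S\<in>supports p s. \<Sum>i\<in>S. f i) =
      (\<Sum>i<p. (real p * card {S \<in> supports p s. i \<in> S}) * f i)"
    by (simp add: sum_distrib_left mult.assoc)
  also have "\<dots> = (\<Sum>i<p. (real s * (p choose s)) * f i)"
    using assms by (intro sum.cong refl) (simp add: card_supports_member)
  finally show ?thesis by (simp add: sum_distrib_left)
qed

text \<open>A pair with i = j would occur with frequency s/p instead of (s/p)^2; this is why
  \<open>f\<close> vanishes on the diagonal, and why the matrices fed into it are cut down by
  \<open>offdiag\<close>.\<close>

lemma sum_supports_pairs: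
  assumes "s \<le> p" and f: "\<And>i j. f i j \<ge> (0 :: real)" and f0: "\<And>i. f i i = 0"
  shows "(real p)\<^sup>2 * (\<Sum>S\<in>supports p s. \<Sum>i\<in>S. \<Sum>j\<in>S. f i j) \<le> (real s)\<^sup>2 * (p choose s) * (\<Sum>i<p. \<Sum>j<p. f i j)"
proof -
  have "(\<Sum>S\<in>supports p s. \<Sum>i\<in>S. \<Sum>j\<in>S. f i j) =
      (\<Sum>S\<in>supports p s. \<Sum>i<p. \<Sum>j<p. if i \<in> S \<and> j \<in> S then f i j else 0)"
  proof (rule sum.cong[OF refl])
    fix S assume S: "S \<in> supports p s"
    show "(\<Sum>i\<in>S. \<Sum>j\<in>S. f i j) = (\<Sum>i<p. \<Sum>j<p. if i \<in> S \<and> j \<in> S then f i j else 0)"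
      unfolding sum_support_restrict[OF S] by (rule sum.cong[OF refl]) simp
  qed
  also have "\<dots> = (\<Sum>i<p. \<Sum>S\<in>supports p s. \<Sum>j<p. if i \<in> S \<and> j \<in> S then f i j else 0)"
    by (rule sum.swap)
  also have "\<dots> = (\<Sum>i<p. \<Sum>j<p. \<Sum>S\<in>supports p s. if i \<in> S \<and> j \<in> S then f i j else 0)"
    by (intro sum.cong refl sum.swap)
  also have "\<dots> = (\<Sum>i<p. \<Sum>j<p. card {S \<in> supports p s. i \<in> S \<and> j \<in> S} * f i j)"
    by (intro sum.cong refl) (subst sum.inter_filter[symmetric], simp_all)
  finally have "(real p)\<^sup>2 * (\<Sum>S\<in>supports p s. \<Sum>i\<in>S. \<Sum>j\<in>S. f i j) =
      (\<Sum>i<p. \<Sum>j<p. ((real p)\<^sup>2 * card {S \<in> supports p s. i \<in> S \<and> j \<in> S}) * f i j)"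
    by (simp add: sum_distrib_left mult.assoc)
  also have "\<dots> \<le> (\<Sum>i<p. \<Sum>j<p. ((real s)\<^sup>2 * (p choose s)) * f i j)"
  proof (intro sum_mono)
    fix i j assume "i \<in> {..<p}" "j \<in> {..<p}"
    then show "((real p)\<^sup>2 * card {S \<in> supports p s. i \<in> S \<and> j \<in> S}) * f i j \<le> ((real s)\<^sup>2 * (p choose s)) * f i j"
      using f[of i j] f0 assms(1) card_supports_pair[of i p j s]
      by (cases "i = j") (auto intro!: mult_right_mono)
  qed
  finally show ?thesis by (simp add: sum_distrib_left)
qed

lemma sum_supports_fro_sq:
  assumes "s \<le> p" "p \<ge> 1" and A0: "\<And>i. A i i = 0"
  shows "(\<Sum>S\<in>supports p s. (fro S A)\<^sup>2) \<le> (real s / real p)\<^sup>2 * (p choose s) * (fro {..<p} A)\<^sup>2"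
  using sum_supports_pairs[OF assms(1), of "\<lambda>i j. (A i j)\<^sup>2"] assms(2) A0
  by (simp add: fro_sq power_divide field_simps)

text \<open>Cauchy-Schwarz over the family of supports, so that each factor is averaged on its
  own.\<close>

lemma sum_supports_fro_mult:
  assumes sp: "s \<le> p" "p \<ge> 1" and A0: "\<And>i. A i i = 0" and B0: "\<And>i. B i i = 0"
  shows "(\<Sum>S\<in>supports p s. fro S A * fro S B) \<le>
    (real s / real p)\<^sup>2 * (p choose s) * (fro {..<p} A * fro {..<p} B)"
proof -
  have L2: "L2_set (\<lambda>S. fro S A) (supports p s) \<le> (real s / real p) * sqrt (p choose s) * fro {..<p} A"
    if "\<And>i. A i i = 0" for A
  proof (rule power2_le_imp_le)
    show "(L2_set (\<lambda>S. fro S A) (supports p s))\<^sup>2 \<le> (real s / real p * sqrt (p choose s) * fro {..<p} A)\<^sup>2"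
      using sum_supports_fro_sq[where A = A, OF sp that] by (simp only: L2_set_power2 power_mult_distrib real_sqrt_pow2 of_nat_0_le_iff)
  qed simp
  have "(\<Sum>S\<in>supports p s. fro S A * fro S B) = (\<Sum>S\<in>supports p s. \<bar>fro S A\<bar> * \<bar>fro S B\<bar>)"
    by simp
  also have "\<dots> \<le> L2_set (\<lambda>S. fro S A) (supports p s) * L2_set (\<lambda>S. fro S B) (supports p s)"
    by (rule L2_set_mult_ineq)
  also have "\<dots> \<le> ((real s / real p) * sqrt (p choose s) * fro {..<p} A) *
      ((real s / real p) * sqrt (p choose s) * fro {..<p} B)"
    by (intro mult_mono L2 A0 B0) auto
  also have "\<dots> = (real s / real p)\<^sup>2 * (sqrt (p choose s))\<^sup>2 * (fro {..<p} A * fro {..<p} B)"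
    by (simp add: power2_eq_square)
  finally show ?thesis by simp
qed

section \<open>Operator norm bounds for Gram matrices\<close>

lemma opnorm2_bound:
  "L2_set (\<lambda>i. \<Sum>j<p. D i j * x j) {..<m} \<le> opnorm2 m p D * L2_set x {..<p}"
proof (cases "L2_set x {..<p} = 0")
  case True
  then show ?thesis using matvec_le_frob[where A = D and x = x and m = m and p = p] by simp
next
  case False
  define c where "c = L2_set x {..<p}"
  have c: "c > 0" using False L2_set_nonneg[of x "{..<p}"] unfolding c_def by linarith
  define x' where "x' j = (if j < p then x j / c else 0)" for j
  let ?X = "{x :: nat \<Rightarrow> real. (\<forall>j\<ge>p. x j = 0) \<and> (\<Sum>j<p. (x j)\<^sup>2) \<le> 1}"
  let ?f = "\<lambda>x. sqrt (\<Sum>i<m. (\<Sum>j<p. D i j * x j)\<^sup>2)"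
  have "(\<Sum>j<p. (x' j)\<^sup>2) = (\<Sum>j<p. (x j)\<^sup>2) / c\<^sup>2"
    by (simp add: x'_def power_divide sum_divide_distrib)
  then have "x' \<in> ?X"
    using c by (simp add: x'_def c_def L2_set_power2)
  \<comment> \<open>\<open>opnorm2\<close> is a supremum of reals, so comparing a member with it
    requires boundedness, here supplied by the Frobenius norm.\<close>
  moreover have "bdd_above (?f ` ?X)"
  proof (intro bdd_aboveI2)
    fix x :: "nat \<Rightarrow> real" assume x: "x \<in> ?X"
    have "?f x \<le> frob m p D * L2_set x {..<p}"
      using matvec_le_frob[where A = D and x = x and m = m and p = p] by (simp add: L2_set_def)
    also have "\<dots> \<le> frob m p D * 1"
      using x by (intro mult_left_mono) (auto simp: L2_set_def)
    finally show "?f x \<le> frob m p D" by simp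
  qed
  ultimately have "?f x' \<le> opnorm2 m p D"
    unfolding opnorm2_def by (rule cSUP_upper)
  moreover have "(\<Sum>j<p. D i j * x' j) = 1 / c * (\<Sum>j<p. D i j * x j)" for i
    by (simp add: x'_def sum_distrib_left)
  then have "?f x' = L2_set (\<lambda>i. 1 / c * (\<Sum>j<p. D i j * x j)) {..<m}"
    by (simp only: L2_set_def)
  then have "?f x' = 1 / c * L2_set (\<lambda>i. \<Sum>j<p. D i j * x j) {..<m}"
    using c by (subst L2_set_right_distrib) auto
  ultimately have "1 / c * L2_set (\<lambda>i. \<Sum>j<p. D i j * x j) {..<m} \<le> opnorm2 m p D"
    by linarith
  then show ?thesis
    using c unfolding c_def[symmetric] by (simp add: pos_divide_le_eq)
qed

lemma opnorm2_nonneg: "opnorm2 m p D \<ge> 0" if "p \<ge> 1"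
proof -
  have "L2_set (\<lambda>j. if j = 0 then 1 else 0) {..<p} = 1"
    using that by (simp add: L2_set_def if_distrib[of "\<lambda>x. x\<^sup>2"] cong: if_cong)
  then have "L2_set (\<lambda>i. \<Sum>j<p. D i j * (if j = 0 then 1 else 0)) {..<m} \<le> opnorm2 m p D"
    using opnorm2_bound[where D = D and x = "\<lambda>j. if j = 0 then 1 else 0" and m = m and p = p]
    by (simp only: mult_1_right)
  then show ?thesis
    by (rule order.trans[OF L2_set_nonneg])
qed

text \<open>With w = D^T v, |w|^2 is the inner product of v with D w, hence at most |v| ||D|| |w|;
  one factor |w| cancels.\<close>

lemma opnorm2_transpose_bound:
  "L2_set (\<lambda>j. \<Sum>i<m. D i j * v i) {..<p} \<le> opnorm2 m p D * L2_set v {..<m}" if "p \<ge> 1"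
proof -
  let ?w = "\<lambda>j. \<Sum>i<m. D i j * v i"
  have "(L2_set ?w {..<p})\<^sup>2 = (\<Sum>j<p. \<Sum>i<m. D i j * v i * ?w j)"
    unfolding L2_set_power2 by (simp add: power2_eq_square sum_distrib_right)
  also have "\<dots> = (\<Sum>i<m. v i * (\<Sum>j<p. D i j * ?w j))"
    by (subst sum.swap) (simp add: sum_distrib_left mult_ac)
  also have "\<dots> \<le> L2_set v {..<m} * L2_set (\<lambda>i. \<Sum>j<p. D i j * ?w j) {..<m}"
    using abs_sum_mult_le_L2[of v "\<lambda>i. \<Sum>j<p. D i j * ?w j" "{..<m}"] by linarith
  also have "\<dots> \<le> L2_set v {..<m} * (opnorm2 m p D * L2_set ?w {..<p})"
    by (intro mult_left_mono opnorm2_bound) simp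
  finally have le: "L2_set ?w {..<p} * L2_set ?w {..<p} \<le> (opnorm2 m p D * L2_set v {..<m}) * L2_set ?w {..<p}"
    by (simp add: power2_eq_square mult_ac)
  show ?thesis
  proof (cases "L2_set ?w {..<p} = 0")
    case True
    then show ?thesis using opnorm2_nonneg[OF that, of m D] by simp
  next
    case False
    then have "L2_set ?w {..<p} > 0" using L2_set_nonneg[of ?w "{..<p}"] by linarith
    then show ?thesis using le by simp
  qed
qed

lemma fro_triangle: "fro S (\<lambda>i j. A i j + B i j) \<le> fro S A + fro S B"
  using L2_set_triangle_ineq[of "\<lambda>(i, j). A i j" "\<lambda>(i, j). B i j" "S \<times> S"]
  by (simp add: fro_def case_prod_unfold)

lemma frob_sq_columns: "(frob m p A)\<^sup>2 = (\<Sum>k<p. (L2_set (\<lambda>i. A i k) {..<m})\<^sup>2)"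
  unfolding frob_sq L2_set_power2 by (rule sum.swap)

lemma fro_gram_le_opnorm2:
  assumes "p \<ge> 1"
  shows "fro {..<p} (gram m D A) \<le> opnorm2 m p D * frob m p A"
proof (rule power2_le_imp_le)
  have "(fro {..<p} (gram m D A))\<^sup>2 = (\<Sum>k<p. (L2_set (\<lambda>j. \<Sum>i<m. D i j * A i k) {..<p})\<^sup>2)"
    unfolding fro_sq L2_set_power2 gram_def by (rule sum.swap)
  also have "\<dots> \<le> (\<Sum>k<p. (opnorm2 m p D * L2_set (\<lambda>i. A i k) {..<m})\<^sup>2)"
    by (intro sum_mono power_mono opnorm2_transpose_bound assms) simp
  finally show "(fro {..<p} (gram m D A))\<^sup>2 \<le> (opnorm2 m p D * frob m p A)\<^sup>2"
    by (simp add: power_mult_distrib sum_distrib_left frob_sq_columns)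
  show "0 \<le> opnorm2 m p D * frob m p A"
    using opnorm2_nonneg[OF assms] by simp
qed

lemma fro_gram_le_frob: "fro {..<p} (gram m A A) \<le> (frob m p A)\<^sup>2"
proof (rule power2_le_imp_le)
  let ?n = "\<lambda>k. L2_set (\<lambda>i. A i k) {..<m}"
  have "(fro {..<p} (gram m A A))\<^sup>2 \<le> (\<Sum>j<p. \<Sum>k<p. (?n j)\<^sup>2 * (?n k)\<^sup>2)"
    unfolding fro_sq
  proof (intro sum_mono)
    fix j k
    have "\<bar>gram m A A j k\<bar> \<le> \<bar>?n j * ?n k\<bar>"
      unfolding gram_def using abs_sum_mult_le_L2[of "\<lambda>i. A i j" "\<lambda>i. A i k" "{..<m}"] by simp
    then have "(gram m A A j k)\<^sup>2 \<le> (?n j * ?n k)\<^sup>2"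
      by (simp only: abs_le_square_iff)
    then show "(gram m A A j k)\<^sup>2 \<le> (?n j)\<^sup>2 * (?n k)\<^sup>2"
      by (simp only: power_mult_distrib)
  qed
  also have "\<dots> = ((frob m p A)\<^sup>2)\<^sup>2"
    unfolding frob_sq_columns by (simp add: power2_eq_square sum_product)
  finally show "(fro {..<p} (gram m A A))\<^sup>2 \<le> ((frob m p A)\<^sup>2)\<^sup>2" .
qed simp

section \<open>Coherence and the averaged gap\<close>

lemma cum_coherence_ge:
  assumes "T \<subseteq> {..<p}" "card T \<le> s" "j < p" "j \<notin> T"
  shows "(\<Sum>k\<in>T. \<bar>gram m D D k j\<bar>) \<le> cum_coherence s m p D"
proof -
  let ?f = "\<lambda>(J, j). \<Sum>k\<in>J. \<bar>\<Sum>i<m. D i k * D i j\<bar>"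
  let ?V = "{(\<Sum>k\<in>J. \<bar>\<Sum>i<m. D i k * D i j\<bar>) | J j. J \<subseteq> {..<p} \<and> card J \<le> s \<and> j < p \<and> j \<notin> J}"
  have "?V \<subseteq> ?f ` (Pow {..<p} \<times> {..<p})" by force
  then have "finite ?V" by (rule finite_subset) simp
  moreover have "(\<Sum>k\<in>T. \<bar>\<Sum>i<m. D i k * D i j\<bar>) \<in> ?V"
    using assms by blast
  ultimately show ?thesis
    unfolding cum_coherence_def gram_def by (rule Max_ge)
qed

lemma gram_unit: "D \<in> oblique m p \<Longrightarrow> j < p \<Longrightarrow> gram m D D j j = 1"
  by (simp add: oblique_def gram_def power2_eq_square)

lemma column_norm_oblique: "D \<in> oblique m p \<Longrightarrow> j < p \<Longrightarrow> L2_set (\<lambda>i. D i j) {..<m} = 1"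
  by (simp add: oblique_def L2_set_def)

lemma L2_columns_le_frob:
  assumes "T \<subseteq> {..<p}"
  shows "L2_set (\<lambda>k. L2_set (\<lambda>i. A i k) {..<m}) T \<le> frob m p A"
proof (rule power2_le_imp_le)
  show "(L2_set (\<lambda>k. L2_set (\<lambda>i. A i k) {..<m}) T)\<^sup>2 \<le> (frob m p A)\<^sup>2"
    unfolding frob_sq_columns L2_set_power2[of _ T] using assms by (intro sum_mono2) auto
qed simp

lemma column_le_frob: "j < p \<Longrightarrow> L2_set (\<lambda>i. A i j) {..<m} \<le> frob m p A"
  using L2_columns_le_frob[of "{j}" p A m] by (simp add: L2_set_def)

text \<open>A bound rather than the value of \<open>cum_coherence\<close>, so that the enlarged
  constant for a nearby dictionary can be carried in the same form.\<close>

definition coherent :: "nat \<Rightarrow> nat \<Rightarrow> nat \<Rightarrow> rmat \<Rightarrow> real \<Rightarrow> bool" where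
  "coherent s m p D a \<longleftrightarrow> (\<forall>T j. T \<subseteq> {..<p} \<longrightarrow> card T \<le> s \<longrightarrow> j < p \<longrightarrow> j \<notin> T \<longrightarrow>
     (\<Sum>k\<in>T. \<bar>gram m D D k j\<bar>) \<le> a)"

lemma coherentD:
  assumes "coherent s m p D a" "T \<subseteq> {..<p}" "card T \<le> s" "j < p" "j \<notin> T"
  shows "(\<Sum>k\<in>T. \<bar>gram m D D k j\<bar>) \<le> a"
  using assms unfolding coherent_def by blast

lemma coherent_row_dominant:
  assumes D: "D \<in> oblique m p" and coh: "coherent s m p D a" and T: "T \<subseteq> {..<p}" "card T \<le> s"
    and ab: "a \<le> b"
  shows "row_dominant T b (gram m D D)"
  unfolding row_dominant_def
proof (intro conjI ballI)
  show fin: "finite T" using T finite_subset by blast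
  fix i assume i: "i \<in> T"
  show "gram m D D i i = 1" using gram_unit[OF D] i T by auto
  have "card (T - {i}) \<le> s"
    using card_Diff1_le[of T i] T by linarith
  then have "(\<Sum>k\<in>T - {i}. \<bar>gram m D D k i\<bar>) \<le> a"
    using i T by (intro coherentD[OF coh]) auto
  then show "(\<Sum>j\<in>T - {i}. \<bar>gram m D D i j\<bar>) \<le> b"
    using ab by (simp add: gram_commute[of m D D i])
next
  fix i j show "gram m D D i j = gram m D D j i" by (rule gram_commute)
qed

text \<open>With E = D - D0 the Gram matrix splits as D0^T D0 + D0^T E + E^T D. The constant 9/4 is
  5/4 from the second part plus 1 from the third; both are sums over at most \<open>s\<close>
  columns, hence the factor sqrt s.\<close>

lemma coherent_perturb:
  assumes D0: "D0 \<in> oblique m p" and D: "D \<in> oblique m p"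
    and coh: "coherent s m p D0 a" and a: "a \<le> 1/4"
  shows "coherent s m p D (a + 9/4 * sqrt s * frob_dist m p D D0)"
  unfolding coherent_def
proof (intro allI impI)
  fix T j assume T: "T \<subseteq> {..<p}" "card T \<le> s" and j: "j < p" "j \<notin> T"
  define d where "d = frob_dist m p D D0"
  define E where "E = (\<lambda>i j. D i j - D0 i j)"
  have d: "d = frob m p E" by (simp add: d_def frob_dist_def E_def)
  have fin: "finite T" using T finite_subset by blast
  have split: "gram m D D k j = gram m D0 D0 k j + gram m D0 E k j + gram m E D k j" for k
    unfolding gram_def E_def by (simp add: sum.distrib[symmetric] algebra_simps)
  have 1: "(\<Sum>k\<in>T. \<bar>gram m D0 D0 k j\<bar>) \<le> a"
    by (rule coherentD[OF coh T j])
  have 2: "(\<Sum>k\<in>T. \<bar>gram m D0 E k j\<bar>) \<le> 5/4 * sqrt s * d"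
  proof -
    \<comment> \<open>Signs turn the sum of absolute values into one inner product of column
      \<open>j\<close> of \<open>E\<close> with a signed sum of columns of \<open>D0\<close>. By row
      dominance with 1/4 the squared norm of that sum is at most 5/4 s; the root of 5/4 is rounded
      up to 5/4.\<close>
    define \<sigma> where "\<sigma> k = sgn (gram m D0 E k j)" for k
    have dom: "row_dominant T (1/4) (gram m D0 D0)"
      by (rule coherent_row_dominant[OF D0 coh T a])
    let ?v = "\<lambda>i. \<Sum>k\<in>T. D0 i k * \<sigma> k"
    have "(\<Sum>k\<in>T. (\<sigma> k)\<^sup>2) \<le> (\<Sum>k\<in>T. 1)"
      by (intro sum_mono) (simp add: \<sigma>_def sgn_if)
    also have "\<dots> \<le> s" using T by simp
    finally have \<sigma>2: "(\<Sum>k\<in>T. (\<sigma> k)\<^sup>2) \<le> s" .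
    have "(L2_set ?v {..<m})\<^sup>2 = (\<Sum>k\<in>T. \<sigma> k * (\<Sum>l\<in>T. gram m D0 D0 k l * \<sigma> l))"
      unfolding L2_set_power2 unfolding power2_eq_square by (rule sum_comb_mult)
    also have "\<dots> \<le> 5/4 * (\<Sum>k\<in>T. (\<sigma> k)\<^sup>2)"
      using row_dominant_quadratic[OF dom, of \<sigma>] by linarith
    also have "\<dots> \<le> (5/4 * sqrt s)\<^sup>2"
      using \<sigma>2 by (simp add: power_mult_distrib power2_eq_square)
    finally have v: "L2_set ?v {..<m} \<le> 5/4 * sqrt s"
      by (rule power2_le_imp_le) simp
    have "(\<Sum>k\<in>T. \<bar>gram m D0 E k j\<bar>) = (\<Sum>k\<in>T. gram m E D0 j k * \<sigma> k)"
      by (intro sum.cong refl) (simp add: \<sigma>_def abs_sgn gram_commute[of m E])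
    also have "\<dots> = (\<Sum>i<m. E i j * ?v i)"
      by (rule sum_col_comb[symmetric])
    also have "\<dots> \<le> L2_set (\<lambda>i. E i j) {..<m} * L2_set ?v {..<m}"
      using abs_sum_mult_le_L2[of "\<lambda>i. E i j" ?v "{..<m}"] by linarith
    also have "\<dots> \<le> d * (5/4 * sqrt s)"
      unfolding d using column_le_frob[OF j(1), of E m] v by (intro mult_mono) auto
    finally show ?thesis by (simp add: mult_ac)
  qed
  have 3: "(\<Sum>k\<in>T. \<bar>gram m E D k j\<bar>) \<le> sqrt s * d"
  proof -
    have "(\<Sum>k\<in>T. \<bar>gram m E D k j\<bar>) \<le> (\<Sum>k\<in>T. \<bar>1\<bar> * \<bar>L2_set (\<lambda>i. E i k) {..<m}\<bar>)"
    proof (intro sum_mono)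
      fix k
      show "\<bar>gram m E D k j\<bar> \<le> \<bar>1\<bar> * \<bar>L2_set (\<lambda>i. E i k) {..<m}\<bar>"
        using abs_sum_mult_le_L2[of "\<lambda>i. E i k" "\<lambda>i. D i j" "{..<m}"] column_norm_oblique[OF D j(1)]
        by (simp add: gram_def)
    qed
    also have "\<dots> \<le> L2_set (\<lambda>_. 1) T * L2_set (\<lambda>k. L2_set (\<lambda>i. E i k) {..<m}) T"
      by (rule L2_set_mult_ineq)
    also have "\<dots> \<le> sqrt s * d"
      unfolding d using T L2_columns_le_frob[OF T(1), of E m]
      by (intro mult_mono) (auto simp: L2_set_constant)
    finally show ?thesis .
  qed
  have "(\<Sum>k\<in>T. \<bar>gram m D D k j\<bar>) \<le>
      (\<Sum>k\<in>T. \<bar>gram m D0 D0 k j\<bar> + \<bar>gram m D0 E k j\<bar> + \<bar>gram m E D k j\<bar>)"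
    unfolding split by (intro sum_mono) linarith
  also have "\<dots> \<le> a + 9/4 * sqrt s * d"
    unfolding sum.distrib using 1 2 3 by linarith
  finally show "(\<Sum>k\<in>T. \<bar>gram m D D k j\<bar>) \<le> a + 9/4 * sqrt s * frob_dist m p D D0"
    by (simp add: d_def)
qed

text \<open>Here q is s/p, L is the operator norm of D0 plus 1, and e0, e, f, k are the Frobenius
  norms of the off-diagonal parts of G0, G, G - G0 and K. After division by q \<rho> everything is
  compared with ex2 \<rho>: the main term is at least 9/20 of it, and the losses are at most 63/64 w
  \<rho> + 39/16 w g. Since w \<rho> is at most a quarter and w g less than 1/24 of ex2 \<rho>, the
  losses stay below 7/20.\<close>

lemma averaged_gap_arith:
  fixes q L \<rho> e0 e f k ex2 ea lam :: real
  assumes q: "q > 0" "q * L\<^sup>2 \<le> 1/16" and L: "L \<ge> 1" and \<rho>: "\<rho> > 0"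
    and e0: "e0 \<ge> 0" and e: "0 \<le> e" "e \<le> e0 + 2 * L * \<rho>" and f: "0 \<le> f" "f \<le> 2 * L * \<rho>"
    and k: "0 \<le> k" "k \<le> L * \<rho>" and lam: "lam > 0" "4 * lam \<le> ea" "4 * lam * ea \<le> ex2"
    and gap: "24 * lam * ea * q * L\<^sup>2 * e0 < ex2 * \<rho>"
  shows "0 < ex2 / 2 * (q * \<rho>\<^sup>2 - 3/2 * (q * \<rho>\<^sup>2 / 784 + q\<^sup>2 * k\<^sup>2))
    - lam * ea * (3/4 * (q * \<rho>\<^sup>2) + 3/2 * (q\<^sup>2 * (e * k)))
    - lam\<^sup>2 / 2 * (3/2 * (q\<^sup>2 * (f * e)) + 9/4 * (q\<^sup>2 * (f * e0)))"
proof -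
  define g where "g = q * L * e0"
  define w where "w = lam * ea"
  have ea: "ea > 0" using lam by linarith
  have w: "w > 0" using lam ea by (simp add: w_def)
  have wx: "4 * w \<le> ex2" using lam by (simp add: w_def mult.assoc)
  have ex2: "ex2 > 0" using w wx by linarith
  have g0: "g \<ge> 0" using q L e0 by (simp add: g_def)
  \<comment> \<open>One factor q L^2 \<le> 1/16 turns a pair term, which carries q^2, into a
    sixteenth of the main term q \<rho>^2.\<close>
  have qL: "q\<^sup>2 * (L\<^sup>2 * \<rho>\<^sup>2) \<le> q * \<rho>\<^sup>2 / 16"
  proof -
    have "(q * \<rho>\<^sup>2) * (q * L\<^sup>2) \<le> (q * \<rho>\<^sup>2) * (1/16)"
      using q by (intro mult_left_mono) auto
    then show ?thesis by (simp add: power2_eq_square mult_ac)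
  qed
  have k2: "q\<^sup>2 * k\<^sup>2 \<le> q * \<rho>\<^sup>2 / 16"
  proof -
    have "k\<^sup>2 \<le> (L * \<rho>)\<^sup>2" using k by (intro power_mono) auto
    then have "q\<^sup>2 * k\<^sup>2 \<le> q\<^sup>2 * (L * \<rho>)\<^sup>2" by (intro mult_left_mono) auto
    then show ?thesis using qL by (simp add: power_mult_distrib)
  qed
  have ek: "q\<^sup>2 * (e * k) \<le> q * \<rho> * g + q * \<rho>\<^sup>2 / 8"
  proof -
    have "e * k \<le> (e0 + 2 * L * \<rho>) * (L * \<rho>)"
      using e k e0 L \<rho> by (intro mult_mono) auto
    then have "q\<^sup>2 * (e * k) \<le> q\<^sup>2 * ((e0 + 2 * L * \<rho>) * (L * \<rho>))"
      by (intro mult_left_mono) auto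
    also have "\<dots> = q * \<rho> * g + 2 * (q\<^sup>2 * (L\<^sup>2 * \<rho>\<^sup>2))"
      by (simp add: g_def power2_eq_square algebra_simps)
    finally show ?thesis using qL by linarith
  qed
  have fe: "3/2 * (q\<^sup>2 * (f * e)) + 9/4 * (q\<^sup>2 * (f * e0)) \<le> 15/2 * (q * \<rho> * g) + 3/8 * (q * \<rho>\<^sup>2)"
  proof -
    have "f * e \<le> (2 * L * \<rho>) * (e0 + 2 * L * \<rho>)"
      using e f e0 L \<rho> by (intro mult_mono) auto
    moreover have "f * e0 \<le> (2 * L * \<rho>) * e0"
      using f e0 by (intro mult_right_mono) auto
    ultimately have "3/2 * (f * e) + 9/4 * (f * e0) \<le> 3/2 * ((2 * L * \<rho>) * (e0 + 2 * L * \<rho>)) + 9/4 * ((2 * L * \<rho>) * e0)"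
      by linarith
    then have "q\<^sup>2 * (3/2 * (f * e) + 9/4 * (f * e0)) \<le>
        q\<^sup>2 * (3/2 * ((2 * L * \<rho>) * (e0 + 2 * L * \<rho>)) + 9/4 * ((2 * L * \<rho>) * e0))"
      by (intro mult_left_mono) auto
    also have "\<dots> = 15/2 * (q * \<rho> * g) + 6 * (q\<^sup>2 * (L\<^sup>2 * \<rho>\<^sup>2))"
      by (simp add: g_def power2_eq_square algebra_simps)
    finally show ?thesis using qL by (simp add: algebra_simps)
  qed
  have l2: "lam\<^sup>2 / 2 \<le> w / 8"
    using mult_left_mono[OF lam(2), of lam] lam(1) by (simp add: w_def power2_eq_square)
  have T3: "lam\<^sup>2 / 2 * (3/2 * (q\<^sup>2 * (f * e)) + 9/4 * (q\<^sup>2 * (f * e0))) \<le>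
      w / 8 * (15/2 * (q * \<rho> * g) + 3/8 * (q * \<rho>\<^sup>2))"
    using l2 fe w f e e0 by (intro mult_mono) auto
  have T2: "w * (3/4 * (q * \<rho>\<^sup>2) + 3/2 * (q\<^sup>2 * (e * k))) \<le>
      w * (15/16 * (q * \<rho>\<^sup>2) + 3/2 * (q * \<rho> * g))"
    using w ek by (intro mult_left_mono) auto
  have arith: "9/20 * x \<le> 1/2 * (x - 3/2 * (x / 784 + y))" if "0 \<le> x" "y \<le> x / 16" for x y :: real
    using that by (simp add: field_simps)
  have "9/20 * (q * \<rho>\<^sup>2) \<le> 1/2 * (q * \<rho>\<^sup>2 - 3/2 * (q * \<rho>\<^sup>2 / 784 + q\<^sup>2 * k\<^sup>2))"
    using k2 q by (intro arith) auto
  then have "ex2 * (9/20 * (q * \<rho>\<^sup>2)) \<le> ex2 * (1/2 * (q * \<rho>\<^sup>2 - 3/2 * (q * \<rho>\<^sup>2 / 784 + q\<^sup>2 * k\<^sup>2)))"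
    using ex2 by (intro mult_left_mono) auto
  then have T1: "ex2 * (9/20 * (q * \<rho>\<^sup>2)) \<le> ex2 / 2 * (q * \<rho>\<^sup>2 - 3/2 * (q * \<rho>\<^sup>2 / 784 + q\<^sup>2 * k\<^sup>2))"
    by simp
  have "24 * w * g * 1 \<le> 24 * w * g * L"
    using w g0 L by (intro mult_left_mono) auto
  also have "\<dots> < ex2 * \<rho>"
    using gap by (simp add: w_def g_def power2_eq_square mult_ac)
  finally have gap': "24 * (w * g) < ex2 * \<rho>" by simp
  have wx': "4 * (w * \<rho>) \<le> ex2 * \<rho>"
    using mult_right_mono[OF wx, of \<rho>] \<rho> by simp
  have ex\<rho>: "ex2 * \<rho> > 0" using ex2 \<rho> by simp
  have "0 < 9/20 * (ex2 * \<rho>) - 15/16 * (w * \<rho>) - 3/2 * (w * g) - 15/16 * (w * g) - 3/64 * (w * \<rho>)"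
    using gap' wx' ex\<rho> w g0 mult_nonneg_nonneg[of w g] by linarith
  then have "0 < (q * \<rho>) * (9/20 * (ex2 * \<rho>) - 15/16 * (w * \<rho>) - 3/2 * (w * g) - 15/16 * (w * g) - 3/64 * (w * \<rho>))"
    using q \<rho> by (intro mult_pos_pos) auto
  also have "\<dots> = ex2 * (9/20 * (q * \<rho>\<^sup>2)) - w * (15/16 * (q * \<rho>\<^sup>2) + 3/2 * (q * \<rho> * g))
      - w / 8 * (15/2 * (q * \<rho> * g) + 3/8 * (q * \<rho>\<^sup>2))"
    by (simp add: power2_eq_square algebra_simps)
  finally show ?thesis
    using T1 T2 T3 unfolding w_def[symmetric] by linarith
qed

lemma fro_offdiag_le: "fro S (offdiag A) \<le> fro S A"
proof (rule power2_le_imp_le)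
  show "(fro S (offdiag A))\<^sup>2 \<le> (fro S A)\<^sup>2"
    unfolding fro_sq by (intro sum_mono) (simp add: offdiag_def)
qed simp

lemma fro_sq_split:
  assumes "finite S"
  shows "(fro S A)\<^sup>2 = (\<Sum>i\<in>S. (A i i)\<^sup>2) + (fro S (offdiag A))\<^sup>2"
proof -
  have "(\<Sum>j\<in>S. (A i j)\<^sup>2) = (A i i)\<^sup>2 + (\<Sum>j\<in>S. (offdiag A i j)\<^sup>2)" if i: "i \<in> S" for i
  proof -
    have "(\<Sum>j\<in>S. (offdiag A i j)\<^sup>2) = (\<Sum>j\<in>S - {i}. (A i j)\<^sup>2)"
      using assms i by (subst sum.remove[of S i]) (auto simp: offdiag_def intro!: sum.cong)
    then show ?thesis using assms i by (simp add: sum.remove[of S i])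
  qed
  then show ?thesis unfolding fro_sq by (simp add: sum.distrib)
qed

lemma fro_offdiag_gram:
  assumes "D \<in> oblique m p"
  shows "fro {..<p} (offdiag (gram m D D)) = frob p p (gram_minus_id m p D)"
proof -
  have "fro {..<p} (offdiag (gram m D D)) = fro {..<p} (gram_minus_id m p D)"
  proof (rule fro_cong)
    fix i j assume "i \<in> {..<p}" "j \<in> {..<p}"
    then show "offdiag (gram m D D) i j = gram_minus_id m p D i j"
      using gram_unit[OF assms, of j] by (auto simp: offdiag_def gram_minus_id_def gram_def)
  qed
  then show ?thesis by (simp add: fro_def frob_L2_set)
qed

text \<open>For each support, \<open>low\<close> is the bound from \<open>mean_quad_gap\<close>,
  weakened so that it contains only the trace of K and products of off-diagonal norms. The trace
  averages exactly with weight s/p, the products with weight at most (s/p)^2, and the resulting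
  inequality is \<open>averaged_gap_arith\<close>.\<close>

lemma sum_gap_pos:
  fixes D D0 :: rmat and m p s :: nat
  defines "G \<equiv> gram m D D" and "G0 \<equiv> gram m D0 D0" and "\<rho> \<equiv> frob_dist m p D D0"
    and "L \<equiv> opnorm2 m p D0 + 1" and "q \<equiv> real s / real p"
  assumes D0: "D0 \<in> oblique m p" and D: "D \<in> oblique m p"
    and coh: "coherent s m p D0 a" and a: "0 \<le> a" "a \<le> 1/4"
    and \<rho>: "\<rho> > 0" "14 * (sqrt s * \<rho>) \<le> 1 - 2 * a" and s: "s \<ge> 1" "s \<le> p"
    and qL: "q * L\<^sup>2 \<le> 1/16"
    and lam: "lam > 0" "4 * lam \<le> ea" "4 * lam * ea \<le> ex2"
    and gap: "24 * lam * ea * q * L\<^sup>2 * frob p p (gram_minus_id m p D0) < ex2 * \<rho>"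
    and inv: "\<And>S. S \<in> supports p s \<Longrightarrow> inverse_on S G (H S)"
    and inv0: "\<And>S. S \<in> supports p s \<Longrightarrow> inverse_on S G0 (H0 S)"
  shows "0 < (\<Sum>S\<in>supports p s. 1/2 * (mean_quad S ex2 ea ee lam G0 G0 (H0 S) -
    mean_quad S ex2 ea ee lam G (gram m D D0) (H S)))"
proof -
  define E where "E = (\<lambda>i j. D i j - D0 i j)"
  define K where "K = gram m D E"
  \<comment> \<open>\<open>offdiag\<close> makes \<open>F\<close> vanish on the whole diagonal, also
    at indices from p on, as the averaging lemmas demand; on a support it changes nothing since both
    Gram matrices have diagonal 1.\<close>
  define F where "F = offdiag (\<lambda>i j. G i j - G0 i j)"
  define \<kappa> where "\<kappa> S = (\<Sum>i\<in>S. K i i)" for S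
  define N where "N = real (p choose s)"
  have \<rho>E: "\<rho> = frob m p E" by (simp add: \<rho>_def frob_dist_def E_def)
  have p1: "p \<ge> 1" using s by linarith
  have q0: "q > 0" using s p1 by (simp add: q_def)
  have N0: "N > 0" using s by (simp add: N_def)
  have s1: "sqrt s \<ge> 1" using s by simp
  have op0: "opnorm2 m p D0 \<ge> 0" by (rule opnorm2_nonneg[OF p1])
  have L1: "L \<ge> 1" using op0 by (simp add: L_def)
  have "\<rho> \<le> sqrt s * \<rho>" using s1 \<rho>(1) by simp
  then have \<rho>14: "\<rho> \<le> 1/14" using \<rho>(2) a by linarith
  have DD: "D = (\<lambda>i j. D0 i j + E i j)" by (simp add: E_def)
  have gram_D0: "gram m D D0 = (\<lambda>i j. G i j - K i j)"
    unfolding G_def K_def gram_def E_def by (intro ext) (simp add: right_diff_distrib sum_subtractf)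
  have K_split: "K = (\<lambda>i j. gram m D0 E i j + gram m E E i j)"
    unfolding K_def gram_def by (subst DD) (simp add: distrib_right sum.distrib)
  have G_split: "(\<lambda>i j. G i j - G0 i j) = (\<lambda>i j. (gram m D0 E i j + gram m D0 E j i) + gram m E E i j)"
    unfolding G_def G0_def gram_def E_def
    by (intro ext) (simp add: sum.distrib[symmetric] sum_subtractf[symmetric] algebra_simps)
  \<comment> \<open>For unit vectors d and d0 the inner product of d with d - d0 is half of |d -
    d0|^2.\<close>
  have Kdiag: "K j j = 1/2 * (L2_set (\<lambda>i. E i j) {..<m})\<^sup>2" if "j < p" for j
  proof -
    have "(\<Sum>i<m. (D i j)\<^sup>2) = 1" "(\<Sum>i<m. (D0 i j)\<^sup>2) = 1"
      using D D0 that by (simp_all add: oblique_def)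
    then have "2 * K j j - (\<Sum>i<m. (E i j)\<^sup>2) = 0"
      unfolding K_def gram_def E_def
      by (simp add: power2_diff sum.distrib sum_subtractf sum_distrib_left power2_eq_square algebra_simps)
    then show ?thesis by (simp add: L2_set_power2)
  qed
  have K0: "K j j \<ge> 0" if "j < p" for j
    unfolding Kdiag[OF that] by simp
  \<comment> \<open>Columns of \<open>E\<close> have norm at most 1/14, so \<open>K j j\<close> is
    at most 1/392. As the full trace is \<rho>^2/2, averaging turns 392 into the 784 of the final
    arithmetic.\<close>
  have Ksmall: "(K j j)\<^sup>2 \<le> K j j / 392" if j: "j < p" for j
  proof -
    have "(L2_set (\<lambda>i. E i j) {..<m})\<^sup>2 \<le> (1/14)\<^sup>2"
      using column_le_frob[OF j, of E m] \<rho>14 unfolding \<rho>E by (intro power_mono) auto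
    then have "K j j \<le> 1/392" using Kdiag[OF j] by (simp add: power2_eq_square)
    then have "K j j * K j j \<le> K j j * (1/392)"
      using K0[OF j] by (intro mult_left_mono) auto
    then show ?thesis by (simp add: power2_eq_square)
  qed
  have \<kappa>_total: "(\<Sum>j<p. K j j) = \<rho>\<^sup>2 / 2"
    unfolding \<rho>E frob_sq_columns by (simp add: Kdiag sum_divide_distrib)
  define k where "k = fro {..<p} (offdiag K)"
  define e where "e = fro {..<p} (offdiag G)"
  define e0 where "e0 = fro {..<p} (offdiag G0)"
  define f where "f = fro {..<p} F"
  have bE: "fro {..<p} (gram m D0 E) \<le> opnorm2 m p D0 * \<rho>"
    unfolding \<rho>E by (rule fro_gram_le_opnorm2[OF p1])
  have "\<rho>\<^sup>2 \<le> \<rho>" using \<rho>(1) \<rho>14 by (simp add: power2_eq_square mult_le_cancel_left1)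
  \<comment> \<open>Since \<rho>^2 \<le> \<rho>, the quadratic part E^T E costs at most \<rho>: this
    is the 1 added to the operator norm in \<open>L\<close>.\<close>
  then have bEE: "fro {..<p} (gram m E E) \<le> \<rho>"
    using fro_gram_le_frob[of p m E] unfolding \<rho>E by linarith
  have kL: "k \<le> L * \<rho>"
  proof -
    have "k \<le> fro {..<p} K" unfolding k_def by (rule fro_offdiag_le)
    also have "\<dots> \<le> fro {..<p} (gram m D0 E) + fro {..<p} (gram m E E)"
      unfolding K_split by (rule fro_triangle)
    also have "\<dots> \<le> L * \<rho>" using bE bEE by (simp add: L_def distrib_right)
    finally show ?thesis .
  qed
  have fL: "f \<le> 2 * L * \<rho>"
  proof -
    have "f \<le> fro {..<p} (\<lambda>i j. G i j - G0 i j)" unfolding f_def F_def by (rule fro_offdiag_le)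
    also have "\<dots> \<le> fro {..<p} (\<lambda>i j. gram m D0 E i j + gram m D0 E j i) + fro {..<p} (gram m E E)"
      unfolding G_split by (rule fro_triangle)
    also have "fro {..<p} (\<lambda>i j. gram m D0 E i j + gram m D0 E j i) \<le>
        fro {..<p} (gram m D0 E) + fro {..<p} (\<lambda>i j. gram m D0 E j i)"
      by (rule fro_triangle)
    also have "fro {..<p} (\<lambda>i j. gram m D0 E j i) = fro {..<p} (gram m D0 E)"
      by (rule fro_transpose)
    finally show ?thesis using bE bEE \<rho>(1) by (simp add: L_def algebra_simps)
  qed
  have eL: "e \<le> e0 + 2 * L * \<rho>"
  proof -
    have "offdiag G = (\<lambda>i j. offdiag G0 i j + F i j)"
      by (intro ext) (simp add: F_def offdiag_def)
    then have "e \<le> e0 + f"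
      unfolding e_def e0_def f_def using fro_triangle[of "{..<p}" "offdiag G0" F] by simp
    then show ?thesis using fL by linarith
  qed
  define low where "low S = ex2 / 2 * (2 * \<kappa> S - 3/2 * (\<kappa> S / 392 + (fro S (offdiag K))\<^sup>2))
     - lam * ea * (3/2 * \<kappa> S + 3/2 * (fro S (offdiag G) * fro S (offdiag K)))
     - lam\<^sup>2 / 2 * (3/2 * (fro S F * fro S (offdiag G)) + 9/4 * (fro S F * fro S (offdiag G0)))" for S
  have ea0: "ea > 0" using lam by linarith
  have ex0: "ex2 > 0" using lam ea0 mult_pos_pos[OF lam(1) ea0] by linarith
  \<comment> \<open>With sqrt s \<rho> \<le> (1 - 2a)/14 and a \<le> 1/4 the left side is at most
    37/112, just below 1/3.\<close>
  have a13: "a + 9/4 * sqrt s * \<rho> \<le> 1/3" using \<rho>(2) a by linarith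
  have coh': "coherent s m p D (a + 9/4 * sqrt s * \<rho>)"
    unfolding \<rho>_def by (rule coherent_perturb[OF D0 D coh a(2)])
  have low: "low S \<le> 1/2 * (mean_quad S ex2 ea ee lam G0 G0 (H0 S) -
      mean_quad S ex2 ea ee lam G (gram m D D0) (H S))" if S: "S \<in> supports p s" for S
  proof -
    have Sp: "S \<subseteq> {..<p}" "card S \<le> s" using S by (auto simp: supports_def)
    have fin: "finite S" by (rule supports_finite[OF S])
    have dom: "row_dominant S (1/3) G"
      unfolding G_def by (rule coherent_row_dominant[OF D coh' Sp a13])
    have dom0: "row_dominant S (1/3) G0"
      unfolding G0_def using a by (intro coherent_row_dominant[OF D0 coh Sp]) simp
    have FS: "fro S (\<lambda>i j. G i j - G0 i j) = fro S F"
      using dom dom0 by (intro fro_cong) (simp add: F_def offdiag_def row_dominant_def)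
    have "(\<Sum>i\<in>S. (K i i)\<^sup>2) \<le> (\<Sum>i\<in>S. K i i / 392)"
      using Sp Ksmall by (intro sum_mono) auto
    then have "(fro S K)\<^sup>2 \<le> \<kappa> S / 392 + (fro S (offdiag K))\<^sup>2"
      unfolding fro_sq_split[OF fin, of K] \<kappa>_def by (simp add: sum_divide_distrib)
    then have "ex2 / 2 * (2 * \<kappa> S - 3/2 * (\<kappa> S / 392 + (fro S (offdiag K))\<^sup>2)) \<le>
        ex2 / 2 * (2 * \<kappa> S - 3/2 * (fro S K)\<^sup>2)"
      using ex0 by (intro mult_left_mono) auto
    then have "low S \<le> ex2 / 2 * (2 * \<kappa> S - 3/2 * (fro S K)\<^sup>2)
       - lam * ea * (3/2 * \<kappa> S + 3/2 * fro S (offdiag G) * fro S (offdiag K))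
       - lam\<^sup>2 / 2 * fro S (\<lambda>i j. G i j - G0 i j) * (3/2 * fro S (offdiag G) + 9/4 * fro S (offdiag G0))"
      unfolding low_def FS by (simp add: algebra_simps)
    also have "\<dots> \<le> 1/2 * (mean_quad S ex2 ea ee lam G0 G0 (H0 S) -
        mean_quad S ex2 ea ee lam G (\<lambda>i j. G i j - K i j) (H S))"
      unfolding \<kappa>_def
    proof (rule mean_quad_gap[OF dom inv[OF S] dom0 inv0[OF S]])
      show "K i i \<ge> 0" if "i \<in> S" for i using that Sp K0 by auto
    qed (use ex0 ea0 lam in auto)
    finally show ?thesis unfolding gram_D0 .
  qed
  let ?\<Sigma> = "\<lambda>g. \<Sum>S\<in>supports p s. g S"
  have S\<kappa>: "?\<Sigma> \<kappa> = N * (q * \<rho>\<^sup>2 / 2)"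
    using sum_supports_single[OF s(1), of p "\<lambda>i. K i i"] p1
    by (simp add: \<kappa>_def \<kappa>_total N_def q_def field_simps)
  have od0: "offdiag A i i = 0" for A i by (simp add: offdiag_def)
  have SK: "?\<Sigma> (\<lambda>S. (fro S (offdiag K))\<^sup>2) \<le> N * (q\<^sup>2 * k\<^sup>2)"
    using sum_supports_fro_sq[where A = "offdiag K", OF s(2) p1 od0] by (simp add: N_def q_def k_def mult_ac)
  have SEK: "?\<Sigma> (\<lambda>S. fro S (offdiag G) * fro S (offdiag K)) \<le> N * (q\<^sup>2 * (e * k))"
    using sum_supports_fro_mult[where A = "offdiag G" and B = "offdiag K", OF s(2) p1 od0 od0]
    by (simp add: N_def q_def k_def e_def mult_ac)
  have SFE: "?\<Sigma> (\<lambda>S. fro S F * fro S (offdiag G)) \<le> N * (q\<^sup>2 * (f * e))"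
    unfolding F_def f_def
    using sum_supports_fro_mult[where A = "offdiag (\<lambda>i j. G i j - G0 i j)" and B = "offdiag G", OF s(2) p1 od0 od0]
    by (simp add: N_def q_def e_def mult_ac)
  have SFE0: "?\<Sigma> (\<lambda>S. fro S F * fro S (offdiag G0)) \<le> N * (q\<^sup>2 * (f * e0))"
    unfolding F_def f_def
    using sum_supports_fro_mult[where A = "offdiag (\<lambda>i j. G i j - G0 i j)" and B = "offdiag G0", OF s(2) p1 od0 od0]
    by (simp add: N_def q_def e0_def mult_ac)
  let ?expr = "ex2 / 2 * (q * \<rho>\<^sup>2 - 3/2 * (q * \<rho>\<^sup>2 / 784 + q\<^sup>2 * k\<^sup>2))
    - lam * ea * (3/4 * (q * \<rho>\<^sup>2) + 3/2 * (q\<^sup>2 * (e * k)))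
    - lam\<^sup>2 / 2 * (3/2 * (q\<^sup>2 * (f * e)) + 9/4 * (q\<^sup>2 * (f * e0)))"
  have "24 * lam * ea * q * L\<^sup>2 * e0 < ex2 * \<rho>"
    using gap fro_offdiag_gram[OF D0] by (simp add: e0_def G0_def)
  then have "0 < ?expr"
    using q0 qL L1 \<rho>(1) eL fL kL lam
    by (intro averaged_gap_arith[of q L \<rho> e0 e f k lam ea ex2]) (auto simp: e_def e0_def f_def k_def)
  then have "0 < N * ?expr" using N0 by simp
  also have "\<dots> = ex2 / 2 * (2 * (N * (q * \<rho>\<^sup>2 / 2)) - 3/2 * ((N * (q * \<rho>\<^sup>2 / 2)) / 392 + N * (q\<^sup>2 * k\<^sup>2)))
    - lam * ea * (3/2 * (N * (q * \<rho>\<^sup>2 / 2)) + 3/2 * (N * (q\<^sup>2 * (e * k))))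
    - lam\<^sup>2 / 2 * (3/2 * (N * (q\<^sup>2 * (f * e))) + 9/4 * (N * (q\<^sup>2 * (f * e0))))"
    by (simp add: field_simps)
  also have "\<dots> \<le> ex2 / 2 * (2 * ?\<Sigma> \<kappa> - 3/2 * (?\<Sigma> \<kappa> / 392 + ?\<Sigma> (\<lambda>S. (fro S (offdiag K))\<^sup>2)))
    - lam * ea * (3/2 * ?\<Sigma> \<kappa> + 3/2 * ?\<Sigma> (\<lambda>S. fro S (offdiag G) * fro S (offdiag K)))
    - lam\<^sup>2 / 2 * (3/2 * ?\<Sigma> (\<lambda>S. fro S F * fro S (offdiag G)) + 9/4 * ?\<Sigma> (\<lambda>S. fro S F * fro S (offdiag G0)))"
    using SK SEK SFE SFE0 ex0 lam ea0 N0 unfolding S\<kappa>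
    by (intro diff_mono mult_left_mono add_mono) auto
  also have "\<dots> = ?\<Sigma> low"
    unfolding low_def
    by (simp only: sum.distrib sum_subtractf sum_distrib_left[symmetric] sum_divide_distrib[symmetric])
  also have "\<dots> \<le> ?\<Sigma> (\<lambda>S. 1/2 * (mean_quad S ex2 ea ee lam G0 G0 (H0 S) -
      mean_quad S ex2 ea ee lam G (gram m D D0) (H S)))"
    by (intro sum_mono low)
  finally show ?thesis .
qed

section \<open>Conditional expectations given the support\<close>

text \<open>Unlike integrability, essential boundedness is closed under products, so the many second
  moments below need no separate integrability proofs.\<close>

definition ess_bounded :: "'a measure \<Rightarrow> ('a \<Rightarrow> real) \<Rightarrow> bool" where
  "ess_bounded M X \<longleftrightarrow> X \<in> borel_measurable M \<and> (\<exists>B. AE z in M. \<bar>X z\<bar> \<le> B)"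

lemma ess_boundedI:
  assumes "X \<in> borel_measurable M" "AE z in M. \<bar>X z\<bar> \<le> B"
  shows "ess_bounded M X"
  using assms unfolding ess_bounded_def by blast

lemma ess_bounded_const: "ess_bounded M (\<lambda>_. c)"
  by (rule ess_boundedI[of _ _ "\<bar>c\<bar>"]) auto

lemma ess_bounded_add:
  assumes "ess_bounded M X" "ess_bounded M Y"
  shows "ess_bounded M (\<lambda>z. X z + Y z)"
proof -
  obtain A B where AB: "AE z in M. \<bar>X z\<bar> \<le> A" "AE z in M. \<bar>Y z\<bar> \<le> B"
    using assms unfolding ess_bounded_def by blast
  have "AE z in M. \<bar>X z + Y z\<bar> \<le> A + B"
    using AB by eventually_elim linarith
  then show ?thesis
    using assms by (intro ess_boundedI borel_measurable_add) (auto simp: ess_bounded_def)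
qed

lemma ess_bounded_mult:
  assumes "ess_bounded M X" "ess_bounded M Y"
  shows "ess_bounded M (\<lambda>z. X z * Y z)"
proof -
  obtain A B where AB: "AE z in M. \<bar>X z\<bar> \<le> A" "AE z in M. \<bar>Y z\<bar> \<le> B"
    using assms unfolding ess_bounded_def by blast
  have "AE z in M. \<bar>X z * Y z\<bar> \<le> A * B"
    using AB by eventually_elim (simp add: abs_mult mult_mono)
  then show ?thesis
    using assms by (intro ess_boundedI borel_measurable_times) (auto simp: ess_bounded_def)
qed

lemma ess_bounded_cmult: "ess_bounded M X \<Longrightarrow> ess_bounded M (\<lambda>z. c * X z)"
  by (intro ess_bounded_mult ess_bounded_const)

lemma ess_bounded_diff:
  assumes "ess_bounded M X" "ess_bounded M Y"
  shows "ess_bounded M (\<lambda>z. X z - Y z)"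
  using ess_bounded_add[OF assms(1) ess_bounded_cmult[OF assms(2), of "- 1"]] by simp

lemma ess_bounded_sum:
  assumes "\<And>i. i \<in> I \<Longrightarrow> ess_bounded M (X i)"
  shows "ess_bounded M (\<lambda>z. \<Sum>i\<in>I. X i z)"
  using assms
  by (induction I rule: infinite_finite_induct) (simp_all add: ess_bounded_const ess_bounded_add)

lemma ess_bounded_power2: "ess_bounded M X \<Longrightarrow> ess_bounded M (\<lambda>z. (X z)\<^sup>2)"
  unfolding power2_eq_square by (intro ess_bounded_mult)

lemma ess_bounded_integrable:
  assumes "finite_measure M" "ess_bounded M X"
  shows "integrable M X"
proof -
  obtain B where "AE z in M. \<bar>X z\<bar> \<le> B"
    using assms(2) unfolding ess_bounded_def by blast
  then show ?thesis
    using assms by (intro finite_measure.integrable_const_bound[of M X B]) (auto simp: ess_bounded_def)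
qed

locale support_model =
  fixes M :: "'a measure" and J :: "'a \<Rightarrow> nat set"
  assumes prob: "prob_space M" and J_sets: "\<And>S. {z \<in> space M. J z = S} \<in> sets M"
begin

lemma finite_meas: "finite_measure M"
  using prob by (rule prob_space.finite_measure)

lemma ess_bounded_event:
  assumes "ess_bounded M X"
  shows "ess_bounded M (\<lambda>z. indicator {z \<in> space M. J z = S} z * X z)"
proof (intro ess_bounded_mult assms)
  show "ess_bounded M (indicat_real {z \<in> space M. J z = S})"
    using J_sets[of S] by (intro ess_boundedI[of _ _ 1] borel_measurable_indicator) (auto simp: indicator_def)
qed

lemma integrable_event:
  assumes "ess_bounded M X"
  shows "integrable M (\<lambda>z. indicator {z \<in> space M. J z = S} z * X z)"
  by (intro ess_bounded_integrable finite_meas ess_bounded_event assms)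

lemma cexpJ_cong:
  assumes "\<And>z. z \<in> space M \<Longrightarrow> J z = S \<Longrightarrow> X z = Y z"
  shows "cexpJ M J S X = cexpJ M J S Y"
proof -
  have "(\<integral>z. indicator {z \<in> space M. J z = S} z * X z \<partial>M) =
      (\<integral>z. indicator {z \<in> space M. J z = S} z * Y z \<partial>M)"
    by (intro Bochner_Integration.integral_cong) (auto simp: indicator_def assms)
  then show ?thesis by (simp add: cexpJ_def)
qed

lemma cexpJ_add:
  assumes "ess_bounded M X" "ess_bounded M Y"
  shows "cexpJ M J S (\<lambda>z. X z + Y z) = cexpJ M J S X + cexpJ M J S Y"
  unfolding cexpJ_def distrib_left
  by (subst Bochner_Integration.integral_add[OF integrable_event integrable_event])
    (auto simp: assms add_divide_distrib)

lemma cexpJ_cmult: "cexpJ M J S (\<lambda>z. c * X z) = c * cexpJ M J S X"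
  unfolding cexpJ_def mult.left_commute[of _ c] by simp

lemma cexpJ_diff:
  assumes "ess_bounded M X" "ess_bounded M Y"
  shows "cexpJ M J S (\<lambda>z. X z - Y z) = cexpJ M J S X - cexpJ M J S Y"
  using cexpJ_add[OF assms(1) ess_bounded_cmult[OF assms(2), of "- 1"]] cexpJ_cmult[of S "- 1" Y] by simp

lemma cexpJ_sum:
  assumes "\<And>i. i \<in> I \<Longrightarrow> ess_bounded M (X i)"
  shows "cexpJ M J S (\<lambda>z. \<Sum>i\<in>I. X i z) = (\<Sum>i\<in>I. cexpJ M J S (X i))"
  using assms
proof (induction I rule: infinite_finite_induct)
  case (insert i I)
  then show ?case by (simp add: cexpJ_add ess_bounded_sum)
qed (simp_all add: cexpJ_def)

lemma cexpJ_bilinear: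
  assumes "\<And>c. c \<in> A \<Longrightarrow> ess_bounded M (f c)" "\<And>d. d \<in> B \<Longrightarrow> ess_bounded M (g d)"
  shows "cexpJ M J S (\<lambda>z. (\<Sum>c\<in>A. \<alpha> c * f c z) * (\<Sum>d\<in>B. \<beta> d * g d z)) =
    (\<Sum>c\<in>A. \<Sum>d\<in>B. \<alpha> c * \<beta> d * cexpJ M J S (\<lambda>z. f c z * g d z))"
proof -
  have "cexpJ M J S (\<lambda>z. (\<Sum>c\<in>A. \<alpha> c * f c z) * (\<Sum>d\<in>B. \<beta> d * g d z)) =
      cexpJ M J S (\<lambda>z. \<Sum>c\<in>A. \<Sum>d\<in>B. (\<alpha> c * \<beta> d) * (f c z * g d z))"
    by (intro cexpJ_cong) (simp add: sum_product mult_ac)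
  also have "\<dots> = (\<Sum>c\<in>A. cexpJ M J S (\<lambda>z. \<Sum>d\<in>B. (\<alpha> c * \<beta> d) * (f c z * g d z)))"
    using assms by (intro cexpJ_sum ess_bounded_sum ess_bounded_cmult ess_bounded_mult) auto
  also have "\<dots> = (\<Sum>c\<in>A. \<Sum>d\<in>B. cexpJ M J S (\<lambda>z. (\<alpha> c * \<beta> d) * (f c z * g d z)))"
    using assms by (intro sum.cong refl cexpJ_sum ess_bounded_cmult ess_bounded_mult) auto
  finally show ?thesis by (simp only: cexpJ_cmult)
qed

lemma cexpJ_mono:
  assumes X: "ess_bounded M X" and Y: "ess_bounded M Y"
    and le: "AE z in M. J z = S \<longrightarrow> X z \<le> Y z"
  shows "cexpJ M J S X \<le> cexpJ M J S Y"
proof -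
  have "(\<integral>z. indicator {z \<in> space M. J z = S} z * X z \<partial>M) \<le>
      (\<integral>z. indicator {z \<in> space M. J z = S} z * Y z \<partial>M)"
  proof (intro integral_mono_AE integrable_event X Y)
    show "AE z in M. indicator {z \<in> space M. J z = S} z * X z \<le> indicator {z \<in> space M. J z = S} z * Y z"
      using le by eventually_elim (auto simp: indicator_def)
  qed
  then show ?thesis unfolding cexpJ_def by (intro divide_right_mono) auto
qed

lemma cexpJ_const:
  assumes "measure M {z \<in> space M. J z = S} \<noteq> 0"
  shows "cexpJ M J S (\<lambda>_. c) = c"
proof -
  have event: "(\<integral>z. indicator E z * c \<partial>M) = measure M E * c" if "E \<in> sets M" for E
    using sets.Int_space_eq2[OF that] by simp
  show ?thesis
    unfolding cexpJ_def event[OF J_sets] using assms by simp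
qed

text \<open>The law of total expectation for finitely many equally likely supports.\<close>

lemma integral_eq_sum_cexpJ:
  assumes X: "ess_bounded M X" and fin: "finite \<S>" and J: "\<And>z. z \<in> space M \<Longrightarrow> J z \<in> \<S>"
    and P: "\<And>S. S \<in> \<S> \<Longrightarrow> measure M {z \<in> space M. J z = S} = P" and P0: "P \<noteq> 0"
  shows "(\<integral>z. X z \<partial>M) = P * (\<Sum>S\<in>\<S>. cexpJ M J S X)"
proof -
  have "(\<integral>z. X z \<partial>M) = (\<integral>z. (\<Sum>S\<in>\<S>. indicator {z \<in> space M. J z = S} z * X z) \<partial>M)"
  proof (intro Bochner_Integration.integral_cong refl)
    fix z assume z: "z \<in> space M"
    have "(\<Sum>S\<in>\<S>. indicator {z \<in> space M. J z = S} z * X z) = (\<Sum>S\<in>\<S>. if S = J z then X z else 0)"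
      using z by (intro sum.cong refl) (auto simp: indicator_def)
    then show "X z = (\<Sum>S\<in>\<S>. indicator {z \<in> space M. J z = S} z * X z)"
      using fin J[OF z] by simp
  qed
  also have "\<dots> = (\<Sum>S\<in>\<S>. \<integral>z. indicator {z \<in> space M. J z = S} z * X z \<partial>M)"
    by (intro Bochner_Integration.integral_sum integrable_event X)
  also have "\<dots> = (\<Sum>S\<in>\<S>. P * cexpJ M J S X)"
    using P P0 by (intro sum.cong refl) (simp add: cexpJ_def)
  finally show ?thesis by (simp add: sum_distrib_left)
qed

text \<open>On the event J = S, the vector D^T y - lam sgn(x) is a sum of three vectors, linear in
  the coefficients, in the noise and in the signs. All moments mixing the noise with the other two
  vanish, and the remaining second moments are those collected in \<open>mean_quad\<close>.\<close>

lemma cexpJ_lasso_value: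
  fixes x e :: "'a \<Rightarrow> nat \<Rightarrow> real"
  assumes S: "S \<subseteq> {..<p}"
    and x: "\<And>i. ess_bounded M (\<lambda>z. x z i)" and e: "\<And>i. i < m \<Longrightarrow> ess_bounded M (\<lambda>z. e z i)"
    and sx: "\<And>i. ess_bounded M (\<lambda>z. sgn (x z i))"
    and supp: "\<And>z i. z \<in> space M \<Longrightarrow> i \<notin> J z \<Longrightarrow> x z i = 0"
    and xx: "\<And>i j. i \<in> S \<Longrightarrow> j \<in> S \<Longrightarrow> cexpJ M J S (\<lambda>z. x z i * x z j) = (if i = j then ex2 else 0)"
    and ss: "\<And>i j. i \<in> S \<Longrightarrow> j \<in> S \<Longrightarrow> cexpJ M J S (\<lambda>z. sgn (x z i) * sgn (x z j)) = (if i = j then 1 else 0)"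
    and sgx: "\<And>i j. i \<in> S \<Longrightarrow> j \<in> S \<Longrightarrow> cexpJ M J S (\<lambda>z. sgn (x z i) * x z j) = (if i = j then ea else 0)"
    and ne: "\<And>i j. i < m \<Longrightarrow> j < m \<Longrightarrow> cexpJ M J S (\<lambda>z. e z i * e z j) = (if i = j then ee else 0)"
    and xe: "\<And>i j. i \<in> S \<Longrightarrow> j < m \<Longrightarrow> cexpJ M J S (\<lambda>z. x z i * e z j) = 0"
    and se: "\<And>i j. i \<in> S \<Longrightarrow> j < m \<Longrightarrow> cexpJ M J S (\<lambda>z. sgn (x z i) * e z j) = 0"
    and y: "y = (\<lambda>z i. (\<Sum>j<p. D0 i j * x z j) + e z i)"
  shows "cexpJ M J S (\<lambda>z. lasso_value lam m (y z) D S H (\<lambda>b. sgn (x z b))) =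
      cexpJ M J S (\<lambda>z. 1/2 * (\<Sum>i<m. (y z i)\<^sup>2)) - 1/2 * mean_quad S ex2 ea ee lam (gram m D D) (gram m D D0) H"
    and "ess_bounded M (\<lambda>z. lasso_value lam m (y z) D S H (\<lambda>b. sgn (x z b)))"
proof -
  have fin: "finite S" using S finite_subset by blast
  define B where "B = gram m D D0"
  have yb: "ess_bounded M (\<lambda>z. y z i)" if "i < m" for i
    unfolding y using that by (intro ess_bounded_add ess_bounded_sum ess_bounded_cmult x e)
  define v where "v a z = (\<Sum>i<m. D i a * y z i) - lam * sgn (x z a)" for a z
  define u where "u a z = (\<Sum>c\<in>S. B a c * x z c)" for a z
  define n where "n a z = (\<Sum>i<m. D i a * e z i)" for a z
  define \<sigma> where "\<sigma> a z = sgn (x z a)" for a z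
  have vb: "ess_bounded M (v a)" for a
    unfolding v_def by (intro ess_bounded_diff ess_bounded_sum ess_bounded_cmult yb sx) auto
  have ub: "ess_bounded M (u a)" for a
    unfolding u_def by (intro ess_bounded_sum ess_bounded_cmult x)
  have nb: "ess_bounded M (n a)" for a
    unfolding n_def by (intro ess_bounded_sum ess_bounded_cmult e) auto
  have \<sigma>b: "ess_bounded M (\<sigma> a)" for a
    unfolding \<sigma>_def by (rule sx)
  have v_eq: "v a z = u a z + n a z - lam * \<sigma> a z" if "z \<in> space M" "J z = S" for a z
  proof -
    have restr: "(\<Sum>j<p. D0 i j * x z j) = (\<Sum>j\<in>S. D0 i j * x z j)" for i
      using S supp[OF that(1)] that(2) by (intro sum.mono_neutral_right) auto
    have "(\<Sum>i<m. D i a * y z i) = (\<Sum>i<m. D i a * (\<Sum>j\<in>S. D0 i j * x z j)) + n a z"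
      by (simp add: y restr n_def distrib_left sum.distrib)
    then show ?thesis
      by (simp add: v_def u_def \<sigma>_def B_def sum_col_comb)
  qed
  have uu: "cexpJ M J S (\<lambda>z. u a z * u b z) = ex2 * (\<Sum>c\<in>S. B a c * B b c)" for a b
  proof -
    have "cexpJ M J S (\<lambda>z. u a z * u b z) = (\<Sum>c\<in>S. \<Sum>d\<in>S. B a c * B b d * (if c = d then ex2 else 0))"
      unfolding u_def by (subst cexpJ_bilinear) (auto intro!: sum.cong x simp: xx)
    also have "\<dots> = (\<Sum>c\<in>S. B a c * B b c * ex2)"
      using fin by (intro sum.cong refl) (simp add: if_distrib cong: if_cong)
    finally show ?thesis by (simp add: sum_distrib_left mult_ac)
  qed
  have nn: "cexpJ M J S (\<lambda>z. n a z * n b z) = ee * gram m D D a b" for a b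
  proof -
    have "cexpJ M J S (\<lambda>z. n a z * n b z) = (\<Sum>i<m. \<Sum>j<m. D i a * D j b * (if i = j then ee else 0))"
      unfolding n_def by (subst cexpJ_bilinear) (auto intro!: sum.cong e simp: ne)
    also have "\<dots> = (\<Sum>i<m. D i a * D i b * ee)"
      by (intro sum.cong refl) (simp add: if_distrib cong: if_cong)
    finally show ?thesis by (simp add: gram_def sum_distrib_left mult_ac)
  qed
  have un: "cexpJ M J S (\<lambda>z. u a z * n b z) = 0" for a b
    unfolding u_def n_def by (subst cexpJ_bilinear) (auto intro!: x e simp: xe)
  \<comment> \<open>The sign is written as a sum with one term so that \<open>cexpJ_bilinear\<close>
    covers it too.\<close>
  have single: "\<sigma> a z = (\<Sum>c\<in>{a}. 1 * sgn (x z c))" for a z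
    by (simp add: \<sigma>_def)
  have \<sigma>u: "cexpJ M J S (\<lambda>z. \<sigma> a z * u b z) = ea * B b a" if a: "a \<in> S" for a b
  proof -
    have "cexpJ M J S (\<lambda>z. \<sigma> a z * u b z) = (\<Sum>d\<in>S. B b d * (if a = d then ea else 0))"
      unfolding single u_def by (subst cexpJ_bilinear) (use a in \<open>auto intro!: sum.cong x sx simp: sgx\<close>)
    then show ?thesis using fin a by (simp add: if_distrib cong: if_cong)
  qed
  have \<sigma>n: "cexpJ M J S (\<lambda>z. \<sigma> a z * n b z) = 0" if a: "a \<in> S" for a b
    unfolding single n_def by (subst cexpJ_bilinear) (use a in \<open>auto intro!: e sx simp: se\<close>)
  have vv: "cexpJ M J S (\<lambda>z. v a z * v b z) = ex2 * (\<Sum>c\<in>S. B a c * B b c) + ee * gram m D D a b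
      - lam * ea * (B a b + B b a) + lam\<^sup>2 * (if a = b then 1 else 0)" if ab: "a \<in> S" "b \<in> S" for a b
  proof -
    have "cexpJ M J S (\<lambda>z. v a z * v b z) = cexpJ M J S (\<lambda>z.
        u a z * u b z + u a z * n b z + u b z * n a z + n a z * n b z
        - lam * (\<sigma> b z * u a z) - lam * (\<sigma> a z * u b z) - lam * (\<sigma> b z * n a z) - lam * (\<sigma> a z * n b z)
        + lam\<^sup>2 * (\<sigma> a z * \<sigma> b z))"
      by (intro cexpJ_cong) (simp add: v_eq power2_eq_square algebra_simps)
    also have "\<dots> = cexpJ M J S (\<lambda>z. u a z * u b z) + cexpJ M J S (\<lambda>z. u a z * n b z)
        + cexpJ M J S (\<lambda>z. u b z * n a z) + cexpJ M J S (\<lambda>z. n a z * n b z)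
        - lam * cexpJ M J S (\<lambda>z. \<sigma> b z * u a z) - lam * cexpJ M J S (\<lambda>z. \<sigma> a z * u b z)
        - lam * cexpJ M J S (\<lambda>z. \<sigma> b z * n a z) - lam * cexpJ M J S (\<lambda>z. \<sigma> a z * n b z)
        + lam\<^sup>2 * cexpJ M J S (\<lambda>z. \<sigma> a z * \<sigma> b z)"
      by (simp only: cexpJ_add cexpJ_diff cexpJ_cmult ess_bounded_add ess_bounded_diff ess_bounded_mult
          ess_bounded_cmult ub nb \<sigma>b)
    also have "cexpJ M J S (\<lambda>z. \<sigma> a z * \<sigma> b z) = (if a = b then 1 else 0)"
      unfolding \<sigma>_def by (rule ss[OF ab])
    finally show ?thesis
      by (simp only: uu nn un \<sigma>u[OF ab(1)] \<sigma>u[OF ab(2)] \<sigma>n[OF ab(1)] \<sigma>n[OF ab(2)]) (simp add: algebra_simps)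
  qed
  have sqb: "ess_bounded M (\<lambda>z. 1/2 * (\<Sum>i<m. (y z i)\<^sup>2))"
    by (intro ess_bounded_cmult ess_bounded_sum ess_bounded_power2 yb) auto
  have qb: "ess_bounded M (\<lambda>z. \<Sum>a\<in>S. \<Sum>b\<in>S. H a b * (v a z * v b z))"
    by (intro ess_bounded_sum ess_bounded_cmult ess_bounded_mult vb)
  have eq: "(\<lambda>z. lasso_value lam m (y z) D S H (\<lambda>b. sgn (x z b))) =
      (\<lambda>z. 1/2 * (\<Sum>i<m. (y z i)\<^sup>2) - 1/2 * (\<Sum>a\<in>S. \<Sum>b\<in>S. H a b * (v a z * v b z)))"
    unfolding lasso_value_def v_def ..
  show "ess_bounded M (\<lambda>z. lasso_value lam m (y z) D S H (\<lambda>b. sgn (x z b)))"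
    unfolding eq by (intro ess_bounded_diff ess_bounded_cmult[OF qb] sqb)
  have "cexpJ M J S (\<lambda>z. \<Sum>a\<in>S. \<Sum>b\<in>S. H a b * (v a z * v b z)) =
      (\<Sum>a\<in>S. cexpJ M J S (\<lambda>z. \<Sum>b\<in>S. H a b * (v a z * v b z)))"
    by (intro cexpJ_sum ess_bounded_sum ess_bounded_cmult ess_bounded_mult vb)
  also have "\<dots> = (\<Sum>a\<in>S. \<Sum>b\<in>S. cexpJ M J S (\<lambda>z. H a b * (v a z * v b z)))"
    by (intro sum.cong refl cexpJ_sum ess_bounded_cmult ess_bounded_mult vb)
  also have "\<dots> = (\<Sum>a\<in>S. \<Sum>b\<in>S. H a b * (ex2 * (\<Sum>c\<in>S. B a c * B b c) + ee * gram m D D a b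
      - lam * ea * (B a b + B b a) + lam\<^sup>2 * (if a = b then 1 else 0)))"
    unfolding cexpJ_cmult by (intro sum.cong refl) (simp only: vv)
  also have "\<dots> = mean_quad S ex2 ea ee lam (gram m D D) (gram m D D0) H"
    unfolding mean_quad_def B_def ..
  finally show "cexpJ M J S (\<lambda>z. lasso_value lam m (y z) D S H (\<lambda>b. sgn (x z b))) =
      cexpJ M J S (\<lambda>z. 1/2 * (\<Sum>i<m. (y z i)\<^sup>2)) - 1/2 * mean_quad S ex2 ea ee lam (gram m D D) (gram m D D0) H"
    unfolding eq cexpJ_diff[OF sqb ess_bounded_cmult[OF qb]] cexpJ_cmult by simp
qed

end

section \<open>The local minimum\<close>

text \<open>\<open>frob_dist\<close> does not metrize the topology of \<open>rmat\<close>. A modulus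
  of continuity in it still gives continuity, by squeezing f between f A minus and plus the modulus,
  which tends to 0 because \<open>frob_dist\<close> is continuous.\<close>

lemma continuous_on_frob_modulus:
  fixes f :: "rmat \<Rightarrow> real"
  assumes "\<And>A B. A \<in> C \<Longrightarrow> B \<in> C \<Longrightarrow> f B \<le> f A + (a * frob_dist m p A B + b * (frob_dist m p A B)\<^sup>2)"
  shows "continuous_on C f"
  unfolding continuous_on_def
proof
  fix A assume A: "A \<in> C"
  let ?h = "\<lambda>B. a * frob_dist m p B A + b * (frob_dist m p B A)\<^sup>2"
  have "continuous_on C ?h"
    by (intro continuous_intros continuous_on_frob_dist)
  then have h: "(?h \<longlongrightarrow> 0) (at A within C)"
    using A by (auto simp: continuous_on_def)
  have up: "\<forall>\<^sub>F B in at A within C. f B \<le> f A + ?h B"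
    using assms[OF A] by (auto simp: eventually_at_topological frob_dist_commute[of m p A])
  have lo: "\<forall>\<^sub>F B in at A within C. f A - ?h B \<le> f B"
    using assms[OF _ A] by (auto simp: eventually_at_topological algebra_simps)
  show "(f \<longlongrightarrow> f A) (at A within C)"
    using lo up
  proof (rule real_tendsto_sandwich)
    show "((\<lambda>B. f A - ?h B) \<longlongrightarrow> f A) (at A within C)"
      using tendsto_diff[OF tendsto_const h] by simp
    show "((\<lambda>B. f A + ?h B) \<longlongrightarrow> f A) (at A within C)"
      using tendsto_add[OF tendsto_const h] by simp
  qed
qed

lemma local_min_inside_sphere:
  assumes C: "compact C" and f: "continuous_on C f" and D0: "D0 \<in> C" and \<rho>: "\<rho> > 0"
    and gap: "\<And>D. D \<in> C \<Longrightarrow> frob_dist m p D D0 = \<rho> \<Longrightarrow> f D0 < f D"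
  shows "\<exists>Dst. local_min_on C f (frob_dist m p) Dst \<and> frob_dist m p Dst D0 < \<rho>"
proof -
  let ?X = "C \<inter> {D. frob_dist m p D D0 \<le> \<rho>}"
  have "closed {D. frob_dist m p D D0 \<le> \<rho>}"
    by (intro closed_Collect_le continuous_on_frob_dist continuous_on_const)
  then have "compact ?X" by (rule compact_Int_closed[OF C])
  moreover have "?X \<noteq> {}" using D0 \<rho> by auto
  moreover have "continuous_on ?X f" using f by (rule continuous_on_subset) auto
  ultimately obtain Dst where Dst: "Dst \<in> ?X" and min: "\<And>D. D \<in> ?X \<Longrightarrow> f Dst \<le> f D"
    using continuous_attains_inf[of ?X f] by auto
  have "f Dst \<le> f D0" using min[of D0] D0 \<rho> by simp
  then have less: "frob_dist m p Dst D0 < \<rho>"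
    using gap[of Dst] Dst by fastforce
  \<comment> \<open>By the triangle inequality this neighbourhood stays inside the ball of radius
    \<rho> around \<open>D0\<close>, where \<open>Dst\<close> is a minimizer.\<close>
  have "f Dst \<le> f D" if "D \<in> C" "frob_dist m p D Dst < \<rho> - frob_dist m p Dst D0" for D
    using that frob_dist_triangle[of m p D D0 Dst] by (intro min) simp
  then have "local_min_on C f (frob_dist m p) Dst"
    unfolding local_min_on_def using Dst less
    by (intro conjI exI[of _ "\<rho> - frob_dist m p Dst D0"]) auto
  then show ?thesis using less by blast
qed

theorem theorem1:
  fixes N r s :: nat and ms ps :: "nat \<Rightarrow> nat" and m p :: nat
    and C :: "rmat set" and D0 :: rmat
    and M :: "'a measure" and J :: "'a \<Rightarrow> nat set"
    and x0 eps :: "'a \<Rightarrow> nat \<Rightarrow> real" and xr er :: "'a \<Rightarrow> real"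
    and lam Mx xlow Meps :: real
    and Ex2 Eabs Eeps2 lbar Cmin Cmax :: real
    and y :: "'a \<Rightarrow> nat \<Rightarrow> real" and fP :: "rmat \<Rightarrow> real"
  assumes N2: "N \<ge> 2" and r1: "r \<ge> 1"
    and dims: "\<forall>n<N. ms n \<ge> 1 \<and> ps n \<ge> 1"
    and m_def: "m = (\<Prod>n<N. ms n)" and p_def: "p = (\<Prod>n<N. ps n)"
    and C_cases: "(N = 2 \<and> C = Kset 2 ms ps r) \<or> C = Kset N ms ps 1 \<or>
                  (\<exists>c>0. C = cKset c N ms ps r) \<or> C = Kbar N ms ps r"
    and D0C: "D0 \<in> C"
    \<comment> \<open>probability model\<close>
    and PS: "prob_space M"
    and J_meas: "\<And>S. {\<omega> \<in> space M. J \<omega> = S} \<in> sets M"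
    and J_range: "\<forall>\<omega>\<in>space M. J \<omega> \<subseteq> {..<p} \<and> card (J \<omega>) = s"
    and J_unif: "\<And>S. S \<subseteq> {..<p} \<Longrightarrow> card S = s \<Longrightarrow>
                    measure M {\<omega> \<in> space M. J \<omega> = S} = 1 / real (p choose s)"
    and x0_meas: "\<And>i. (\<lambda>\<omega>. x0 \<omega> i) \<in> borel_measurable M"
    and eps_meas: "\<And>i. (\<lambda>\<omega>. eps \<omega> i) \<in> borel_measurable M"
    and xr_meas: "xr \<in> borel_measurable M" and er_meas: "er \<in> borel_measurable M"
    and x0_supp: "\<forall>\<omega>\<in>space M. \<forall>i. i \<notin> J \<omega> \<longrightarrow> x0 \<omega> i = 0"
    and Ex2_def: "Ex2 = (\<integral>\<omega>. (xr \<omega>)\<^sup>2 \<partial>M)"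
    and Eabs_def: "Eabs = (\<integral>\<omega>. \<bar>xr \<omega>\<bar> \<partial>M)"
    and Eeps2_def: "Eeps2 = (\<integral>\<omega>. (er \<omega>)\<^sup>2 \<partial>M)"
    \<comment> \<open>coefficient assumption\<close>
    and coef_xx: "\<And>S i j. S \<subseteq> {..<p} \<Longrightarrow> card S = s \<Longrightarrow> i \<in> S \<Longrightarrow> j \<in> S \<Longrightarrow>
        cexpJ M J S (\<lambda>\<omega>. x0 \<omega> i * x0 \<omega> j) = (if i = j then Ex2 else 0)"
    and coef_ss: "\<And>S i j. S \<subseteq> {..<p} \<Longrightarrow> card S = s \<Longrightarrow> i \<in> S \<Longrightarrow> j \<in> S \<Longrightarrow>
        cexpJ M J S (\<lambda>\<omega>. sgn (x0 \<omega> i) * sgn (x0 \<omega> j)) = (if i = j then 1 else 0)"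
    and coef_sx: "\<And>S i j. S \<subseteq> {..<p} \<Longrightarrow> card S = s \<Longrightarrow> i \<in> S \<Longrightarrow> j \<in> S \<Longrightarrow>
        cexpJ M J S (\<lambda>\<omega>. sgn (x0 \<omega> i) * x0 \<omega> j) = (if i = j then Eabs else 0)"
    and x0_bound: "AE \<omega> in M. sqrt (\<Sum>i<p. (x0 \<omega> i)\<^sup>2) \<le> Mx"
    and x0_low: "AE \<omega> in M. \<forall>j\<in>J \<omega>. \<bar>x0 \<omega> j\<bar> \<ge> xlow"
    and Mx_pos: "Mx > 0" and xlow_pos: "xlow > 0"
    \<comment> \<open>noise assumption\<close>
    and noise_ee: "\<And>S i j. S \<subseteq> {..<p} \<Longrightarrow> card S = s \<Longrightarrow> i < m \<Longrightarrow> j < m \<Longrightarrow>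
        cexpJ M J S (\<lambda>\<omega>. eps \<omega> i * eps \<omega> j) = (if i = j then Eeps2 else 0)"
    and noise_xe: "\<And>S i j. S \<subseteq> {..<p} \<Longrightarrow> card S = s \<Longrightarrow> i < p \<Longrightarrow> j < m \<Longrightarrow>
        cexpJ M J S (\<lambda>\<omega>. x0 \<omega> i * eps \<omega> j) = 0"
    and noise_se: "\<And>S i j. S \<subseteq> {..<p} \<Longrightarrow> card S = s \<Longrightarrow> i < p \<Longrightarrow> j < m \<Longrightarrow>
        cexpJ M J S (\<lambda>\<omega>. sgn (x0 \<omega> i) * eps \<omega> j) = 0"
    and eps_bound: "AE \<omega> in M. sqrt (\<Sum>i<m. (eps \<omega> i)\<^sup>2) \<le> Meps"
    and Meps_pos: "Meps > 0"
    \<comment> \<open>samples and objective\<close>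
    and y_def: "y = (\<lambda>\<omega> i. (\<Sum>j<p. D0 i j * x0 \<omega> j) + eps \<omega> i)"
    and fP_def: "fP = (\<lambda>D. \<integral>\<omega>. f_y lam m p (y \<omega>) D \<partial>M)"
    \<comment> \<open>parameters\<close>
    and lam_pos: "lam > 0"
    and lbar_def: "lbar = lam / Eabs"
    and Cmin_def: "Cmin = 24 * (Eabs\<^sup>2 / Ex2) * (opnorm2 m p D0 + 1)\<^sup>2 * (real s / real p)
                          * frob p p (gram_minus_id m p D0)"
    and Cmax_def: "Cmax = 2 * Eabs / (7 * Mx) * (1 - 2 * cum_coherence s m p D0)"
    \<comment> \<open>parameter assumption\<close>
    and par1: "Cmin \<le> Cmax"
    and par2: "lam \<le> xlow / 4"
    and par3: "real s \<le> real p / (16 * (opnorm2 m p D0 + 1)\<^sup>2)"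
    and par4: "cum_coherence s m p D0 \<le> 1/4"
    and par5: "Meps / Mx < 7/2 * (Cmax - Cmin) * lbar"
  shows "\<forall>\<rho>. lbar * Cmin < \<rho> \<and> \<rho> < lbar * Cmax \<and> Meps / Mx < 7/2 * (lbar * Cmax - \<rho>)
          \<longrightarrow> (\<exists>Dst. local_min_on C fP (frob_dist m p) Dst \<and> frob_dist m p Dst D0 < \<rho>)"
proof (intro allI impI, elim conjE)
  fix \<rho>
  assume \<rho>lo: "lbar * Cmin < \<rho>" and \<rho>hi: "\<rho> < lbar * Cmax"
    and \<rho>noise: "Meps / Mx < 7/2 * (lbar * Cmax - \<rho>)"
  interpret support_model M J by (rule support_model.intro) (rule PS, rule J_meas)
  define L where "L = opnorm2 m p D0 + 1"
  define q where "q = real s / real p"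
  define \<mu> where "\<mu> = cum_coherence s m p D0"
  define e0 where "e0 = frob p p (gram_minus_id m p D0)"
  have N1: "N \<ge> 1" using N2 by simp
  have p1: "p \<ge> 1" using dims by (simp add: p_def Suc_le_eq prod_pos)
  have C: "compact C \<and> C \<subseteq> oblique m p"
    using C_cases
  proof (elim disjE)
    assume *: "N = 2 \<and> C = Kset 2 ms ps r"
    then have "compact C" using dims by (auto intro: compact_Kset_2)
    then show ?thesis using * by (auto simp: Kset_def m_def p_def)
  next
    assume *: "C = Kset N ms ps 1"
    then show ?thesis using compact_Kset_1[OF N1] by (auto simp: Kset_def m_def p_def)
  next
    assume "\<exists>c>0. C = cKset c N ms ps r"
    then obtain c where *: "C = cKset c N ms ps r" by blast
    then show ?thesis using compact_cKset[OF N1] by (auto simp: cKset_def m_def p_def)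
  next
    assume *: "C = Kbar N ms ps r"
    show ?thesis unfolding * m_def p_def using compact_Kbar Kbar_subset_oblique by blast
  qed
  have D0: "D0 \<in> oblique m p" using C D0C by blast
  have L1: "L \<ge> 1" using opnorm2_nonneg[OF p1, of m D0] by (simp add: L_def)
  have e00: "e0 \<ge> 0" by (simp add: e0_def)
  have \<mu>0: "\<mu> \<ge> 0"
    using cum_coherence_ge[of "{}" p s 0 m D0] p1 by (simp add: \<mu>_def)
  have \<mu>4: "\<mu> \<le> 1/4" using par4 by (simp add: \<mu>_def)
  have coh: "coherent s m p D0 \<mu>"
    unfolding coherent_def \<mu>_def using cum_coherence_ge by blast
  have Eabs0: "Eabs \<ge> 0" unfolding Eabs_def by simp
  have Ex20: "Ex2 \<ge> 0" unfolding Ex2_def by simp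
  have Cmin_eq: "Cmin = 24 * (Eabs\<^sup>2 / Ex2) * L\<^sup>2 * q * e0"
    by (simp add: Cmin_def L_def q_def e0_def)
  have Cmax_eq: "Cmax = 2 * Eabs / (7 * Mx) * (1 - 2 * \<mu>)"
    by (simp add: Cmax_def \<mu>_def)
  have Cmin0: "Cmin \<ge> 0"
    unfolding Cmin_eq q_def using Ex20 e00 by (intro mult_nonneg_nonneg) auto
  have lbar0: "lbar \<ge> 0" using lam_pos Eabs0 by (simp add: lbar_def)
  have \<rho>0: "\<rho> > 0" using mult_nonneg_nonneg[OF lbar0 Cmin0] \<rho>lo by linarith
  \<comment> \<open>If the mean were 0, division by zero would make \<open>lbar\<close> equal to 0
    and leave no room for \<rho>.\<close>
  have Eabs_pos: "Eabs > 0"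
  proof (rule ccontr)
    assume "\<not> Eabs > 0"
    then have "lbar = 0" using Eabs0 by (simp add: lbar_def)
    then show False using \<rho>lo \<rho>hi by simp
  qed
  have lC: "lbar * Cmax = 2 * lam * (1 - 2 * \<mu>) / (7 * Mx)"
    using Eabs_pos by (simp add: lbar_def Cmax_eq)
  \<comment> \<open>The noise condition on \<rho> with \<open>lbar * Cmax\<close> written out, where
    \<open>Eabs\<close> cancels: Meps plus a reserve of 7/2 Mx \<rho> stays below lam (1 -
    2\<mu>).\<close>
  have noise: "Meps < lam * (1 - 2 * \<mu>) - 7/2 * Mx * \<rho>"
  proof -
    have "Meps < 7/2 * (lbar * Cmax - \<rho>) * Mx"
      using \<rho>noise Mx_pos by (simp only: pos_divide_less_eq)
    also have "\<dots> = 7/2 * Mx * (lbar * Cmax) - 7/2 * Mx * \<rho>"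
      by algebra
    also have "7/2 * Mx * (lbar * Cmax) = lam * (1 - 2 * \<mu>)"
      unfolding lC using Mx_pos by simp
    finally show ?thesis .
  qed
  have "0 \<le> lam * (2 * \<mu>)" using \<mu>0 lam_pos by simp
  moreover have "0 < Mx * \<rho>" using \<rho>0 Mx_pos by simp
  ultimately have Meps_lam: "Meps \<le> lam" using noise by (simp add: algebra_simps)

  have x0_off: "x0 \<omega> i = 0" if "\<omega> \<in> space M" "i \<notin> J \<omega>" for \<omega> i
    using x0_supp that by blast
  have xb: "ess_bounded M (\<lambda>\<omega>. x0 \<omega> i)" for i
  proof (rule ess_boundedI[OF x0_meas])
    show "AE \<omega> in M. \<bar>x0 \<omega> i\<bar> \<le> Mx"
      using x0_bound AE_space
    proof eventually_elim
      fix \<omega> assume b: "sqrt (\<Sum>i<p. (x0 \<omega> i)\<^sup>2) \<le> Mx" and \<omega>: "\<omega> \<in> space M"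
      show "\<bar>x0 \<omega> i\<bar> \<le> Mx"
      proof (cases "i < p")
        case True
        have "\<bar>x0 \<omega> i\<bar> \<le> L2_set (\<lambda>i. \<bar>x0 \<omega> i\<bar>) {..<p}"
          using True by (intro member_le_L2_set) auto
        then show ?thesis using b by (simp add: L2_set_def)
      next
        case False
        then have "i \<notin> J \<omega>" using J_range \<omega> by auto
        then show ?thesis using x0_off[OF \<omega>] Mx_pos by simp
      qed
    qed
  qed
  have eb: "ess_bounded M (\<lambda>\<omega>. eps \<omega> i)" if "i < m" for i
  proof (rule ess_boundedI[OF eps_meas])
    show "AE \<omega> in M. \<bar>eps \<omega> i\<bar> \<le> Meps"
      using eps_bound
    proof eventually_elim
      fix \<omega> assume b: "sqrt (\<Sum>i<m. (eps \<omega> i)\<^sup>2) \<le> Meps"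
      have "\<bar>eps \<omega> i\<bar> \<le> L2_set (\<lambda>i. \<bar>eps \<omega> i\<bar>) {..<m}"
        using that by (intro member_le_L2_set) auto
      then show "\<bar>eps \<omega> i\<bar> \<le> Meps" using b by (simp add: L2_set_def)
    qed
  qed
  have sb: "ess_bounded M (\<lambda>\<omega>. sgn (x0 \<omega> i))" for i
    using x0_meas by (intro ess_boundedI[of _ _ 1]) (auto simp: sgn_if)
  have y_meas: "(\<lambda>\<omega>. y \<omega> i) \<in> borel_measurable M" for i
    unfolding y_def using x0_meas eps_meas by measurable
  define Y where "Y = frob m p D0 * Mx + Meps"
  have yY: "AE \<omega> in M. L2_set (y \<omega>) {..<m} \<le> Y"
    using x0_bound eps_bound
  proof eventually_elim
    fix \<omega> assume b: "sqrt (\<Sum>i<p. (x0 \<omega> i)\<^sup>2) \<le> Mx" "sqrt (\<Sum>i<m. (eps \<omega> i)\<^sup>2) \<le> Meps"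
    have "L2_set (y \<omega>) {..<m} \<le> L2_set (\<lambda>i. \<Sum>j<p. D0 i j * x0 \<omega> j) {..<m} + L2_set (eps \<omega>) {..<m}"
      unfolding y_def by (rule L2_set_triangle_ineq)
    also have "\<dots> \<le> frob m p D0 * L2_set (x0 \<omega>) {..<p} + Meps"
      using b(2) by (intro add_mono matvec_le_frob) (simp add: L2_set_def)
    also have "\<dots> \<le> Y"
      unfolding Y_def using b(1) by (intro add_mono mult_left_mono) (auto simp: L2_set_def)
    finally show "L2_set (y \<omega>) {..<m} \<le> Y" .
  qed
  have fb: "ess_bounded M (\<lambda>\<omega>. f_y lam m p (y \<omega>) D)" for D
  proof (rule ess_boundedI)
    show "(\<lambda>\<omega>. f_y lam m p (y \<omega>) D) \<in> borel_measurable M"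
      using lam_pos y_meas by (intro borel_measurable_f_y) auto
    show "AE \<omega> in M. \<bar>f_y lam m p (y \<omega>) D\<bar> \<le> 1/2 * Y\<^sup>2"
      using yY
    proof eventually_elim
      fix \<omega> assume "L2_set (y \<omega>) {..<m} \<le> Y"
      then have "(\<Sum>i<m. (y \<omega> i)\<^sup>2) \<le> Y\<^sup>2"
        unfolding L2_set_power2[symmetric] by (intro power_mono) auto
      then show "\<bar>f_y lam m p (y \<omega>) D\<bar> \<le> 1/2 * Y\<^sup>2"
        using f_y_nonneg[of lam m p "y \<omega>" D] f_y_le_half[of lam m p "y \<omega>" D] lam_pos by simp
    qed
  qed
  have fint: "integrable M (\<lambda>\<omega>. f_y lam m p (y \<omega>) D)" for D
    by (rule ess_bounded_integrable[OF finite_meas fb])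
  have cont: "continuous_on C fP"
  proof (rule continuous_on_frob_modulus)
    fix A B
    define d where "d = frob_dist m p A B"
    define R where "R = Y\<^sup>2 / (2 * lam)"
    have const: "integrable M (\<lambda>_. Y * R * d + 1/2 * (R * d)\<^sup>2)"
      by (rule ess_bounded_integrable[OF finite_meas ess_bounded_const])
    have "fP B \<le> (\<integral>\<omega>. f_y lam m p (y \<omega>) A + (Y * R * d + 1/2 * (R * d)\<^sup>2) \<partial>M)"
      unfolding fP_def
    proof (rule integral_mono_AE[OF fint Bochner_Integration.integrable_add[OF fint const]])
      show "AE \<omega> in M. f_y lam m p (y \<omega>) B \<le> f_y lam m p (y \<omega>) A + (Y * R * d + 1/2 * (R * d)\<^sup>2)"
        using yY
      proof eventually_elim
        fix \<omega> assume "L2_set (y \<omega>) {..<m} \<le> Y"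
        then show "f_y lam m p (y \<omega>) B \<le> f_y lam m p (y \<omega>) A + (Y * R * d + 1/2 * (R * d)\<^sup>2)"
          unfolding R_def d_def by (rule f_y_perturb[OF lam_pos])
      qed
    qed
    also have "\<dots> = fP A + (Y * R * d + 1/2 * (R * d)\<^sup>2)"
      unfolding fP_def
      by (subst Bochner_Integration.integral_add[OF fint const])
        (simp add: prob_space.prob_space[OF PS])
    finally show "fP B \<le> fP A + (Y * R * frob_dist m p A B + 1/2 * R\<^sup>2 * (frob_dist m p A B)\<^sup>2)"
      by (simp add: d_def power_mult_distrib)
  qed

  show "\<exists>Dst. local_min_on C fP (frob_dist m p) Dst \<and> frob_dist m p Dst D0 < \<rho>"
  \<comment> \<open>Without active coefficients the sample is pure noise of norm at most lam. It is
    itself dual feasible for every dictionary in \<open>C\<close>, so each value \<open>f_y\<close>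
    is half its squared norm and \<open>D0\<close> is a minimizer. The moment bounds of the other
    case are read off from a nonempty support.\<close>
  proof (cases "s = 0")
    case True
    have "fP D0 \<le> fP D" if "D \<in> C" for D
      unfolding fP_def
    proof (intro integral_mono_AE fint)
      have D: "D \<in> oblique m p" using C that by blast
      show "AE \<omega> in M. f_y lam m p (y \<omega>) D0 \<le> f_y lam m p (y \<omega>) D"
        using eps_bound AE_space
      proof eventually_elim
        fix \<omega> assume b: "sqrt (\<Sum>i<m. (eps \<omega> i)\<^sup>2) \<le> Meps" and \<omega>: "\<omega> \<in> space M"
        have "J \<omega> = {}"
          using J_range \<omega> True finite_subset[of "J \<omega>" "{..<p}"] by auto
        then have y: "y \<omega> = eps \<omega>" unfolding y_def using x0_off[OF \<omega>] by simp
        have "\<bar>\<Sum>i<m. D i j * y \<omega> i\<bar> \<le> lam" if "j < p" for j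
          using abs_sum_mult_le_L2[of "\<lambda>i. D i j" "y \<omega>" "{..<m}"] column_norm_oblique[OF D that] b Meps_lam
          unfolding y by (simp add: L2_set_def)
        then have "1/2 * (\<Sum>i<m. (y \<omega> i)\<^sup>2) - 1/2 * (\<Sum>i<m. (y \<omega> i - y \<omega> i)\<^sup>2) \<le> f_y lam m p (y \<omega>) D"
          using lam_pos by (intro f_y_ge_dual) auto
        then show "f_y lam m p (y \<omega>) D0 \<le> f_y lam m p (y \<omega>) D"
          using f_y_le_half[of lam m p "y \<omega>" D0] lam_pos by simp
      qed
    qed
    then have "local_min_on C fP (frob_dist m p) D0"
      unfolding local_min_on_def using D0C by (auto intro: exI[of _ 1])
    then show ?thesis using \<rho>0 by (intro exI[of _ D0]) simp
  next
    case False
    then have s1: "s \<ge> 1" by simp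
    have par3': "real s * (16 * L\<^sup>2) \<le> real p"
      using par3 L1 by (simp add: L_def field_simps)
    have "real s * 1 \<le> real s * (16 * L\<^sup>2)"
      using one_le_power[OF L1, of 2] by (intro mult_left_mono) linarith+
    then have sp: "s \<le> p" using par3' by linarith
    have qL: "q * L\<^sup>2 \<le> 1/16"
      using par3' p1 by (simp add: q_def field_simps)
    have P0: "1 / real (p choose s) \<noteq> 0" using sp by simp
    have JS: "measure M {\<omega> \<in> space M. J \<omega> = S} = 1 / real (p choose s)" if "S \<in> supports p s" for S
      using that J_unif by (simp add: supports_def)
    have Jin: "J \<omega> \<in> supports p s" if "\<omega> \<in> space M" for \<omega>
      using J_range that by (simp add: supports_def)
    \<comment> \<open>The moments of \<open>xr\<close> are tied to lam through one coordinate of one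
      support: given J = S, the entry of \<open>x0\<close> at 0 is at least xlow \<ge> 4 lam in
      absolute value, and its conditional first absolute and second moments are \<open>Eabs\<close>
      and \<open>Ex2\<close>.\<close>
    have xx_low: "4 * lam \<le> Eabs \<and> 4 * lam * Eabs \<le> Ex2"
    proof -
      define S where "S = {..<s}"
      have S: "S \<subseteq> {..<p}" "card S = s" "0 \<in> S" "S \<in> supports p s"
        using sp s1 by (auto simp: S_def supports_def)
      have Sx: "cexpJ M J S (\<lambda>\<omega>. \<bar>x0 \<omega> 0\<bar>) = Eabs"
        using coef_sx[OF S(1,2,3,3)] by (simp add: abs_sgn mult.commute)
      have Sxx: "cexpJ M J S (\<lambda>\<omega>. x0 \<omega> 0 * x0 \<omega> 0) = Ex2"
        using coef_xx[OF S(1,2,3,3)] by simp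
      have absb: "ess_bounded M (\<lambda>\<omega>. \<bar>x0 \<omega> 0\<bar>)"
        using ess_bounded_mult[OF sb xb, of 0 0] by (simp add: abs_sgn mult.commute)
      have low: "AE \<omega> in M. J \<omega> = S \<longrightarrow> 4 * lam \<le> \<bar>x0 \<omega> 0\<bar>"
        using x0_low
      proof eventually_elim
        fix \<omega> assume "\<forall>j\<in>J \<omega>. xlow \<le> \<bar>x0 \<omega> j\<bar>"
        then show "J \<omega> = S \<longrightarrow> 4 * lam \<le> \<bar>x0 \<omega> 0\<bar>" using S(3) par2 by fastforce
      qed
      have "cexpJ M J S (\<lambda>_. 4 * lam) \<le> cexpJ M J S (\<lambda>\<omega>. \<bar>x0 \<omega> 0\<bar>)"
        by (intro cexpJ_mono ess_bounded_const absb low)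
      moreover have "cexpJ M J S (\<lambda>_. 4 * lam) = 4 * lam"
        using JS[OF S(4)] P0 by (intro cexpJ_const) simp
      moreover have "cexpJ M J S (\<lambda>\<omega>. 4 * lam * \<bar>x0 \<omega> 0\<bar>) \<le> cexpJ M J S (\<lambda>\<omega>. x0 \<omega> 0 * x0 \<omega> 0)"
      proof (intro cexpJ_mono ess_bounded_cmult absb ess_bounded_mult xb)
        show "AE \<omega> in M. J \<omega> = S \<longrightarrow> 4 * lam * \<bar>x0 \<omega> 0\<bar> \<le> x0 \<omega> 0 * x0 \<omega> 0"
          using low
        proof eventually_elim
          fix \<omega> assume "J \<omega> = S \<longrightarrow> 4 * lam \<le> \<bar>x0 \<omega> 0\<bar>"
          then show "J \<omega> = S \<longrightarrow> 4 * lam * \<bar>x0 \<omega> 0\<bar> \<le> x0 \<omega> 0 * x0 \<omega> 0"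
            using mult_right_mono[of "4 * lam" "\<bar>x0 \<omega> 0\<bar>" "\<bar>x0 \<omega> 0\<bar>"] by auto
        qed
      qed
      ultimately show ?thesis unfolding cexpJ_cmult Sx Sxx by simp
    qed
    \<comment> \<open>All s active entries are at least 4 lam in absolute value, which bounds the
      norm of \<open>x0\<close> from below. An almost sure inequality between constants holds
      outright on a probability space.\<close>
    have Mx_low: "4 * lam * sqrt s \<le> Mx"
    proof -
      have "AE \<omega> in M. 4 * lam * sqrt s \<le> Mx"
        using x0_low x0_bound AE_space
      proof eventually_elim
        fix \<omega> assume low: "\<forall>j\<in>J \<omega>. xlow \<le> \<bar>x0 \<omega> j\<bar>" and b: "sqrt (\<Sum>i<p. (x0 \<omega> i)\<^sup>2) \<le> Mx"
          and \<omega>: "\<omega> \<in> space M"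
        have "real s * (4 * lam)\<^sup>2 = (\<Sum>j\<in>J \<omega>. (4 * lam)\<^sup>2)"
          using J_range \<omega> by simp
        also have "\<dots> \<le> (\<Sum>j\<in>J \<omega>. (x0 \<omega> j)\<^sup>2)"
        proof (intro sum_mono)
          fix j assume "j \<in> J \<omega>"
          then have "\<bar>4 * lam\<bar> \<le> \<bar>x0 \<omega> j\<bar>" using low par2 lam_pos by fastforce
          then show "(4 * lam)\<^sup>2 \<le> (x0 \<omega> j)\<^sup>2" by (simp only: abs_le_square_iff)
        qed
        also have "\<dots> \<le> (\<Sum>j<p. (x0 \<omega> j)\<^sup>2)"
          using J_range \<omega> by (intro sum_mono2) auto
        finally have "sqrt (real s * (4 * lam)\<^sup>2) \<le> sqrt (\<Sum>j<p. (x0 \<omega> j)\<^sup>2)"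
          by (rule real_sqrt_le_mono)
        then show "4 * lam * sqrt s \<le> Mx"
          using b lam_pos by (simp add: real_sqrt_mult mult.commute)
      qed
      then show ?thesis using prob_space.AE_const[OF PS] by blast
    qed
    \<comment> \<open>The bound \<rho> < lbar Cmax carries the factor 2 lam/(7 Mx); with Mx \<ge> 4
      lam sqrt s this becomes 1/(14 sqrt s).\<close>
    have \<rho>s: "14 * (sqrt s * \<rho>) \<le> 1 - 2 * \<mu>"
    proof -
      have "7 * Mx * \<rho> < 2 * lam * (1 - 2 * \<mu>)"
        using \<rho>hi Mx_pos unfolding lC by (simp add: field_simps)
      moreover have "(4 * lam * sqrt s) * \<rho> \<le> Mx * \<rho>"
        using Mx_low \<rho>0 by (intro mult_right_mono) auto
      moreover have "(2 * lam) * (14 * (sqrt s * \<rho>)) = 7 * ((4 * lam * sqrt s) * \<rho>)"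
        by simp
      ultimately have "(2 * lam) * (14 * (sqrt s * \<rho>)) \<le> (2 * lam) * (1 - 2 * \<mu>)"
        by linarith
      then show ?thesis using lam_pos by simp
    qed
    have gap: "24 * lam * Eabs * q * L\<^sup>2 * e0 < Ex2 * \<rho>"
    proof -
      have Ex2_pos: "Ex2 > 0"
        using xx_low mult_pos_pos[OF lam_pos Eabs_pos] by linarith
      have "lbar * Cmin = 24 * lam * Eabs * q * L\<^sup>2 * e0 / Ex2"
        using Eabs_pos Ex2_pos by (simp add: lbar_def Cmin_eq field_simps power2_eq_square)
      then have "24 * lam * Eabs * q * L\<^sup>2 * e0 = Ex2 * (lbar * Cmin)"
        using Ex2_pos by simp
      also have "\<dots> < Ex2 * \<rho>"
        using \<rho>lo Ex2_pos by (rule mult_strict_left_mono)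
      finally show ?thesis .
    qed
    show ?thesis
    proof (rule local_min_inside_sphere[OF _ cont D0C \<rho>0])
      show "compact C" using C by blast
      fix D assume DC: "D \<in> C" and dist: "frob_dist m p D D0 = \<rho>"
      have D: "D \<in> oblique m p" using C DC by blast
      define a where "a = \<mu> + 9/4 * sqrt s * \<rho>"
      have a13: "a \<le> 1/3" using \<rho>s \<mu>4 unfolding a_def by linarith
      have cohD: "coherent s m p D a"
        unfolding a_def dist[symmetric] by (rule coherent_perturb[OF D0 D coh \<mu>4])
      \<comment> \<open>One inverse is fixed per support. It does not depend on the outcome, so it
        acts as a constant coefficient in the conditional expectations.\<close>
      define H where "H S = (SOME H. inverse_on S (gram m D D) H)" for S
      define H0 where "H0 S = (SOME H. inverse_on S (gram m D0 D0) H)" for S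
      have domD: "row_dominant S a (gram m D D)" if "S \<in> supports p s" for S
        using that by (intro coherent_row_dominant[OF D cohD]) (auto simp: supports_def)
      have domD0: "row_dominant S (1/4) (gram m D0 D0)" if "S \<in> supports p s" for S
        using that by (intro coherent_row_dominant[OF D0 coh _ _ \<mu>4]) (auto simp: supports_def)
      have inv: "inverse_on S (gram m D D) (H S)" if "S \<in> supports p s" for S
        unfolding H_def by (rule someI_ex[of "inverse_on S (gram m D D)"], rule inverse_on_exists[OF domD[OF that]]) (use a13 in simp)
      have inv0: "inverse_on S (gram m D0 D0) (H0 S)" if "S \<in> supports p s" for S
        unfolding H0_def by (rule someI_ex[of "inverse_on S (gram m D0 D0)"], rule inverse_on_exists[OF domD0[OF that]]) simp
      let ?low = "\<lambda>S. 1/2 * (mean_quad S Ex2 Eabs Eeps2 lam (gram m D0 D0) (gram m D0 D0) (H0 S) -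
        mean_quad S Ex2 Eabs Eeps2 lam (gram m D D) (gram m D D0) (H S))"
      have pos: "0 < (\<Sum>S\<in>supports p s. ?low S)"
        using xx_low \<rho>0 \<rho>s gap qL lam_pos s1 sp inv inv0
        by (intro sum_gap_pos[OF D0 D coh \<mu>0 \<mu>4]) (simp_all add: dist L_def q_def e0_def)
      have "?low S \<le> cexpJ M J S (\<lambda>\<omega>. f_y lam m p (y \<omega>) D) - cexpJ M J S (\<lambda>\<omega>. f_y lam m p (y \<omega>) D0)"
        if S: "S \<in> supports p s" for S
      proof -
        have Sp: "S \<subseteq> {..<p}" "card S = s" using S by (auto simp: supports_def)
        have xe: "cexpJ M J S (\<lambda>\<omega>. x0 \<omega> i * eps \<omega> j) = 0"
          and se: "cexpJ M J S (\<lambda>\<omega>. sgn (x0 \<omega> i) * eps \<omega> j) = 0" if "i \<in> S" "j < m" for i j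
          using noise_xe[OF Sp] noise_se[OF Sp] Sp(1) that by auto
        \<comment> \<open>Stated for an arbitrary dictionary because it is applied at
          \<open>D\<close> and at \<open>D0\<close>; the energy of the sample then cancels in the
          difference.\<close>
        have lv: "cexpJ M J S (\<lambda>\<omega>. lasso_value lam m (y \<omega>) D' S H' (\<lambda>b. sgn (x0 \<omega> b))) =
            cexpJ M J S (\<lambda>\<omega>. 1/2 * (\<Sum>i<m. (y \<omega> i)\<^sup>2)) -
              1/2 * mean_quad S Ex2 Eabs Eeps2 lam (gram m D' D') (gram m D' D0) H'" for D' H'
          by (rule cexpJ_lasso_value(1)[OF Sp(1) xb eb sb x0_off coef_xx[OF Sp] coef_ss[OF Sp]
                coef_sx[OF Sp] noise_ee[OF Sp] xe se y_def]; assumption)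
        have lvb: "ess_bounded M (\<lambda>\<omega>. lasso_value lam m (y \<omega>) D' S H' (\<lambda>b. sgn (x0 \<omega> b)))" for D' H'
          by (rule cexpJ_lasso_value(2)[OF Sp(1) xb eb sb x0_off coef_xx[OF Sp] coef_ss[OF Sp]
                coef_sx[OF Sp] noise_ee[OF Sp] xe se y_def]; assumption)
        have "cexpJ M J S (\<lambda>\<omega>. lasso_value lam m (y \<omega>) D S (H S) (\<lambda>b. sgn (x0 \<omega> b))) \<le>
            cexpJ M J S (\<lambda>\<omega>. f_y lam m p (y \<omega>) D)"
        proof (intro cexpJ_mono lvb fb)
          show "AE \<omega> in M. J \<omega> = S \<longrightarrow>
              lasso_value lam m (y \<omega>) D S (H S) (\<lambda>b. sgn (x0 \<omega> b)) \<le> f_y lam m p (y \<omega>) D"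
            using x0_bound eps_bound AE_space
          proof (eventually_elim, intro impI)
            fix \<omega> assume xM: "sqrt (\<Sum>i<p. (x0 \<omega> i)\<^sup>2) \<le> Mx" and eM: "sqrt (\<Sum>i<m. (eps \<omega> i)\<^sup>2) \<le> Meps"
              and \<omega>: "\<omega> \<in> space M" and JS: "J \<omega> = S"
            \<comment> \<open>Relative to \<open>D\<close> the sample is D x0 plus \<open>w\<close>,
              where \<open>w\<close> collects the noise and the dictionary mismatch; its norm is at
              most Meps + \<rho> Mx.\<close>
            define w where "w i = eps \<omega> i + (\<Sum>j<p. (D0 i j - D i j) * x0 \<omega> j)" for i
            show "lasso_value lam m (y \<omega>) D S (H S) (\<lambda>b. sgn (x0 \<omega> b)) \<le> f_y lam m p (y \<omega>) D"
            proof (rule lasso_value_bounds(1)[OF lam_pos Sp(1) domD[OF S], where x = "x0 \<omega>" and w = w and \<nu> = "Meps + \<rho> * Mx"])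
              show "a < 1" using a13 by simp
              show "(\<Sum>j\<in>S. gram m D D i j * H S j k) = (if i = k then 1 else 0)" if "i \<in> S" "k \<in> S" for i k
                by (rule inverse_on_solves[OF inv[OF S] that])
              show "gram m D D j j = 1" if "j < p" for j by (rule gram_unit[OF D that])
              show "y \<omega> i = (\<Sum>b\<in>S. D i b * x0 \<omega> b) + w i" if "i < m" for i
              proof -
                have "(\<Sum>b\<in>S. D i b * x0 \<omega> b) = (\<Sum>b<p. D i b * x0 \<omega> b)"
                  using Sp x0_off[OF \<omega>] JS by (intro sum.mono_neutral_left) auto
                then show ?thesis by (simp add: y_def w_def left_diff_distrib sum_subtractf)
              qed
              have "L2_set w {..<m} \<le> L2_set (eps \<omega>) {..<m} + L2_set (\<lambda>i. \<Sum>j<p. (D0 i j - D i j) * x0 \<omega> j) {..<m}"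
                unfolding w_def by (rule L2_set_triangle_ineq)
              also have "\<dots> \<le> Meps + frob m p (\<lambda>i j. D0 i j - D i j) * L2_set (x0 \<omega>) {..<p}"
                using eM by (intro add_mono matvec_le_frob) (simp add: L2_set_def)
              also have "frob m p (\<lambda>i j. D0 i j - D i j) = \<rho>"
                using dist unfolding frob_dist_commute[of m p D D0] by (simp add: frob_dist_def)
              also have "Meps + \<rho> * L2_set (x0 \<omega>) {..<p} \<le> Meps + \<rho> * Mx"
                using xM \<rho>0 by (simp add: L2_set_def)
              finally show "L2_set w {..<m} \<le> Meps + \<rho> * Mx" .
              show "\<bar>sgn (x0 \<omega> b)\<bar> \<le> 1" for b by (simp add: sgn_if)
              show "(\<Sum>b\<in>S. \<bar>gram m D D j b\<bar>) \<le> a" if "j < p" "j \<notin> S" for j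
                unfolding gram_commute[of m D D j] using Sp that by (intro coherentD[OF cohD]) auto
              \<comment> \<open>Dual feasibility at \<open>D\<close> costs \<rho> Mx for the
                mismatch and 9/2 lam sqrt s \<rho> \<le> 9/8 \<rho> Mx for the growth of the
                coherence; the total 17/8 \<rho> Mx is covered by the 7/2 Mx \<rho> reserved in
                \<open>noise\<close>.\<close>
              have "(4 * lam * sqrt s) * \<rho> \<le> Mx * \<rho>"
                using Mx_low \<rho>0 by (intro mult_right_mono) auto
              moreover have "0 \<le> lam * sqrt s * \<rho>" using lam_pos \<rho>0 by simp
              moreover have "lam * (1 - 2 * a) = lam * (1 - 2 * \<mu>) - 9/2 * (lam * sqrt s * \<rho>)"
                by (simp add: a_def algebra_simps)
              ultimately show "Meps + \<rho> * Mx \<le> lam * (1 - 2 * a)"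
                using noise by (simp add: mult.commute[of \<rho>])
            qed
          qed
        qed
        moreover have "cexpJ M J S (\<lambda>\<omega>. f_y lam m p (y \<omega>) D0) \<le>
            cexpJ M J S (\<lambda>\<omega>. lasso_value lam m (y \<omega>) D0 S (H0 S) (\<lambda>b. sgn (x0 \<omega> b)))"
        proof (intro cexpJ_mono lvb fb)
          show "AE \<omega> in M. J \<omega> = S \<longrightarrow>
              f_y lam m p (y \<omega>) D0 \<le> lasso_value lam m (y \<omega>) D0 S (H0 S) (\<lambda>b. sgn (x0 \<omega> b))"
            using x0_low eps_bound AE_space
          proof (eventually_elim, intro impI)
            fix \<omega> assume low: "\<forall>j\<in>J \<omega>. xlow \<le> \<bar>x0 \<omega> j\<bar>" and eM: "sqrt (\<Sum>i<m. (eps \<omega> i)\<^sup>2) \<le> Meps"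
              and \<omega>: "\<omega> \<in> space M" and JS: "J \<omega> = S"
            show "f_y lam m p (y \<omega>) D0 \<le> lasso_value lam m (y \<omega>) D0 S (H0 S) (\<lambda>b. sgn (x0 \<omega> b))"
            proof (rule lasso_value_bounds(2)[OF lam_pos Sp(1) domD0[OF S], where x = "x0 \<omega>" and w = "eps \<omega>" and \<nu> = Meps])
              show "(\<Sum>j\<in>S. gram m D0 D0 i j * H0 S j k) = (if i = k then 1 else 0)" if "i \<in> S" "k \<in> S" for i k
                by (rule inverse_on_solves[OF inv0[OF S] that])
              show "gram m D0 D0 j j = 1" if "j < p" for j by (rule gram_unit[OF D0 that])
              show "y \<omega> i = (\<Sum>b\<in>S. D0 i b * x0 \<omega> b) + eps \<omega> i" if "i < m" for i
              proof -
                have "(\<Sum>b\<in>S. D0 i b * x0 \<omega> b) = (\<Sum>b<p. D0 i b * x0 \<omega> b)"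
                  using Sp x0_off[OF \<omega>] JS by (intro sum.mono_neutral_left) auto
                then show ?thesis by (simp add: y_def)
              qed
              show "L2_set (eps \<omega>) {..<m} \<le> Meps" using eM by (simp add: L2_set_def)
              show "\<bar>sgn (x0 \<omega> b)\<bar> \<le> 1" for b by (simp add: sgn_if)
              \<comment> \<open>With Meps \<le> lam the left side is at most 8/3 lam, below 4 lam
                \<le> xlow.\<close>
              show "(Meps + lam) / (1 - 1/4) \<le> \<bar>x0 \<omega> b\<bar>" if "b \<in> S" for b
                using low that JS par2 Meps_lam lam_pos by fastforce
            qed simp_all
          qed
        qed
        ultimately show ?thesis unfolding lv right_diff_distrib by linarith
      qed
      then have "0 < (\<Sum>S\<in>supports p s. cexpJ M J S (\<lambda>\<omega>. f_y lam m p (y \<omega>) D) -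
          cexpJ M J S (\<lambda>\<omega>. f_y lam m p (y \<omega>) D0))"
        by (intro less_le_trans[OF pos] sum_mono)
      moreover have "fP D' = 1 / real (p choose s) * (\<Sum>S\<in>supports p s. cexpJ M J S (\<lambda>\<omega>. f_y lam m p (y \<omega>) D'))" for D'
        unfolding fP_def by (rule integral_eq_sum_cexpJ[OF fb finite_supports Jin JS P0])
      ultimately show "fP D0 < fP D"
        using sp by (simp add: sum_subtractf divide_strict_right_mono)
    qed
  qed
qed


end
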